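(* Let $0<a<b$ and $k\in(0,1)$. Denote by $\mathcal{F}'$ the class of $\mathcal{C}^2$ contact (orientation-preserving) quasiconformal maps $f:S_{a,b}\to S_{a^k,b^k}$ which preserve the vertical axis $\{(0,t)\}$ and map the boundary components of $S_{a,b}$ to the respective boundary components of $S_{a^k,b^k}$. Let $$\rho_0(z,t)=\frac{1}{4\pi\log(b/a)}\cdot\frac{1}{|z|\cdot\left||z|^2-it\right|}\cdot\mathcal{X}(S_{a,b})(z,t),\qquad (z,t)\in\mathfrak{H},$$ where $\mathcal{X}(S_{a,b})$ is the characteristic function of $S_{a,b}$. Then, up to composition with rotations $(z,t)\mapsto(ze^{i\theta},t)$ around the vertical axis, the stretch map $f_k$ minimises the $2/3$-mean distortion $\mathfrak{M}_{2/3}(\cdot,\rho_0)$ within the class $\mathcal{F}'$: for any $f\in\mathcal{F}'$ we have $$k^{-1/3}=K_{f_k}^{1/6}=\mathfrak{M}_{2/3}(f_k,\rho_0)\le\mathfrak{M}_{2/3}(f,\rho_0).$$ Moreover, $K_f\ge K_{f_k}^{1/4}$ for any $f\in\mathcal{F}'$.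
   Context: The Heisenberg group $\mathfrak{H}$ is $\mathbb{C}\times\mathbb{R}$ with group law $(z,t)*(w,s)=(z+w,t+s+2\Im(\overline{w}z))$ and contact form $\omega=dt+2\Im(\overline{z}dz)=dt+2x\,dy-2y\,dx$, $z=x+iy$. Let $X=\partial_x+2y\,\partial_t$, $Y=\partial_y-2x\,\partial_t$, $Z=\frac12(X-iY)$, $\overline{Z}=\frac12(X+iY)$. A contact transformation is a diffeomorphism $f=(f_I,f_3):\Omega\to\Omega'$ between domains of $\mathfrak{H}$ ($f_I=f_1+if_2$ the $\mathbb{C}$-component) with $f^*\omega=\lambda\omega$ for a non-vanishing real function $\lambda$; orientation-preserving means $\lambda>0$, and then $\lambda=|Zf_I|^2-|\overline{Z}f_I|^2=J_f^{1/2}$ with $J_f$ the Jacobian determinant. A $\mathcal{C}^2$ orientation-preserving contact transformation $f$ has Beltrami coefficient $\mu_f=\overline{Z}f_I/Zf_I$, distortion function $$K_f(p)=\frac{1+|\mu_f(p)|}{1-|\mu_f(p)|}=\frac{|Zf_I(p)|+|\overline{Z}f_I(p)|}{|Zf_I(p)|-|\overline{Z}f_I(p)|},$$ and maximal distortion $K_f=\mathrm{ess\,sup}_{p}K_f(p)$; it is quasiconformal if and only if $K_f<\infty$ (equivalently $\|\mu_f\|_\infty<1$). For $0<a<b$, the Heisenberg spherical ring is $S_{a,b}=\{(z,t)\in\mathfrak{H}: a^4<|z|^4+t^2<b^4\}$; its boundary components are $\{|z|^4+t^2=a^4\}$ and $\{|z|^4+t^2=b^4\}$ (inner and outer). "Respective"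 means inner to inner and outer to outer. Logarithmic coordinates: off the vertical axis, every point of $\mathfrak{H}$ is $\Phi(\xi,\psi,\eta)=\left(i\cos^{1/2}\psi\; e^{\frac{\xi+i(\psi-3\eta)}{2}},\,-\sin\psi\; e^{\xi}\right)$ with $\xi\in\mathbb{R}$, $\psi\in(-\pi/2,\pi/2)$ unique and $\eta\in\mathbb{R}$ unique modulo $4\pi/3$. The stretch map $f_k$ is defined by $$f_k(\Phi(\xi,\psi,\eta))=\Phi\left(k\xi,\arctan\left(\tfrac{\tan\psi}{k}\right),\eta\right),$$ extended continuously to the punctured vertical axis by $f_k(0,t)=(0,t|t|^{k-1})$; it is restricted to $S_{a,b}$. Its maximal distortion is $K_{f_k}=k^{-2}$. For a quasiconformal $f$ on $\Omega$ and a non-negative Borel function $\rho$ on $\Omega$, the $2/3$-mean distortion is $$\mathfrak{M}_{2/3}(f,\rho)=\frac{\iiint_\Omega K_f^{2/3}(p)\rho^{4/3}(p)\,d\mathcal{L}^3(p)}{\iiint_\Omega \rho^{4/3}(p)\,d\mathcal{L}^3(p)},$$ where $\mathcal{L}^3$ is Lebesgue measure on $\mathbb{R}^3$; here $\Omega=S_{a,b}$. *)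

theory Defs
  imports "HOL-Probability.Essential_Supremum"
begin

text \<open>
  Points of the Heisenberg group are pairs \<open>(z, t)\<close> of type \<^typ>\<open>complex \<times> real\<close>; the Euclidean
  structure of that type is the one of \<open>\<real>\<^sup>3\<close>, so \<^const>\<open>lborel\<close> on it is three-dimensional
  Lebesgue measure and Frechet derivatives are taken with respect to \<open>(x, y, t)\<close>, \<open>z = x + i y\<close>.
\<close>

type_synonym heis = "complex \<times> real"

section \<open>Contact structure\<close>

text \<open>The value at \<open>p\<close> of \<open>\<omega> = dt + 2 Im (cnj z dz)\<close> on the tangent vector \<open>v\<close>.\<close>

definition contact_form :: "heis \<Rightarrow> heis \<Rightarrow> real" where
  "contact_form p v = snd v + 2 * Im (cnj (fst p) * fst v)"

definition partial_x :: "(heis \<Rightarrow> complex) \<Rightarrow> heis \<Rightarrow> complex" where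
  "partial_x g p = frechet_derivative g (at p) (1, 0)"

definition partial_y :: "(heis \<Rightarrow> complex) \<Rightarrow> heis \<Rightarrow> complex" where
  "partial_y g p = frechet_derivative g (at p) (\<i>, 0)"

definition partial_t :: "(heis \<Rightarrow> complex) \<Rightarrow> heis \<Rightarrow> complex" where
  "partial_t g p = frechet_derivative g (at p) (0, 1)"

definition X_field :: "(heis \<Rightarrow> complex) \<Rightarrow> heis \<Rightarrow> complex" where
  "X_field g p = partial_x g p + of_real (2 * Im (fst p)) * partial_t g p"

definition Y_field :: "(heis \<Rightarrow> complex) \<Rightarrow> heis \<Rightarrow> complex" where
  "Y_field g p = partial_y g p - of_real (2 * Re (fst p)) * partial_t g p"

definition Z_field :: "(heis \<Rightarrow> complex) \<Rightarrow> heis \<Rightarrow> complex" where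
  "Z_field g p = (X_field g p - \<i> * Y_field g p) / 2"

definition Zbar_field :: "(heis \<Rightarrow> complex) \<Rightarrow> heis \<Rightarrow> complex" where
  "Zbar_field g p = (X_field g p + \<i> * Y_field g p) / 2"

section \<open>Contact and quasiconformal maps\<close>

text \<open>Continuous second derivative on an open set; \<open>D\<close> and \<open>D2\<close> are the first and second
  Frechet derivatives.\<close>

definition C2_on :: "'a::real_normed_vector set \<Rightarrow> ('a \<Rightarrow> 'b::real_normed_vector) \<Rightarrow> bool" where
  "C2_on \<Omega> f \<longleftrightarrow> (\<exists>(D :: 'a \<Rightarrow> 'a \<Rightarrow>\<^sub>L 'b) (D2 :: 'a \<Rightarrow> 'a \<Rightarrow>\<^sub>L ('a \<Rightarrow>\<^sub>L 'b)).
     (\<forall>p\<in>\<Omega>. (f has_derivative blinfun_apply (D p)) (at p)) \<and>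
     (\<forall>p\<in>\<Omega>. (D has_derivative blinfun_apply (D2 p)) (at p)) \<and>
     continuous_on \<Omega> D2)"

definition C2_diffeomorphism :: "heis set \<Rightarrow> heis set \<Rightarrow> (heis \<Rightarrow> heis) \<Rightarrow> bool" where
  "C2_diffeomorphism \<Omega> \<Omega>' f \<longleftrightarrow>
     bij_betw f \<Omega> \<Omega>' \<and> C2_on \<Omega> f \<and> C2_on \<Omega>' (inv_into \<Omega> f)"

text \<open>Orientation-preserving \<open>C\<^sup>2\<close> contact transformations between domains \<open>\<Omega>\<close> and \<open>\<Omega>'\<close>:
  the pullback of the contact form is \<open>\<lambda>\<close> times the contact form, with \<open>\<lambda> > 0\<close>. As for all
  notions below, only the values of \<open>f\<close> on \<open>\<Omega>\<close> matter.\<close>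

definition op_contact_transformation :: "heis set \<Rightarrow> heis set \<Rightarrow> (heis \<Rightarrow> heis) \<Rightarrow> bool" where
  "op_contact_transformation \<Omega> \<Omega>' f \<longleftrightarrow>
     C2_diffeomorphism \<Omega> \<Omega>' f \<and>
     (\<exists>l :: heis \<Rightarrow> real. (\<forall>p\<in>\<Omega>. 0 < l p) \<and>
       (\<forall>p\<in>\<Omega>. \<forall>v. contact_form (f p) (frechet_derivative f (at p) v) = l p * contact_form p v))"

definition beltrami :: "(heis \<Rightarrow> heis) \<Rightarrow> heis \<Rightarrow> complex" where
  "beltrami f p = Zbar_field (\<lambda>q. fst (f q)) p / Z_field (\<lambda>q. fst (f q)) p"

definition distortion :: "(heis \<Rightarrow> heis) \<Rightarrow> heis \<Rightarrow> real" where
  "distortion f p = (1 + norm (beltrami f p)) / (1 - norm (beltrami f p))"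

definition max_distortion :: "heis set \<Rightarrow> (heis \<Rightarrow> heis) \<Rightarrow> ereal" where
  "max_distortion \<Omega> f = esssup (restrict_space lborel \<Omega>) (\<lambda>p. ereal (distortion f p))"

definition contact_quasiconformal :: "heis set \<Rightarrow> heis set \<Rightarrow> (heis \<Rightarrow> heis) \<Rightarrow> bool" where
  "contact_quasiconformal \<Omega> \<Omega>' f \<longleftrightarrow>
     op_contact_transformation \<Omega> \<Omega>' f \<and> max_distortion \<Omega> f < \<infinity>"

text \<open>The integrals are taken in \<open>[0, \<infinity>]\<close>, so no integrability is presupposed.\<close>

definition mean_distortion_2_3 :: "heis set \<Rightarrow> (heis \<Rightarrow> heis) \<Rightarrow> (heis \<Rightarrow> real) \<Rightarrow> ennreal" where
  "mean_distortion_2_3 \<Omega> f \<rho> =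
     (\<integral>\<^sup>+p\<in>\<Omega>. ennreal (distortion f p powr (2/3) * \<rho> p powr (4/3)) \<partial>lborel) /
     (\<integral>\<^sup>+p\<in>\<Omega>. ennreal (\<rho> p powr (4/3)) \<partial>lborel)"

section \<open>Spherical rings\<close>

definition spherical_ring :: "real \<Rightarrow> real \<Rightarrow> heis set" where
  "spherical_ring a b = {(z, t). a^4 < norm z ^ 4 + t\<^sup>2 \<and> norm z ^ 4 + t\<^sup>2 < b^4}"

definition koranyi_sphere :: "real \<Rightarrow> heis set" where
  "koranyi_sphere r = {(z, t). norm z ^ 4 + t\<^sup>2 = r^4}"

definition vertical_axis :: "heis set" where
  "vertical_axis = {(z, t). z = 0}"

text \<open>Since \<open>f\<close> is only given on the open set \<open>\<Omega>\<close>, ``\<open>f\<close> maps the boundary component \<open>B\<close> to the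
  boundary component \<open>B'\<close>'' means that \<open>f p\<close> approaches \<open>B'\<close> as \<open>p \<in> \<Omega>\<close> approaches a point
  of \<open>B\<close>.\<close>

definition maps_boundary :: "heis set \<Rightarrow> (heis \<Rightarrow> heis) \<Rightarrow> heis set \<Rightarrow> heis set \<Rightarrow> bool" where
  "maps_boundary \<Omega> f B B' \<longleftrightarrow> (\<forall>q\<in>B. ((\<lambda>p. infdist (f p) B') \<longlongrightarrow> 0) (at q within \<Omega>))"

text \<open>The axis condition is that \<open>f\<close> maps the part of the axis in the source ring onto its part in
  the target ring.\<close>

definition ring_maps :: "real \<Rightarrow> real \<Rightarrow> real \<Rightarrow> (heis \<Rightarrow> heis) set" where
  "ring_maps a b k = {f.
     contact_quasiconformal (spherical_ring a b) (spherical_ring (a powr k) (b powr k)) f \<and>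
     f ` (vertical_axis \<inter> spherical_ring a b) =
       vertical_axis \<inter> spherical_ring (a powr k) (b powr k) \<and>
     maps_boundary (spherical_ring a b) f (koranyi_sphere a) (koranyi_sphere (a powr k)) \<and>
     maps_boundary (spherical_ring a b) f (koranyi_sphere b) (koranyi_sphere (b powr k))}"

definition rho0 :: "real \<Rightarrow> real \<Rightarrow> heis \<Rightarrow> real" where
  "rho0 a b = (\<lambda>(z, t). 1 / (4 * pi * ln (b / a)) *
     (1 / (norm z * norm (complex_of_real ((norm z)\<^sup>2) - \<i> * complex_of_real t))) *
     indicator (spherical_ring a b) (z, t))"

definition rotation :: "real \<Rightarrow> heis \<Rightarrow> heis" where
  "rotation \<theta> = (\<lambda>(z, t). (z * exp (\<i> * complex_of_real \<theta>), t))"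

section \<open>Logarithmic coordinates and the stretch map\<close>

definition log_coords :: "real \<Rightarrow> real \<Rightarrow> real \<Rightarrow> heis" where
  "log_coords \<xi> \<psi> \<eta> =
     (\<i> * complex_of_real (sqrt (cos \<psi>)) * exp (Complex \<xi> (\<psi> - 3 * \<eta>) / 2), - sin \<psi> * exp \<xi>)"

text \<open>Off the vertical axis the coordinate \<open>\<eta>\<close> is only unique modulo \<open>4 \<pi> / 3\<close>, but the image
  point does not depend on it; see \<open>stretch_log_coords\<close> below.\<close>

definition stretch :: "real \<Rightarrow> heis \<Rightarrow> heis" where
  "stretch k p =
     (if p \<in> vertical_axis then (0, snd p * \<bar>snd p\<bar> powr (k - 1))
      else (THE q. \<exists>\<xi> \<psi> \<eta>. - pi / 2 < \<psi> \<and> \<psi> < pi / 2 \<and> p = log_coords \<xi> \<psi> \<eta> \<and>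
              q = log_coords (k * \<xi>) (arctan (tan \<psi> / k)) \<eta>))"

lemma log_coords_gauge:
  assumes "- pi / 2 < \<psi>" "\<psi> < pi / 2"
  shows "norm (fst (log_coords \<xi> \<psi> \<eta>)) ^ 4 + (snd (log_coords \<xi> \<psi> \<eta>))\<^sup>2 = exp (2 * \<xi>)"
proof -
  have c: "0 < cos \<psi>" using assms by (intro cos_gt_zero_pi) auto
  have "norm (fst (log_coords \<xi> \<psi> \<eta>)) ^ 4 = (sqrt (cos \<psi>))^4 * exp (\<xi> / 2) ^ 4"
    using c by (simp add: log_coords_def norm_mult norm_exp_eq_Re power_mult_distrib)
  also have "(sqrt (cos \<psi>))^4 = ((sqrt (cos \<psi>))\<^sup>2)\<^sup>2" by (simp flip: power_mult)
  also have "\<dots> = (cos \<psi>)\<^sup>2" using c by simp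
  also have "exp (\<xi> / 2) ^ 4 = exp (2 * \<xi>)" by (simp flip: exp_of_nat_mult)
  finally have "norm (fst (log_coords \<xi> \<psi> \<eta>)) ^ 4 = (cos \<psi>)\<^sup>2 * exp (2 * \<xi>)" .
  moreover have "(snd (log_coords \<xi> \<psi> \<eta>))\<^sup>2 = (sin \<psi>)\<^sup>2 * exp (2 * \<xi>)"
    by (simp add: log_coords_def power_mult_distrib flip: exp_double)
  ultimately show ?thesis
    by (simp flip: distrib_right)
qed

lemma log_coords_eqD:
  assumes "- pi / 2 < \<psi>" "\<psi> < pi / 2" "- pi / 2 < \<psi>'" "\<psi>' < pi / 2"
    and eq: "log_coords \<xi> \<psi> \<eta> = log_coords \<xi>' \<psi>' \<eta>'"
  shows "\<xi> = \<xi>'" "\<psi> = \<psi>'" "log_coords r s \<eta> = log_coords r s \<eta>'"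
proof -
  have "exp (2 * \<xi>) = exp (2 * \<xi>')"
    using log_coords_gauge[of \<psi> \<xi> \<eta>] log_coords_gauge[of \<psi>' \<xi>' \<eta>'] assms by simp
  thus xi: "\<xi> = \<xi>'" by simp
  have "sin \<psi> = sin \<psi>'" using eq xi by (simp add: log_coords_def)
  thus psi: "\<psi> = \<psi>'"
    using assms by (simp add: sin_inj_pi)
  have c: "0 < cos \<psi>" using assms by (intro cos_gt_zero_pi) auto
  have split: "exp (Complex u (v - 3 * w) / 2) =
      exp (Complex (u - \<xi>) (v - \<psi>) / 2) * exp (Complex \<xi> (\<psi> - 3 * w) / 2)" for u v w
    by (simp add: complex_eq_iff flip: exp_add)
       (simp add: Re_exp Im_exp flip: exp_add; simp add: field_simps)
  have "exp (Complex \<xi> (\<psi> - 3 * \<eta>) / 2) = exp (Complex \<xi> (\<psi> - 3 * \<eta>') / 2)"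
    using eq c unfolding xi[symmetric] psi[symmetric] by (auto simp: log_coords_def)
  thus "log_coords r s \<eta> = log_coords r s \<eta>'"
    unfolding log_coords_def split[of r s \<eta>] split[of r s \<eta>'] by simp
qed

lemma stretch_log_coords:
  assumes psi: "- pi / 2 < \<psi>" "\<psi> < pi / 2"
  shows "stretch k (log_coords \<xi> \<psi> \<eta>) = log_coords (k * \<xi>) (arctan (tan \<psi> / k)) \<eta>"
proof -
  have c: "0 < cos \<psi>" using psi by (intro cos_gt_zero_pi) auto
  hence off: "log_coords \<xi> \<psi> \<eta> \<notin> vertical_axis"
    by (simp add: log_coords_def vertical_axis_def)
  show ?thesis
    unfolding stretch_def if_not_P[OF off]
  proof (rule the_equality)
    fix q
    assume "\<exists>\<xi>' \<psi>' \<eta>'. - pi / 2 < \<psi>' \<and> \<psi>' < pi / 2 \<and> log_coords \<xi> \<psi> \<eta> = log_coords \<xi>' \<psi>' \<eta>' \<and>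
              q = log_coords (k * \<xi>') (arctan (tan \<psi>' / k)) \<eta>'"
    thus "q = log_coords (k * \<xi>) (arctan (tan \<psi> / k)) \<eta>"
      using log_coords_eqD[OF psi] by metis
  qed (use psi in blast)
qed

end

theory Submission
  imports Defs
begin

text \<open>
For \<open>p = (z, t)\<close> put \<open>N = (|z|\<^sup>4 + t\<^sup>2)^(1/2)\<close> (\<open>gauge\<close>) and \<open>r = 1 / (|z| N)\<close>
(\<open>radial_density\<close>); on the ring \<open>\<rho>\<^sub>0\<close> is a constant multiple of \<open>r\<close>. In logarithmic coordinates, with
\<open>u = tan \<psi>\<close> in place of \<open>\<psi>\<close>, Lebesgue measure is \<open>(3/4) |z|\<^sup>4 d\<xi> d\<eta> du\<close> and the lines
\<open>u \<mapsto> (\<xi>, u, \<eta>)\<close> are horizontal curves. Each of them lies on a gauge sphere and joins its two poles,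
which lie on the two halves of the vertical axis.

\<^emph>\<open>Lower bound.\<close> A map \<open>f\<close> of the class is a homeomorphism that carries the axis onto the axis, so
it either preserves or exchanges the two halves of the axis (\<open>axis_sides\<close>). Along the image of each
of the curves the slope \<open>-t / |z|\<^sup>2\<close> therefore runs from one infinity to the other, and the
integral of \<open>(1 + slope\<^sup>2)^(-2/3)\<close> against the variation of the slope is at least
\<open>J = \<integral> (1 + u\<^sup>2)^(-2/3) du\<close> (\<open>nn_integral_path_ge\<close>). A horizontal vector is
stretched by at most \<open>(K \<lambda>)^(1/2)\<close>, where \<open>K\<close> is the distortion and \<open>\<lambda>\<close> the dilation of
\<open>f\<close>; this gives \<open>J \<le> \<integral> r(f)^(1/3) (K \<lambda>)^(1/2) |z|\<^sup>3 / N du\<close> on every curve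
(\<open>curve_estimate\<close>). Integrated over \<open>(\<xi>, \<eta>)\<close>, the left side becomes a multiple of
\<open>m = \<integral> r^(4/3)\<close> over the ring, and the right side is bounded by Young's inequality
\<open>x y \<le> x\<^sup>4 / (4 k) + (3/4) k^(1/3) y^(4/3)\<close> with \<open>x = r(f)^(1/3) \<lambda>^(1/2)\<close> and
\<open>y = K^(1/2) r\<close>. The Jacobian of \<open>f\<close> is \<open>\<lambda>\<^sup>2\<close>, so the integral of \<open>x\<^sup>4\<close> is the integral of
\<open>r^(4/3)\<close> over the image ring, which is \<open>k m\<close>. With \<open>M = \<integral> K^(2/3) r^(4/3)\<close> the
outcome is \<open>m \<le> m / 4 + (3/4) k^(1/3) M\<close>, that is, \<open>M \<ge> k^(-1/3) m\<close>
(\<open>distortion_integral_ge\<close>). As \<open>M\<close> is at most the \<open>2/3\<close>-rd power of the maximal distortion times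
\<open>m\<close>, the bound for the maximal distortion follows.

\<^emph>\<open>Equality.\<close> The stretch map acts by \<open>(\<xi>, u, \<eta>) \<mapsto> (k \<xi>, u / k, \<eta>)\<close> and has
\<open>K = (1 + u\<^sup>2) / (k\<^sup>2 + u\<^sup>2)\<close>, so that the substitution \<open>u = k v\<close> gives
\<open>M = k^(-1/3) m\<close>; the weights in Young's inequality are those for which it is an equality in this
case.

Two points need more than calculus in the chart. That \<open>\<lambda> = |Z f\<^sub>I|\<^sup>2 - |Zbar f\<^sub>I|\<^sup>2\<close> for every
contact map of class \<open>C\<^sup>2\<close> is the comparison of \<open>d\<omega>\<close> with its pullback, and rests on the symmetry of
second derivatives (\<open>dilation_horizontal\<close>). And the logarithmic coordinates degenerate on the axis, so
that the regularity of the stretch map there is read off from a closed formula in \<open>z\<close> and \<open>t\<close>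
(\<open>smooth_stretch\<close>).
\<close>

section \<open>Change of variables in three-dimensional Lebesgue integrals\<close>

text \<open>
Such a map pulls boxes back to boxes with the same edge lengths, and Lebesgue measure is determined
by its values on boxes. This moves statements about \<open>\<real>\<^sup>3\<close> as a type of vectors to \<open>\<complex> \<times> \<real>\<close>.
\<close>

lemma distr_basis_isometry:
  fixes e :: "'a::euclidean_space \<Rightarrow> 'b::euclidean_space"
  assumes lin: "linear e" and bas: "bij_betw e Basis Basis"
  shows "distr lborel borel e = lborel"
proof (rule lborel_eqI[symmetric])
  have [measurable]: "e \<in> borel_measurable borel"
    using lin by (intro borel_measurable_continuous_onI linear_continuous_on linear_conv_bounded_linear[THEN iffD1])
  have inner: "e x \<bullet> e b = x \<bullet> b" if b: "b \<in> Basis" for x b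
  proof -
    have "e x = (\<Sum>c\<in>Basis. (x \<bullet> c) *\<^sub>R e c)"
      by (subst euclidean_representation[of x, symmetric], simp add: linear_sum[OF lin] linear_cmul[OF lin])
    hence "e x \<bullet> e b = (\<Sum>c\<in>Basis. (x \<bullet> c) * (e c \<bullet> e b))"
      by (simp add: inner_sum_left)
    also have "\<dots> = (\<Sum>c\<in>Basis. (x \<bullet> c) * (if c = b then 1 else 0))"
    proof (rule sum.cong)
      fix c :: 'a assume "c \<in> Basis"
      moreover have "e c \<in> Basis" "e b \<in> Basis" "e c = e b \<longleftrightarrow> c = b"
        using bas b \<open>c \<in> Basis\<close> by (auto simp: bij_betw_def inj_on_def)
      ultimately show "(x \<bullet> c) * (e c \<bullet> e b) = (x \<bullet> c) * (if c = b then 1 else 0)"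
        by (simp add: inner_Basis)
    qed simp
    also have "\<dots> = (\<Sum>c\<in>Basis. if c = b then x \<bullet> c else 0)"
      by (intro sum.cong) auto
    finally show ?thesis using b by simp
  qed
  fix l u :: 'b assume lu: "\<And>b. b \<in> Basis \<Longrightarrow> l \<bullet> b \<le> u \<bullet> b"
  define l' where "l' = (\<Sum>b\<in>Basis. (l \<bullet> e b) *\<^sub>R b)"
  define u' where "u' = (\<Sum>b\<in>Basis. (u \<bullet> e b) *\<^sub>R b)"
  have Be: "(Basis :: 'b set) = e ` Basis" using bas by (simp add: bij_betw_def)
  have "e -` box l u = box l' u'"
    unfolding box_def Be by (auto simp: inner l'_def u'_def)
  hence "emeasure (distr lborel borel e) (box l u) = emeasure lborel (box l' u')"
    by (simp add: emeasure_distr)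
  also have "\<dots> = (\<Prod>b\<in>Basis. (u' - l') \<bullet> b)"
    using lu Be by (intro emeasure_lborel_box) (auto simp: l'_def u'_def)
  also have "(\<Prod>b\<in>Basis. (u' - l') \<bullet> b) = (\<Prod>b\<in>Basis. (u - l) \<bullet> e b)"
    by (intro prod.cong) (auto simp: l'_def u'_def inner_diff_left)
  also have "\<dots> = (\<Prod>b\<in>Basis. (u - l) \<bullet> b)"
    using prod.reindex_bij_betw[OF bas, of "\<lambda>b. (u - l) \<bullet> b"] by simp
  finally show "emeasure (distr lborel borel e) (box l u) = (\<Prod>b\<in>Basis. (u - l) \<bullet> b)" .
qed simp

lemma lebesgue_nn_integral_eq_integral:
  fixes h :: "'a::euclidean_space \<Rightarrow> real"
  assumes "h \<in> borel_measurable lebesgue" "\<And>x. 0 \<le> h x" "h absolutely_integrable_on UNIV"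
  shows "(\<integral>\<^sup>+x. ennreal (h x) \<partial>lebesgue) = ennreal (integral UNIV h)"
proof -
  have "integrable lebesgue h" using assms(3) by (simp add: set_integrable_def)
  hence "(\<integral>\<^sup>+x. ennreal (h x) \<partial>lebesgue) = ennreal (integral\<^sup>L lebesgue h)"
    using assms(2) by (intro nn_integral_eq_integral) auto
  thus ?thesis using assms(3) set_lebesgue_integral_eq_integral(2)[OF assms(3)]
    by (simp add: set_lebesgue_integral_def)
qed

text \<open>
The change of variables formula for absolutely integrable functions contains the one for integrals
in \<open>[0, \<infinity>]\<close>: by its equivalence of integrability, both sides are infinite together.
\<close>

lemma nn_integral_change_of_variables_vec:
  fixes g :: "real^'n::{finite,wellorder} \<Rightarrow> real^'n::_" and h :: "real^'n::_ \<Rightarrow> real"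
  assumes S: "S \<in> sets lebesgue" and gS: "g ` S \<in> sets lebesgue"
    and der: "\<And>x. x \<in> S \<Longrightarrow> (g has_derivative g' x) (at x within S)"
    and inj: "inj_on g S"
    and h: "h \<in> borel_measurable lebesgue" "\<And>x. 0 \<le> h x"
    and D: "(\<lambda>x. indicator S x * (\<bar>det (matrix (g' x))\<bar> * h (g x))) \<in> borel_measurable lebesgue"
  shows "(\<integral>\<^sup>+x\<in>g ` S. ennreal (h x) \<partial>lebesgue) =
    (\<integral>\<^sup>+x\<in>S. ennreal (\<bar>det (matrix (g' x))\<bar> * h (g x)) \<partial>lebesgue)"
proof -
  define h1 where "h1 x = indicator (g ` S) x * h x" for x
  define h2 where "h2 x = indicator S x * (\<bar>det (matrix (g' x))\<bar> * h (g x))" for x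
  have m: "h1 \<in> borel_measurable lebesgue" "h2 \<in> borel_measurable lebesgue"
    using h D gS unfolding h1_def[abs_def] h2_def[abs_def] by auto
  have nn: "0 \<le> h1 x" "0 \<le> h2 x" for x using h by (auto simp: h1_def h2_def)
  have ind: "indicat_real A x * y = (if x \<in> A then y else 0)" for A and x :: "real^'n::_" and y
    by (simp add: indicator_def)
  have res: "h1 absolutely_integrable_on UNIV \<longleftrightarrow> h absolutely_integrable_on (g ` S)"
     "h2 absolutely_integrable_on UNIV \<longleftrightarrow> (\<lambda>x. \<bar>det (matrix (g' x))\<bar> * h (g x)) absolutely_integrable_on S"
     "integral UNIV h1 = integral (g ` S) h"
     "integral UNIV h2 = integral S (\<lambda>x. \<bar>det (matrix (g' x))\<bar> * h (g x))"
    unfolding h1_def h2_def set_integrable_def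
    by (simp_all add: integral_restrict_UNIV[symmetric, of _ h] integral_restrict_UNIV[symmetric, of S]
        ind)
  have cv: "h2 absolutely_integrable_on UNIV \<and> integral UNIV h2 = b \<longleftrightarrow>
       h1 absolutely_integrable_on UNIV \<and> integral UNIV h1 = b" for b
  proof -
    have "(\<lambda>x. vec (\<bar>det (matrix (g' x))\<bar> * h (g x)) :: real^1) = (\<lambda>x. \<bar>det (matrix (g' x))\<bar> *\<^sub>R vec (h (g x)))"
      by (auto simp: vec_eq_iff)
    thus ?thesis
    using has_absolute_integral_change_of_variables[OF S der inj, of "\<lambda>x. vec (h x) :: real^1" "vec b"]
    unfolding res
    by (simp add: absolutely_integrable_on_1_iff integral_on_1_eq)
  qed
  have "(\<integral>\<^sup>+x. ennreal (h1 x) \<partial>lebesgue) = (\<integral>\<^sup>+x. ennreal (h2 x) \<partial>lebesgue)"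
  proof (cases "h1 absolutely_integrable_on UNIV")
    case True
    thus ?thesis using cv lebesgue_nn_integral_eq_integral m nn by metis
  next
    case False
    hence F2: "\<not> h2 absolutely_integrable_on UNIV" using cv by blast
    have "\<not> integrable lebesgue h1" "\<not> integrable lebesgue h2"
      using False F2 by (auto simp: set_integrable_def)
    thus ?thesis using m nn by (metis integrableI_nonneg AE_I2 top.not_eq_extremum infinity_ennreal_def)
  qed
  moreover have "ennreal (h1 x) = ennreal (h x) * indicator (g ` S) x"
      "ennreal (h2 x) = ennreal (\<bar>det (matrix (g' x))\<bar> * h (g x)) * indicator S x" for x
    by (auto simp: h1_def h2_def indicator_def)
  ultimately show ?thesis by simp
qed

definition to_vec :: "heis \<Rightarrow> real^3" where
  "to_vec p = vector [Re (fst p), Im (fst p), snd p]"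

definition of_vec :: "real^3 \<Rightarrow> heis" where
  "of_vec v = (Complex (v$1) (v$2), v$3)"

lemma to_vec_of_vec [simp]: "to_vec (of_vec v) = v" "of_vec (to_vec p) = p"
  by (simp_all add: to_vec_def of_vec_def vec_eq_iff forall_3 prod_eq_iff)

lemma bounded_linear_of_vec: "bounded_linear of_vec"
  by (intro linear_conv_bounded_linear[THEN iffD1] linearI)
     (auto simp: of_vec_def complex_eq_iff)

lemma bounded_linear_to_vec: "bounded_linear to_vec"
  by (intro linear_conv_bounded_linear[THEN iffD1] linearI)
     (auto simp: to_vec_def vec_eq_iff forall_3)

lemma of_vec_axis: "of_vec (axis 1 1) = (1, 0)" "of_vec (axis 2 1) = (\<i>, 0)" "of_vec (axis 3 1) = (0, 1)"
  by (simp_all add: of_vec_def axis_def complex_eq_iff)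

lemma bij_betw_of_vec_Basis: "bij_betw of_vec Basis Basis"
proof -
  have B3: "(Basis :: (real^3) set) = {axis 1 1, axis 2 1, axis 3 1}"
    by (auto simp: Basis_vec_def UNIV_3)
  have "(Basis :: heis set) = {(1, 0), (\<i>, 0), (0, 1)}"
    by (auto simp: Basis_prod_def Basis_complex_def zero_prod_def)
  hence "of_vec ` Basis = Basis" unfolding B3 by (simp add: of_vec_axis)
  moreover have "inj of_vec" by (metis injI to_vec_of_vec(1))
  ultimately show ?thesis by (auto simp: bij_betw_def inj_on_def)
qed

lemma measurable_of_vec [measurable]: "of_vec \<in> borel_measurable borel"
  by (intro borel_measurable_continuous_onI linear_continuous_on bounded_linear_of_vec)

lemma nn_integral_of_vec:
  assumes [measurable]: "F \<in> borel_measurable borel"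
  shows "(\<integral>\<^sup>+p. F p \<partial>lborel) = (\<integral>\<^sup>+v. F (of_vec v) \<partial>lborel)"
proof -
  have "(\<integral>\<^sup>+p. F p \<partial>lborel) = (\<integral>\<^sup>+p. F p \<partial>distr lborel borel of_vec)"
    using distr_basis_isometry[OF _ bij_betw_of_vec_Basis] bounded_linear_of_vec
    by (simp add: bounded_linear.linear)
  also have "\<dots> = (\<integral>\<^sup>+v. F (of_vec v) \<partial>lborel)"
    by (rule nn_integral_distr) auto
  finally show ?thesis .
qed

text \<open>
The Jacobian determinant of a linear map in the coordinates \<open>(x, y, t)\<close>, expanded along the last
coordinate; \<open>Im (cnj v * w)\<close> is the planar determinant of \<open>v\<close> and \<open>w\<close>.
\<close>

definition heis_det :: "(heis \<Rightarrow> heis) \<Rightarrow> real" where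
  "heis_det L = snd (L (1, 0)) * Im (cnj (fst (L (\<i>, 0))) * fst (L (0, 1)))
     - snd (L (\<i>, 0)) * Im (cnj (fst (L (1, 0))) * fst (L (0, 1)))
     + snd (L (0, 1)) * Im (cnj (fst (L (1, 0))) * fst (L (\<i>, 0)))"

lemma det_matrix_heis: "det (matrix (to_vec \<circ> L \<circ> of_vec)) = heis_det L"
  unfolding det_3 heis_det_def matrix_def
  by (simp add: of_vec_axis to_vec_def algebra_simps)

theorem nn_integral_change_of_variables_heis:
  fixes g :: "heis \<Rightarrow> heis" and h :: "heis \<Rightarrow> real"
  assumes S: "S \<in> sets borel" and gS: "g ` S \<in> sets borel"
    and der: "\<And>p. p \<in> S \<Longrightarrow> (g has_derivative g' p) (at p within S)"
    and inj: "inj_on g S"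
    and h [measurable]: "h \<in> borel_measurable borel" and nn: "\<And>p. 0 \<le> h p"
    and D [measurable]: "(\<lambda>p. indicator S p * (\<bar>heis_det (g' p)\<bar> * h (g p))) \<in> borel_measurable borel"
  shows "(\<integral>\<^sup>+p\<in>g ` S. ennreal (h p) \<partial>lborel) =
    (\<integral>\<^sup>+p\<in>S. ennreal (\<bar>heis_det (g' p)\<bar> * h (g p)) \<partial>lborel)"
proof -
  define T where "T = of_vec -` S"
  define G where "G = to_vec \<circ> g \<circ> of_vec"
  define G' where "G' v = to_vec \<circ> g' (of_vec v) \<circ> of_vec" for v
  define D' where "D' p = indicator S p * (\<bar>heis_det (g' p)\<bar> * h (g p))" for p
  have T: "T = to_vec ` S" unfolding T_def by (auto simp: image_iff) (metis to_vec_of_vec)+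
  have GT: "G ` T = of_vec -` (g ` S)"
    unfolding T G_def by (auto simp: image_iff) (metis to_vec_of_vec)+
  have Tb [measurable]: "T \<in> sets borel" "G ` T \<in> sets borel"
    using measurable_sets_borel[OF measurable_of_vec S] measurable_sets_borel[OF measurable_of_vec gS]
    unfolding GT by (simp_all add: T_def)
  have D'm [measurable]: "D' \<in> borel_measurable borel" unfolding D'_def by (rule D)
  have ind: "indicator S (of_vec v) = indicator T v" "indicator (g ` S) (of_vec v) = indicator (G ` T) v" for v
    unfolding GT by (simp_all add: T_def indicator_def)
  have det: "det (matrix (G' v)) = heis_det (g' (of_vec v))" for v
    unfolding G'_def by (rule det_matrix_heis)
  have "(\<integral>\<^sup>+v\<in>G ` T. ennreal ((h \<circ> of_vec) v) \<partial>lebesgue) =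
    (\<integral>\<^sup>+v\<in>T. ennreal (\<bar>det (matrix (G' v))\<bar> * (h \<circ> of_vec) (G v)) \<partial>lebesgue)"
  proof (rule nn_integral_change_of_variables_vec)
    show "T \<in> sets lebesgue" "G ` T \<in> sets lebesgue" using Tb by (auto intro: sets_completionI_sets)
    show "inj_on G T" unfolding T G_def
      using inj by (auto simp: inj_on_def) (metis to_vec_of_vec(2))
    show "(G has_derivative G' v) (at v within T)" if "v \<in> T" for v
    proof -
      have 1: "(of_vec has_derivative of_vec) (at v within T)"
        using bounded_linear_of_vec by (rule bounded_linear_imp_has_derivative)
      have 2: "(g has_derivative g' (of_vec v)) (at (of_vec v) within of_vec ` T)"
        using der[of "of_vec v"] that by (auto simp: T image_image)
      have 3: "(to_vec has_derivative to_vec) (at ((g \<circ> of_vec) v) within (g \<circ> of_vec) ` T)"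
        using bounded_linear_to_vec by (rule bounded_linear_imp_has_derivative)
      show ?thesis unfolding G_def G'_def
        using diff_chain_within[OF diff_chain_within[OF 1 2] 3]
        by (simp add: o_def)
    qed
    have "h \<circ> of_vec \<in> borel_measurable borel" by simp
    thus "h \<circ> of_vec \<in> borel_measurable lebesgue" by (simp add: measurable_completion)
    have "(\<lambda>v. indicator T v * (\<bar>det (matrix (G' v))\<bar> * (h \<circ> of_vec) (G v))) = D' \<circ> of_vec"
      by (auto simp: D'_def det G_def ind)
    moreover have "D' \<circ> of_vec \<in> borel_measurable borel" by simp
    ultimately show "(\<lambda>v. indicator T v * (\<bar>det (matrix (G' v))\<bar> * (h \<circ> of_vec) (G v))) \<in> borel_measurable lebesgue"
      by (simp add: measurable_completion)
  qed (simp add: nn)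
  hence eq: "(\<integral>\<^sup>+v. ennreal (h (of_vec v)) * indicator (G ` T) v \<partial>lborel) =
    (\<integral>\<^sup>+v. ennreal (D' (of_vec v)) \<partial>lborel)"
    by (simp add: nn_integral_completion det G_def D'_def ind ennreal_mult' mult_ac ennreal_indicator)
  have "(\<integral>\<^sup>+p\<in>g ` S. ennreal (h p) \<partial>lborel) = (\<integral>\<^sup>+v. ennreal (h (of_vec v)) * indicator (G ` T) v \<partial>lborel)"
    using gS by (subst nn_integral_of_vec) (auto simp: ind)
  also note eq
  also have "(\<integral>\<^sup>+v. ennreal (D' (of_vec v)) \<partial>lborel) = (\<integral>\<^sup>+p. ennreal (D' p) \<partial>lborel)"
    by (rule nn_integral_of_vec[symmetric]) simp
  finally show ?thesis
    by (simp add: D'_def ennreal_mult' mult_ac ennreal_indicator)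
qed

section \<open>Twice continuously differentiable maps\<close>

lemma C2_onI:
  assumes "\<And>p. p \<in> S \<Longrightarrow> (f has_derivative blinfun_apply (D p)) (at p)"
    and "\<And>p. p \<in> S \<Longrightarrow> (D has_derivative blinfun_apply (D2 p)) (at p)"
    and "continuous_on S D2"
  shows "C2_on S f"
  using assms unfolding C2_on_def by blast

lemma C2_on_subset: "C2_on T f \<Longrightarrow> S \<subseteq> T \<Longrightarrow> C2_on S f"
  unfolding C2_on_def by (meson continuous_on_subset subsetD)

lemma C2_on_cong:
  assumes "open S" "\<And>p. p \<in> S \<Longrightarrow> f p = g p" "C2_on S f"
  shows "C2_on S g"
proof -
  obtain D D2 where D: "\<And>p. p \<in> S \<Longrightarrow> (f has_derivative blinfun_apply (D p)) (at p)"
    and "\<And>p. p \<in> S \<Longrightarrow> (D has_derivative blinfun_apply (D2 p)) (at p)" "continuous_on S D2"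
    using assms(3) unfolding C2_on_def by blast
  moreover have "(g has_derivative blinfun_apply (D p)) (at p)" if "p \<in> S" for p
    using has_derivative_transform_within_open[OF D[OF that] assms(1) that assms(2)] .
  ultimately show ?thesis by (intro C2_onI[of S g D D2])
qed

text \<open>
A map whose derivative depends linearly on the point is quadratic; products are the case of
interest.
\<close>

lemma C2_on_linear_derivative:
  fixes D :: "'a::real_normed_vector \<Rightarrow> 'a \<Rightarrow>\<^sub>L 'b::real_normed_vector"
  assumes "\<And>p. (f has_derivative blinfun_apply (D p)) (at p)" "bounded_linear D"
  shows "C2_on S f"
  using assms
  by (intro C2_onI[of S f D "\<lambda>_. Blinfun D"])
     (auto simp: bounded_linear_Blinfun_apply bounded_linear_imp_has_derivative)

lemma C2_on_bounded_linear: "bounded_linear f \<Longrightarrow> C2_on S f"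
  by (intro C2_onI[of S f "\<lambda>_. Blinfun f" "\<lambda>_. 0"])
     (auto simp: bounded_linear_Blinfun_apply bounded_linear_imp_has_derivative zero_blinfun.rep_eq)

lemma C2_on_const: "C2_on S (\<lambda>_. c)"
  by (intro C2_onI[of S _ "\<lambda>_. 0" "\<lambda>_. 0"]) (auto simp: zero_blinfun.rep_eq)

lemma C2_on_add:
  assumes "C2_on S f" "C2_on S g"
  shows "C2_on S (\<lambda>p. f p + g p)"
proof -
  obtain D D2 where D: "\<And>p. p \<in> S \<Longrightarrow> (f has_derivative blinfun_apply (D p)) (at p)"
    "\<And>p. p \<in> S \<Longrightarrow> (D has_derivative blinfun_apply (D2 p)) (at p)" "continuous_on S D2"
    using assms(1) unfolding C2_on_def by blast
  obtain E E2 where E: "\<And>p. p \<in> S \<Longrightarrow> (g has_derivative blinfun_apply (E p)) (at p)"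
    "\<And>p. p \<in> S \<Longrightarrow> (E has_derivative blinfun_apply (E2 p)) (at p)" "continuous_on S E2"
    using assms(2) unfolding C2_on_def by blast
  show ?thesis
    by (intro C2_onI[of S _ "\<lambda>p. D p + E p" "\<lambda>p. D2 p + E2 p"])
       (auto simp: plus_blinfun.rep_eq intro!: has_derivative_add D E continuous_intros)
qed

text \<open>
The derivative \<open>E (f p) o D p\<close> of the composition is itself a bilinear expression in
differentiable maps. The continuity of its derivative may be tested on the finitely many basis
vectors, since the domain of \<open>f\<close> is Euclidean.
\<close>

lemma C2_on_compose:
  fixes f :: "'a::euclidean_space \<Rightarrow> 'b::real_normed_vector" and g :: "'b \<Rightarrow> 'c::real_normed_vector"
  assumes "C2_on T g" "C2_on S f" and sub: "\<And>p. p \<in> S \<Longrightarrow> f p \<in> T"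
  shows "C2_on S (\<lambda>p. g (f p))"
proof -
  obtain D D2 where D: "\<And>p. p \<in> S \<Longrightarrow> (f has_derivative blinfun_apply (D p)) (at p)"
    "\<And>p. p \<in> S \<Longrightarrow> (D has_derivative blinfun_apply (D2 p)) (at p)" "continuous_on S D2"
    using assms(2) unfolding C2_on_def by blast
  obtain E E2 where E: "\<And>p. p \<in> T \<Longrightarrow> (g has_derivative blinfun_apply (E p)) (at p)"
    "\<And>p. p \<in> T \<Longrightarrow> (E has_derivative blinfun_apply (E2 p)) (at p)" "continuous_on T E2"
    using assms(1) unfolding C2_on_def by blast
  define F where "F p = E (f p) o\<^sub>L D p" for p
  define F' where "F' p h = (E (f p) o\<^sub>L D2 p h) + (E2 (f p) (D p h) o\<^sub>L D p)" for p h
  have F': "(F has_derivative F' p) (at p)" if "p \<in> S" for p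
    unfolding F_def[abs_def] F'_def[abs_def]
    using that sub
    by (intro bounded_bilinear.FDERIV[OF bounded_bilinear_blinfun_compose]
         has_derivative_compose[of f "blinfun_apply (D p)" p UNIV E] D E) auto
  have cf: "continuous_on S f" and cD: "continuous_on S D" and cE: "continuous_on T E"
    using D(1,2) E(2) by (meson continuous_at_imp_continuous_on has_derivative_continuous)+
  have [continuous_intros]: "continuous_on S (\<lambda>p. E (f p))" "continuous_on S (\<lambda>p. E2 (f p))"
    using continuous_on_compose2[OF cE cf] continuous_on_compose2[OF E(3) cf] sub by auto
  have cont: "continuous_on S (\<lambda>p. F' p h)" for h
    unfolding F'_def
    by (intro continuous_intros bounded_bilinear.continuous_on[OF bounded_bilinear_blinfun_compose] cD D(3))
  show ?thesis
  proof (rule C2_onI[of S _ F "\<lambda>p. Blinfun (F' p)"])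
    show "((\<lambda>p. g (f p)) has_derivative blinfun_apply (F p)) (at p)" if "p \<in> S" for p
      using has_derivative_compose[OF D(1)[OF that] E(1)] that sub
      by (simp add: F_def blinfun_compose.rep_eq o_def)
    have B: "blinfun_apply (Blinfun (F' p)) = F' p" if "p \<in> S" for p
      using F'[OF that] by (auto simp: bounded_linear_Blinfun_apply has_derivative_bounded_linear)
    show "(F has_derivative blinfun_apply (Blinfun (F' p))) (at p)" if "p \<in> S" for p
      using F'[OF that] B[OF that] by simp
    show "continuous_on S (\<lambda>p. Blinfun (F' p))"
    proof (rule continuous_on_blinfun_componentwise)
      fix h :: 'a
      show "continuous_on S (\<lambda>p. blinfun_apply (Blinfun (F' p)) h)"
        using cont[of h] by (simp add: B cong: continuous_on_cong)
    qed
  qed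
qed

lemma C2_on_Pair:
  fixes f :: "'a::euclidean_space \<Rightarrow> 'b::real_normed_vector" and g :: "'a \<Rightarrow> 'c::real_normed_vector"
  assumes "C2_on S f" "C2_on S g"
  shows "C2_on S (\<lambda>p. (f p, g p))"
proof -
  have "C2_on S (\<lambda>p. (f p, 0) + (0, g p))"
    by (intro C2_on_add C2_on_compose[of UNIV "\<lambda>x. (x, 0)" S f] C2_on_compose[of UNIV "\<lambda>x. (0, x)" S g] assms
        C2_on_bounded_linear bounded_linear_intros) auto
  thus ?thesis by simp
qed

lemma C2_on_mult:
  fixes f g :: "'a::euclidean_space \<Rightarrow> 'b::real_normed_algebra"
  assumes "C2_on S f" "C2_on S g"
  shows "C2_on S (\<lambda>p. f p * g p)"
proof -
  define D :: "'b \<times> 'b \<Rightarrow> ('b \<times> 'b) \<Rightarrow>\<^sub>L 'b" where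
    "D q = (blinfun_mult_right (fst q) o\<^sub>L Blinfun snd) + (blinfun_mult_left (snd q) o\<^sub>L Blinfun fst)" for q
  have D: "D q h = fst q * snd h + fst h * snd q" for q h
    by (simp add: D_def plus_blinfun.rep_eq bounded_linear_Blinfun_apply bounded_linear_fst bounded_linear_snd)
  have "bounded_linear D"
    unfolding D_def[abs_def]
    by (intro bounded_linear_add
        bounded_bilinear.bounded_linear_left[OF bounded_bilinear_blinfun_compose, THEN bounded_linear_compose]
        bounded_linear_compose[OF bounded_linear_blinfun_mult_right] bounded_linear_compose[OF bounded_linear_blinfun_mult_left]
        bounded_linear_fst bounded_linear_snd)
  moreover have "((\<lambda>q. fst q * snd q) has_derivative blinfun_apply (D q)) (at q)" for q
    by (auto intro!: derivative_eq_intros simp: D)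
  ultimately have "C2_on UNIV (\<lambda>q :: 'b \<times> 'b. fst q * snd q)"
    by (intro C2_on_linear_derivative[of _ D])
  from C2_on_compose[OF this C2_on_Pair[OF assms]] show ?thesis by simp
qed

lemma C2_on_field:
  fixes \<phi> :: "'a::{real_normed_field, euclidean_space} \<Rightarrow> 'a"
  assumes "\<And>x. x \<in> S \<Longrightarrow> (\<phi> has_field_derivative \<phi>1 x) (at x)"
    "\<And>x. x \<in> S \<Longrightarrow> (\<phi>1 has_field_derivative \<phi>2 x) (at x)" and c: "continuous_on S \<phi>2"
  shows "C2_on S \<phi>"
proof (rule C2_onI[of S \<phi> "\<lambda>x. blinfun_mult_right (\<phi>1 x)" "\<lambda>x. Blinfun blinfun_mult_right o\<^sub>L blinfun_mult_right (\<phi>2 x)"])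
  have B: "blinfun_apply (Blinfun blinfun_mult_right) = (blinfun_mult_right :: 'a \<Rightarrow> _)"
    by (simp add: bounded_linear_Blinfun_apply bounded_linear_blinfun_mult_right)
  show "(\<phi> has_derivative blinfun_apply (blinfun_mult_right (\<phi>1 x))) (at x)" if "x \<in> S" for x
    using assms(1)[OF that] by (simp add: has_field_derivative_def)
  show "((\<lambda>x. blinfun_mult_right (\<phi>1 x)) has_derivative
      blinfun_apply (Blinfun blinfun_mult_right o\<^sub>L blinfun_mult_right (\<phi>2 x))) (at x)" if "x \<in> S" for x
    using bounded_linear.has_derivative[OF bounded_linear_blinfun_mult_right assms(2)[OF that, unfolded has_field_derivative_def]]
    by (simp add: blinfun_compose.rep_eq B o_def)
  show "continuous_on S (\<lambda>x. Blinfun blinfun_mult_right o\<^sub>L blinfun_mult_right (\<phi>2 x))"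
    by (intro continuous_on_blinfun_componentwise)
       (auto simp: B intro!: continuous_intros c bounded_linear.continuous_on[OF bounded_linear_blinfun_mult_right])
qed

lemma C2_on_exp:
  fixes f :: "'a::euclidean_space \<Rightarrow> 'b::{real_normed_field, banach, euclidean_space}"
  assumes "C2_on S f" shows "C2_on S (\<lambda>p. exp (f p))"
  by (rule C2_on_compose[of UNIV exp, OF C2_on_field assms])
     (auto intro: DERIV_exp continuous_intros)

lemma C2_on_inverse:
  fixes f :: "'a::euclidean_space \<Rightarrow> real"
  assumes "C2_on S f" "\<And>p. p \<in> S \<Longrightarrow> f p \<noteq> 0" shows "C2_on S (\<lambda>p. inverse (f p))"
  by (rule C2_on_compose[of "- {0}" inverse, OF C2_on_field[of _ _ "\<lambda>x. - inverse (x^2)" "\<lambda>x. 2 * inverse (x^3)"] assms(1)])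
     (use assms(2) in \<open>auto intro!: derivative_eq_intros continuous_intros simp: power2_eq_square power3_eq_cube field_simps\<close>)

lemma C2_on_divide:
  fixes f g :: "'a::euclidean_space \<Rightarrow> real"
  assumes "C2_on S f" "C2_on S g" "\<And>p. p \<in> S \<Longrightarrow> g p \<noteq> 0" shows "C2_on S (\<lambda>p. f p / g p)"
  unfolding divide_inverse by (intro C2_on_mult C2_on_inverse assms)

lemma C2_on_ln:
  fixes f :: "'a::euclidean_space \<Rightarrow> real"
  assumes "C2_on S f" "\<And>p. p \<in> S \<Longrightarrow> 0 < f p" shows "C2_on S (\<lambda>p. ln (f p))"
  by (rule C2_on_compose[of "{0<..}" ln, OF C2_on_field[of _ _ "\<lambda>x. inverse x" "\<lambda>x. - inverse (x^2)"] assms(1)])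
     (use assms(2) in \<open>auto intro!: derivative_eq_intros continuous_intros simp: power2_eq_square field_simps\<close>)

lemma C2_on_arctan:
  fixes f :: "'a::euclidean_space \<Rightarrow> real"
  assumes "C2_on S f" shows "C2_on S (\<lambda>p. arctan (f p))"
proof (rule C2_on_compose[of UNIV arctan, OF C2_on_field[of _ _ "\<lambda>x. inverse (1 + x^2)" "\<lambda>x. - 2 * x * inverse ((1 + x^2)^2)"] assms])
  show "((\<lambda>x. inverse (1 + x^2)) has_real_derivative - 2 * x * inverse ((1 + x^2)^2)) (at x)" for x :: real
    using sum_power2_gt_zero_iff[of 1 x]
    by (auto intro!: derivative_eq_intros simp: power2_eq_square field_simps)
  show "continuous_on UNIV (\<lambda>x::real. - 2 * x * inverse ((1 + x^2)^2))"
    by (intro continuous_intros) (metis add_pos_nonneg less_irrefl power_not_zero zero_le_power2 zero_less_one)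
qed (auto intro: DERIV_arctan)

text \<open>
The second difference of \<open>f\<close> over the parallelogram spanned by \<open>s h\<close> and \<open>s k\<close> is, by the mean
value theorem in direction \<open>h\<close>, an increment of the first derivative in direction \<open>k\<close>. The second
difference is symmetric in \<open>h\<close> and \<open>k\<close>, so this forces the symmetry of the second derivative.
\<close>

lemma second_difference_bound:
  fixes f :: "'a::real_normed_vector \<Rightarrow> real" and D :: "'a \<Rightarrow> 'a \<Rightarrow>\<^sub>L real"
  assumes der: "\<And>v. norm v < d \<Longrightarrow> (f has_derivative blinfun_apply (D (p + v))) (at (p + v))"
    and app: "\<And>v. norm v < d \<Longrightarrow> norm (D (p + v) - D p - D2 v) \<le> e * norm v"
    and lin: "linear D2" and e: "0 < e" and s: "0 < s" "s * (norm h + norm k) < d"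
  shows "\<bar>f (p + s *\<^sub>R h + s *\<^sub>R k) - f (p + s *\<^sub>R h) - f (p + s *\<^sub>R k) + f p - s\<^sup>2 * D2 k h\<bar>
    \<le> s\<^sup>2 * (2 * e * (norm h + norm k)^2)"
proof -
  have small: "norm (x *\<^sub>R h + s *\<^sub>R k) \<le> s * (norm h + norm k)" "norm (x *\<^sub>R h) \<le> s * (norm h + norm k)"
     if "0 \<le> x" "x \<le> s" for x
  proof -
    have 1: "x * norm h \<le> s * norm h" using that by (intro mult_right_mono) auto
    have 2: "0 \<le> s * norm k" using s by simp
    have "norm (x *\<^sub>R h + s *\<^sub>R k) \<le> norm (x *\<^sub>R h) + norm (s *\<^sub>R k)" by (rule norm_triangle_ineq)
    also have "\<dots> = x * norm h + s * norm k" using that s by simp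
    finally show "norm (x *\<^sub>R h + s *\<^sub>R k) \<le> s * (norm h + norm k)" using 1 by (simp add: distrib_left)
    have "norm (x *\<^sub>R h) = x * norm h" using that by simp
    thus "norm (x *\<^sub>R h) \<le> s * (norm h + norm k)" using 1 2 unfolding distrib_left by linarith
  qed
  define g where "g x = f (p + (x *\<^sub>R h + s *\<^sub>R k)) - f (p + x *\<^sub>R h)" for x
  have dg: "(g has_real_derivative D (p + (x *\<^sub>R h + s *\<^sub>R k)) h - D (p + x *\<^sub>R h) h) (at x)" if "0 \<le> x" "x \<le> s" for x
  proof -
    have "((\<lambda>x. p + (x *\<^sub>R h + s *\<^sub>R k)) has_derivative (\<lambda>y. y *\<^sub>R h)) (at x)"
         "((\<lambda>x. p + x *\<^sub>R h) has_derivative (\<lambda>y. y *\<^sub>R h)) (at x)"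
      by (auto intro!: derivative_eq_intros)
    from has_derivative_diff[OF has_derivative_compose[OF this(1) der] has_derivative_compose[OF this(2) der]]
    show ?thesis
      using small[OF that] s unfolding g_def[abs_def] has_field_derivative_def
      by (auto simp: blinfun.scaleR_right algebra_simps elim!: has_derivative_eq_rhs)
  qed
  from MVT2[OF s(1), of g, OF dg] obtain x where x: "0 < x" "x < s"
    and gx: "g s - g 0 = s * (D (p + (x *\<^sub>R h + s *\<^sub>R k)) h - D (p + x *\<^sub>R h) h)" by auto
  define u where "u = x *\<^sub>R h + s *\<^sub>R k"
  define v where "v = x *\<^sub>R h"
  define c where "c = s * (norm h + norm k)"
  have uv: "norm u \<le> c" "norm v \<le> c" using small x unfolding u_def v_def c_def by auto
  have D2: "D2 u - D2 v = s *\<^sub>R D2 k"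
    unfolding u_def v_def using lin by (simp add: linear_add linear_cmul)
  have bd: "\<bar>(D (p + w) - D p - D2 w) h\<bar> \<le> e * c * norm h" if "norm w \<le> c" for w
  proof -
    have "\<bar>(D (p + w) - D p - D2 w) h\<bar> \<le> norm (D (p + w) - D p - D2 w) * norm h"
      using norm_blinfun[of "D (p + w) - D p - D2 w" h] by simp
    also have "\<dots> \<le> (e * norm w) * norm h" using app[of w] that s unfolding c_def by (intro mult_right_mono) auto
    also have "\<dots> \<le> (e * c) * norm h" using that e by (intro mult_right_mono mult_left_mono) auto
    finally show ?thesis .
  qed
  have "D (p + u) h - D (p + v) h - s * D2 k h
     = (D (p + u) - D p - D2 u) h - (D (p + v) - D p - D2 v) h + ((D2 u - D2 v) h - s * D2 k h)"
    by (simp add: blinfun.bilinear_simps)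
  also have "(D2 u - D2 v) h - s * D2 k h = 0" unfolding D2 by (simp add: blinfun.bilinear_simps)
  finally have "\<bar>D (p + u) h - D (p + v) h - s * D2 k h\<bar> \<le> 2 * (e * c * norm h)"
    using bd[OF uv(1)] bd[OF uv(2)] by simp
  hence "s * \<bar>D (p + u) h - D (p + v) h - s * D2 k h\<bar> \<le> s * (2 * (e * c * norm h))"
    using s by (intro mult_left_mono) auto
  also have "\<dots> \<le> s\<^sup>2 * (2 * e * (norm h + norm k)^2)"
  proof -
    have "norm h * (norm h + norm k) \<le> (norm h + norm k)^2"
      unfolding power2_eq_square by (intro mult_right_mono) auto
    hence "(s^2 * (2 * e)) * (norm h * (norm h + norm k)) \<le> (s^2 * (2 * e)) * (norm h + norm k)^2"
      using e by (intro mult_left_mono) auto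
    thus ?thesis unfolding c_def by (simp add: power2_eq_square algebra_simps)
  qed
  also have "s * \<bar>D (p + u) h - D (p + v) h - s * D2 k h\<bar> = \<bar>s * (D (p + u) h - D (p + v) h - s * D2 k h)\<bar>"
    using s by (simp add: abs_mult)
  also have "s * (D (p + u) h - D (p + v) h - s * D2 k h) = g s - g 0 - s\<^sup>2 * D2 k h"
    unfolding gx by (simp add: u_def v_def power2_eq_square right_diff_distrib)
  also have "g s - g 0 = f (p + s *\<^sub>R h + s *\<^sub>R k) - f (p + s *\<^sub>R h) - f (p + s *\<^sub>R k) + f p"
    by (simp add: g_def add.assoc)
  finally show ?thesis .
qed

lemma second_derivative_symmetric_real:
  fixes f :: "'a::real_normed_vector \<Rightarrow> real" and D :: "'a \<Rightarrow> 'a \<Rightarrow>\<^sub>L real"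
  assumes S: "open S" "p \<in> S" and der: "\<And>q. q \<in> S \<Longrightarrow> (f has_derivative blinfun_apply (D q)) (at q)"
    and D2: "(D has_derivative D2) (at p)"
  shows "D2 h k = D2 k h"
proof -
  define C where "C = 4 * (norm h + norm k)^2"
  have lin: "linear D2" using D2 by (simp add: has_derivative_linear)
  have le: "\<bar>D2 h k - D2 k h\<bar> \<le> C * e" if e: "0 < e" for e
  proof -
    obtain d1 where d1: "0 < d1" "\<And>q. norm (q - p) < d1 \<Longrightarrow> norm (D q - D p - D2 (q - p)) \<le> e * norm (q - p)"
      using D2 e unfolding has_derivative_at_alt by blast
    obtain d2 where d2: "0 < d2" "ball p d2 \<subseteq> S" using S open_contains_ball by blast
    define d where "d = min d1 d2"
    define s where "s = d / (2 * (norm h + norm k + 1))"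
    have d: "0 < d" using d1 d2 by (simp add: d_def)
    have s: "0 < s" "s * (norm h + norm k) < d"
    proof -
      have pos: "0 < norm h + norm k + 1" by (smt (verit) norm_ge_zero)
      show "0 < s" using d pos by (simp add: s_def)
      have "s * (norm h + norm k + 1) = d / 2" using pos by (simp add: s_def field_simps)
      thus "s * (norm h + norm k) < d" using \<open>0 < s\<close> d by (simp add: distrib_left)
    qed
    have a1: "(f has_derivative blinfun_apply (D (p + v))) (at (p + v))" if "norm v < d" for v
      using that d2 by (intro der) (auto simp: d_def dist_norm)
    have a2: "norm (D (p + v) - D p - D2 v) \<le> e * norm v" if "norm v < d" for v
      using d1(2)[of "p + v"] that by (simp add: d_def)
    define \<Delta> where "\<Delta> = f (p + s *\<^sub>R h + s *\<^sub>R k) - f (p + s *\<^sub>R h) - f (p + s *\<^sub>R k) + f p"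
    have 1: "\<bar>\<Delta> - s\<^sup>2 * D2 k h\<bar> \<le> s\<^sup>2 * (2 * e * (norm h + norm k)^2)"
      using second_difference_bound[OF a1 a2 lin e s] unfolding \<Delta>_def .
    have "s * (norm k + norm h) < d" using s by (simp add: add.commute)
    from second_difference_bound[OF a1 a2 lin e s(1) this]
    have 2: "\<bar>\<Delta> - s\<^sup>2 * D2 h k\<bar> \<le> s\<^sup>2 * (2 * e * (norm h + norm k)^2)"
      unfolding \<Delta>_def by (simp add: algebra_simps)
    have "s\<^sup>2 * \<bar>D2 h k - D2 k h\<bar> = \<bar>s\<^sup>2 * D2 h k - s\<^sup>2 * D2 k h\<bar>"
      by (simp add: abs_mult right_diff_distrib[symmetric])
    also have "\<dots> \<le> s\<^sup>2 * (C * e)" using 1 2 by (simp add: C_def algebra_simps)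
    finally show ?thesis using s by simp
  qed
  show ?thesis
  proof (rule ccontr)
    assume "D2 h k \<noteq> D2 k h"
    hence pos: "0 < \<bar>D2 h k - D2 k h\<bar>" by simp
    have C: "0 \<le> C" by (simp add: C_def)
    have "\<bar>D2 h k - D2 k h\<bar> \<le> C * (\<bar>D2 h k - D2 k h\<bar> / (2 * (C + 1)))"
      using pos C by (intro le divide_pos_pos) auto
    also have "\<dots> = \<bar>D2 h k - D2 k h\<bar> * (C / (2 * (C + 1)))" by simp
    also have "\<dots> < \<bar>D2 h k - D2 k h\<bar> * 1" using pos C by (intro mult_strict_left_mono) (auto simp: field_simps)
    finally show False by simp
  qed
qed

lemma second_derivative_symmetric:
  fixes f :: "'a::real_normed_vector \<Rightarrow> 'b::euclidean_space" and D :: "'a \<Rightarrow> 'a \<Rightarrow>\<^sub>L 'b"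
  assumes S: "open S" "p \<in> S" and der: "\<And>q. q \<in> S \<Longrightarrow> (f has_derivative blinfun_apply (D q)) (at q)"
    and D2: "(D has_derivative D2) (at p)"
  shows "D2 h k = D2 k h"
proof (rule euclidean_eqI)
  fix b :: 'b
  define I where "I = Blinfun (\<lambda>x. x \<bullet> b)"
  have I: "blinfun_apply I = (\<lambda>x. x \<bullet> b)" by (simp add: I_def bounded_linear_Blinfun_apply bounded_linear_inner_left)
  have "((\<lambda>q. f q \<bullet> b) has_derivative blinfun_apply (I o\<^sub>L D q)) (at q)" if "q \<in> S" for q
    using has_derivative_inner_left[OF der[OF that], of b] by (simp add: I blinfun_compose.rep_eq o_def)
  moreover have "((\<lambda>q. I o\<^sub>L D q) has_derivative (\<lambda>v. I o\<^sub>L D2 v)) (at p)"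
    by (rule bounded_linear.has_derivative[OF bounded_bilinear.bounded_linear_right[OF bounded_bilinear_blinfun_compose] D2])
  ultimately have "(I o\<^sub>L D2 h) k = (I o\<^sub>L D2 k) h"
    by (rule second_derivative_symmetric_real[OF S])
  thus "D2 h k \<bullet> b = D2 k h \<bullet> b" by (simp add: I)
qed

section \<open>Contact transformations of class \<open>C\<^sup>2\<close>\<close>

text \<open>
Values at \<open>p\<close> of the left-invariant horizontal fields \<open>X\<close> and \<open>Y\<close>.
\<close>

definition X_vec :: "heis \<Rightarrow> heis" where "X_vec p = (1, 2 * Im (fst p))"
definition Y_vec :: "heis \<Rightarrow> heis" where "Y_vec p = (\<i>, - 2 * Re (fst p))"

lemma horizontal_decomposition:
  assumes "contact_form p v = 0"
  shows "v = Re (fst v) *\<^sub>R X_vec p + Im (fst v) *\<^sub>R Y_vec p"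
  using assms by (simp add: prod_eq_iff complex_eq_iff contact_form_def X_vec_def Y_vec_def algebra_simps)

lemma contact_form_X_vec [simp]: "contact_form p (X_vec p) = 0"
  and contact_form_Y_vec [simp]: "contact_form p (Y_vec p) = 0"
  and contact_form_vertical [simp]: "contact_form p (0, s) = s"
  by (simp_all add: contact_form_def X_vec_def Y_vec_def)

lemma has_derivative_Im [derivative_intros]:
  "(f has_derivative f') F \<Longrightarrow> ((\<lambda>x. Im (f x)) has_derivative (\<lambda>x. Im (f' x))) F"
  by (rule bounded_linear.has_derivative[OF bounded_linear_Im])

text \<open>
Orientation-preserving contact maps together with their first two derivatives and their dilation
factor.
\<close>

locale contact_C2 =
  fixes \<Omega> :: "heis set" and f :: "heis \<Rightarrow> heis" and D :: "heis \<Rightarrow> heis \<Rightarrow>\<^sub>L heis"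
    and D2 :: "heis \<Rightarrow> heis \<Rightarrow>\<^sub>L (heis \<Rightarrow>\<^sub>L heis)" and l :: "heis \<Rightarrow> real"
  assumes open_dom: "open \<Omega>"
    and D: "p \<in> \<Omega> \<Longrightarrow> (f has_derivative blinfun_apply (D p)) (at p)"
    and D2: "p \<in> \<Omega> \<Longrightarrow> (D has_derivative blinfun_apply (D2 p)) (at p)"
    and l_pos: "p \<in> \<Omega> \<Longrightarrow> 0 < l p"
    and contact: "p \<in> \<Omega> \<Longrightarrow> contact_form (f p) (D p v) = l p * contact_form p v"
begin

lemma D_fst: "p \<in> \<Omega> \<Longrightarrow> ((\<lambda>q. fst (f q)) has_derivative (\<lambda>v. fst (D p v))) (at p)"
  by (rule has_derivative_fst[OF D])

text \<open>
This is \<open>f\<^sup>* d\<omega> = d(l \<omega>) = dl \<and> \<omega> + l d\<omega>\<close> evaluated on two horizontal vectors, on which the term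
with \<open>dl\<close> vanishes. Concretely, \<open>\<omega>(f q, D q v) = l q \<omega>(q, v)\<close> is differentiated in \<open>q\<close> and
antisymmetrised; the second derivative of \<open>f\<close> drops out because it is symmetric.
\<close>

lemma dilation_horizontal:
  assumes p: "p \<in> \<Omega>" and u: "contact_form p u = 0" and v: "contact_form p v = 0"
  shows "Im (cnj (fst (D p u)) * fst (D p v)) = l p * Im (cnj (fst u) * fst v)"
proof -
  \<comment> \<open>the pullback of the contact form on the constant field \<open>v\<close>, as a function of the point\<close>
  define \<theta> where "\<theta> v q = snd (D q v) + 2 * Im (cnj (fst (f q)) * fst (D q v))" for v q
  define \<theta>' where "\<theta>' v w = snd (D2 p w v) +
     2 * Im (cnj (fst (f p)) * fst (D2 p w v) + cnj (fst (D p w)) * fst (D p v))" for v w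
  have d1: "((\<lambda>q. D q v) has_derivative (\<lambda>w. D2 p w v)) (at p)" for v
    using bounded_linear.has_derivative[OF blinfun.bounded_linear_left D2[OF p]] .
  have d\<theta>: "(\<theta> v has_derivative \<theta>' v) (at p)" for v
    unfolding \<theta>_def[abs_def] \<theta>'_def[abs_def]
    by (intro has_derivative_add has_derivative_snd d1 has_derivative_mult_right has_derivative_Im
        has_derivative_mult has_derivative_fst bounded_linear.has_derivative[OF bounded_linear_cnj] D p)
  have \<theta>: "\<theta> v q = contact_form (f q) (D q v)" for v q
    by (simp add: \<theta>_def contact_form_def)
  have eq: "\<theta> v q = \<theta> (0, 1) q * contact_form q v" if "q \<in> \<Omega>" for v q
    unfolding \<theta> contact[OF that] by simp
  have d\<omega>: "((\<lambda>q. contact_form q v) has_derivative (\<lambda>w. 2 * Im (cnj (fst w) * fst v))) (at p)" for v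
    unfolding contact_form_def
    by (rule has_derivative_eq_rhs, (rule has_derivative_add has_derivative_const has_derivative_mult_right
        has_derivative_Im has_derivative_mult_left bounded_linear.has_derivative[OF bounded_linear_cnj]
        has_derivative_fst has_derivative_ident)+, simp)
  have "((\<lambda>q. \<theta> (0, 1) q * contact_form q v) has_derivative
      (\<lambda>w. \<theta> (0, 1) p * (2 * Im (cnj (fst w) * fst v)) + \<theta>' (0, 1) w * contact_form p v)) (at p)" for v
    by (intro has_derivative_mult d\<theta> d\<omega>)
  hence "(\<theta> v has_derivative
      (\<lambda>w. \<theta> (0, 1) p * (2 * Im (cnj (fst w) * fst v)) + \<theta>' (0, 1) w * contact_form p v)) (at p)" for v
    by (rule has_derivative_transform_within_open[OF _ open_dom p]) (rule eq[symmetric])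
  from has_derivative_unique[OF this d\<theta>]
  have key: "\<theta>' v w = \<theta> (0, 1) p * (2 * Im (cnj (fst w) * fst v)) + \<theta>' (0, 1) w * contact_form p v" for v w
    by metis
  have l: "\<theta> (0, 1) p = l p"
    unfolding \<theta> contact[OF p] by simp
  have sym: "D2 p u v = D2 p v u"
    by (rule second_derivative_symmetric[OF open_dom p D D2[OF p]])
  have "\<theta>' v u - \<theta>' u v = 2 * Im (cnj (fst (D p u)) * fst (D p v)) - 2 * Im (cnj (fst (D p v)) * fst (D p u))"
    unfolding \<theta>'_def by (simp add: sym)
  also have "\<dots> = 4 * Im (cnj (fst (D p u)) * fst (D p v))" by simp
  finally have 1: "\<theta>' v u - \<theta>' u v = 4 * Im (cnj (fst (D p u)) * fst (D p v))" .
  have "\<theta>' v u - \<theta>' u v = 4 * (l p * Im (cnj (fst u) * fst v))"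
    using key[of v u] key[of u v] u v by (simp add: l algebra_simps)
  with 1 show ?thesis by simp
qed

text \<open>
In the frame \<open>X, Y, T\<close> the derivative is block triangular: the horizontal block has determinant \<open>l\<close>
by the preceding lemma, and modulo horizontal vectors \<open>T\<close> is multiplied by \<open>l\<close>.
\<close>

lemma heis_det_contact:
  assumes p: "p \<in> \<Omega>" shows "heis_det (D p) = (l p)^2"
proof -
  define a where "a = fst (D p (X_vec p))"
  define b where "b = fst (D p (Y_vec p))"
  define c where "c = fst (D p (0, 1))"
  define w where "w = fst (f p)"
  define x y where "x = Re (fst p)" and "y = Im (fst p)"
  have e: "(1, 0) = X_vec p - (2 * y) *\<^sub>R (0, 1)" "(\<i>, 0) = Y_vec p + (2 * x) *\<^sub>R (0, 1)"
    by (simp_all add: X_vec_def Y_vec_def x_def y_def)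
  have s: "snd (D p (X_vec p)) = - 2 * Im (cnj w * a)" "snd (D p (Y_vec p)) = - 2 * Im (cnj w * b)"
    "snd (D p (0, 1)) = l p - 2 * Im (cnj w * c)"
    using contact[OF p, of "X_vec p"] contact[OF p, of "Y_vec p"] contact[OF p, of "(0, 1)"]
    by (simp_all add: a_def b_def c_def w_def) (simp_all add: contact_form_def)
  have ab: "Im (cnj a * b) = l p"
    using dilation_horizontal[OF p, of "X_vec p" "Y_vec p"] by (simp add: a_def b_def) (simp add: X_vec_def Y_vec_def)
  have "heis_det (D p) = l p * Im (cnj a * b)"
    unfolding heis_det_def e
    by (simp only: blinfun.diff_right blinfun.add_right blinfun.scaleR_right fst_add snd_add fst_diff snd_diff
         fst_scaleR snd_scaleR s a_def[symmetric] b_def[symmetric] c_def[symmetric])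
       (simp add: algebra_simps)
  thus ?thesis unfolding ab by (simp add: power2_eq_square)
qed

lemma Z_fields:
  assumes p: "p \<in> \<Omega>"
  shows "Z_field (\<lambda>q. fst (f q)) p = (fst (D p (X_vec p)) - \<i> * fst (D p (Y_vec p))) / 2"
    and "Zbar_field (\<lambda>q. fst (f q)) p = (fst (D p (X_vec p)) + \<i> * fst (D p (Y_vec p))) / 2"
proof -
  have fd: "frechet_derivative (\<lambda>q. fst (f q)) (at p) = (\<lambda>v. fst (D p v))"
    using frechet_derivative_at[OF D_fst[OF p]] by simp
  have X: "X_field (\<lambda>q. fst (f q)) p = fst (D p (X_vec p))"
  proof -
    have "X_vec p = (1, 0) + (2 * Im (fst p)) *\<^sub>R (0, 1)" by (simp add: X_vec_def)
    thus ?thesis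
      by (simp only: X_field_def partial_x_def partial_t_def fd blinfun.add_right blinfun.scaleR_right)
         (simp add: scaleR_conv_of_real)
  qed
  have Y: "Y_field (\<lambda>q. fst (f q)) p = fst (D p (Y_vec p))"
  proof -
    have "Y_vec p = (\<i>, 0) - (2 * Re (fst p)) *\<^sub>R (0, 1)" by (simp add: Y_vec_def)
    thus ?thesis
      by (simp only: Y_field_def partial_y_def partial_t_def fd blinfun.diff_right blinfun.scaleR_right)
         (simp add: scaleR_conv_of_real)
  qed
  show "Z_field (\<lambda>q. fst (f q)) p = (fst (D p (X_vec p)) - \<i> * fst (D p (Y_vec p))) / 2"
    "Zbar_field (\<lambda>q. fst (f q)) p = (fst (D p (X_vec p)) + \<i> * fst (D p (Y_vec p))) / 2"
    by (simp_all add: Z_field_def Zbar_field_def X Y)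
qed

lemma dilation_eq_Z_fields:
  assumes p: "p \<in> \<Omega>"
  shows "(norm (Z_field (\<lambda>q. fst (f q)) p))^2 - (norm (Zbar_field (\<lambda>q. fst (f q)) p))^2 = l p"
proof -
  have "(norm ((a - \<i> * b) / 2))^2 - (norm ((a + \<i> * b) / 2))^2 = Im (cnj a * b)" for a b
    unfolding norm_divide power_divide cmod_power2 by (simp add: power2_eq_square field_simps)
  moreover have "Im (cnj (fst (D p (X_vec p))) * fst (D p (Y_vec p))) = l p"
    using dilation_horizontal[OF p, of "X_vec p" "Y_vec p"] by simp (simp add: X_vec_def Y_vec_def)
  ultimately show ?thesis unfolding Z_fields[OF p] by simp
qed

lemma derivative_horizontal:
  assumes p: "p \<in> \<Omega>" and v: "contact_form p v = 0"
  shows "fst (D p v) = Z_field (\<lambda>q. fst (f q)) p * fst v + Zbar_field (\<lambda>q. fst (f q)) p * cnj (fst v)"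
proof -
  have "fst (D p v) = Re (fst v) *\<^sub>R fst (D p (X_vec p)) + Im (fst v) *\<^sub>R fst (D p (Y_vec p))"
    by (subst horizontal_decomposition[OF v]) (simp only: blinfun.add_right blinfun.scaleR_right fst_add fst_scaleR)
  thus ?thesis unfolding Z_fields[OF p]
    by (simp add: complex_eq_iff field_simps)
qed

text \<open>
With \<open>A = |Z f|\<close> and \<open>B = |Zbar f|\<close> the dilation is \<open>(A + B) (A - B) > 0\<close> and the distortion is
\<open>(A + B) / (A - B)\<close>; their product \<open>(A + B)\<^sup>2\<close> is the square of the largest horizontal stretching.
\<close>

lemma distortion_dilation:
  assumes p: "p \<in> \<Omega>"
  shows "1 \<le> distortion f p"
    and "distortion f p * l p =
      (norm (Z_field (\<lambda>q. fst (f q)) p) + norm (Zbar_field (\<lambda>q. fst (f q)) p))^2"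
proof -
  define A where "A = norm (Z_field (\<lambda>q. fst (f q)) p)"
  define B where "B = norm (Zbar_field (\<lambda>q. fst (f q)) p)"
  have AB: "A^2 - B^2 = l p" using dilation_eq_Z_fields[OF p] by (simp add: A_def B_def)
  have B0: "0 \<le> B" "0 \<le> A" by (simp_all add: A_def B_def)
  have "B^2 < A^2" using AB l_pos[OF p] by linarith
  hence lt: "B < A" using B0(2) by (rule power2_less_imp_less)
  have K: "distortion f p = (A + B) / (A - B)"
    unfolding distortion_def beltrami_def norm_divide A_def[symmetric] B_def[symmetric]
  proof -
    have "1 + B / A = (A + B) / A" "1 - B / A = (A - B) / A"
      using lt B0 by (simp_all add: add_divide_distrib diff_divide_distrib)
    thus "(1 + B / A) / (1 - B / A) = (A + B) / (A - B)" using lt B0 by simp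
  qed
  show "1 \<le> distortion f p" unfolding K using lt B0 by simp
  have "l p = (A + B) * (A - B)" unfolding AB[symmetric] by (simp add: power2_eq_square algebra_simps)
  thus "distortion f p * l p = (norm (Z_field (\<lambda>q. fst (f q)) p) + norm (Zbar_field (\<lambda>q. fst (f q)) p))^2"
    unfolding K A_def[symmetric] B_def[symmetric] using lt by (simp add: power2_eq_square)
qed

lemma derivative_horizontal_bound:
  assumes p: "p \<in> \<Omega>" and v: "contact_form p v = 0"
  shows "norm (fst (D p v)) \<le> sqrt (distortion f p * l p) * norm (fst v)"
proof -
  have "norm (fst (D p v)) \<le> norm (Z_field (\<lambda>q. fst (f q)) p * fst v) + norm (Zbar_field (\<lambda>q. fst (f q)) p * cnj (fst v))"
    unfolding derivative_horizontal[OF p v] by (rule norm_triangle_ineq)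
  also have "\<dots> = (norm (Z_field (\<lambda>q. fst (f q)) p) + norm (Zbar_field (\<lambda>q. fst (f q)) p)) * norm (fst v)"
    by (simp add: norm_mult distrib_right)
  finally show ?thesis unfolding distortion_dilation(2)[OF p] by simp
qed

lemma continuous_on_f: "continuous_on \<Omega> f"
  using D by (meson continuous_at_imp_continuous_on has_derivative_continuous)

lemma continuous_on_D: "continuous_on \<Omega> D"
  using D2 by (meson continuous_at_imp_continuous_on has_derivative_continuous)

lemma continuous_on_dilation: "continuous_on \<Omega> l"
proof -
  have "continuous_on \<Omega> (\<lambda>p. contact_form (f p) (D p (0, 1)))"
    unfolding contact_form_def by (intro continuous_intros continuous_on_f continuous_on_D)
  thus ?thesis by (simp add: contact cong: continuous_on_cong)
qed

lemma continuous_on_distortion: "continuous_on \<Omega> (distortion f)"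
proof -
  define A where "A p = norm ((fst (D p (X_vec p)) - \<i> * fst (D p (Y_vec p))) / 2)" for p
  define B where "B p = norm ((fst (D p (X_vec p)) + \<i> * fst (D p (Y_vec p))) / 2)" for p
  have "continuous_on \<Omega> A" "continuous_on \<Omega> B"
    unfolding A_def[abs_def] B_def[abs_def] X_vec_def Y_vec_def
    by (intro continuous_intros continuous_on_D; simp)+
  hence "continuous_on \<Omega> (\<lambda>p. (A p + B p)^2 / l p)"
    using l_pos by (intro continuous_intros continuous_on_dilation) (auto simp: less_imp_neq[symmetric] dest!: l_pos)
  moreover have "distortion f p = (A p + B p)^2 / l p" if "p \<in> \<Omega>" for p
    using distortion_dilation(2)[OF that] l_pos[OF that] unfolding A_def B_def Z_fields[OF that]
    by (simp add: field_simps)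
  ultimately show ?thesis by (simp cong: continuous_on_cong)
qed

end

lemma contact_C2_ex:
  assumes "op_contact_transformation \<Omega> \<Omega>' f" "open \<Omega>"
  obtains D D2 l where "contact_C2 \<Omega> f D D2 l"
proof -
  from assms(1) obtain D D2 l where
    D: "\<And>p. p \<in> \<Omega> \<Longrightarrow> (f has_derivative blinfun_apply (D p)) (at p)" and
    D2: "\<And>p. p \<in> \<Omega> \<Longrightarrow> (D has_derivative blinfun_apply (D2 p)) (at p)" and
    l: "\<And>p. p \<in> \<Omega> \<Longrightarrow> 0 < l p"
      "\<And>p v. p \<in> \<Omega> \<Longrightarrow> contact_form (f p) (frechet_derivative f (at p) v) = l p * contact_form p v"
    unfolding op_contact_transformation_def C2_diffeomorphism_def C2_on_def by blast
  have "contact_C2 \<Omega> f D D2 l"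
    using assms(2) D D2 l by unfold_locales (auto simp: frechet_derivative_at[OF D, symmetric])
  thus ?thesis by (rule that)
qed

section \<open>The gauge and the logarithmic chart\<close>

text \<open>
The square of the Koranyi norm.
\<close>

definition gauge :: "heis \<Rightarrow> real" where
  "gauge p = sqrt (norm (fst p) ^ 4 + (snd p)\<^sup>2)"

lemma gauge_square: "(gauge p)^2 = norm (fst p) ^ 4 + (snd p)\<^sup>2"
  by (simp add: gauge_def)

lemma gauge_nonneg [simp]: "0 \<le> gauge p" by (simp add: gauge_def)

lemma gauge_pos_iff: "0 < gauge p \<longleftrightarrow> p \<noteq> 0"
proof -
  have "norm (fst p) ^ 4 + (snd p)\<^sup>2 = 0 \<longleftrightarrow> norm (fst p) ^ 4 = 0 \<and> (snd p)\<^sup>2 = 0"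
    by (intro add_nonneg_eq_0_iff) auto
  hence "norm (fst p) ^ 4 + (snd p)\<^sup>2 = 0 \<longleftrightarrow> p = 0" by (simp add: prod_eq_iff)
  moreover have "0 \<le> norm (fst p) ^ 4 + (snd p)\<^sup>2" by simp
  ultimately show ?thesis unfolding gauge_def by (simp only: real_sqrt_gt_0_iff) linarith
qed

lemma continuous_on_gauge [continuous_intros]: "continuous_on S f \<Longrightarrow> continuous_on S (\<lambda>x. gauge (f x))"
  unfolding gauge_def by (intro continuous_intros)

lemma gauge_eq_iff: "0 \<le> r \<Longrightarrow> gauge p = r^2 \<longleftrightarrow> norm (fst p) ^ 4 + (snd p)\<^sup>2 = r^4"
proof -
  have "r^4 = (r^2)^2" by simp
  thus ?thesis unfolding gauge_square[symmetric] by (simp only: power2_eq_iff_nonneg gauge_nonneg zero_le_power2)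
qed

lemma spherical_ring_gauge:
  assumes "0 < a" "0 < b" shows "spherical_ring a b = {p. a^2 < gauge p \<and> gauge p < b^2}"
proof -
  have "x^4 < (gauge p)^2 \<longleftrightarrow> x^2 < gauge p" "(gauge p)^2 < x^4 \<longleftrightarrow> gauge p < x^2" for x :: real and p
  proof -
    have x: "x^4 = (x^2)^2" by simp
    show "x^4 < (gauge p)^2 \<longleftrightarrow> x^2 < gauge p" "(gauge p)^2 < x^4 \<longleftrightarrow> gauge p < x^2"
      unfolding x by (meson gauge_nonneg power2_less_imp_less power_strict_mono zero_le_power2 zero_less_numeral)+
  qed
  thus ?thesis unfolding spherical_ring_def gauge_square by auto
qed

lemma koranyi_sphere_gauge: "0 < r \<Longrightarrow> koranyi_sphere r = {p. gauge p = r^2}"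
  by (auto simp: koranyi_sphere_def gauge_eq_iff)

lemma open_spherical_ring: "0 < a \<Longrightarrow> 0 < b \<Longrightarrow> open (spherical_ring a b)"
  by (simp add: spherical_ring_gauge) (intro open_Collect_conj open_Collect_less continuous_intros)

lemma spherical_ring_nonzero: "0 < a \<Longrightarrow> 0 < b \<Longrightarrow> p \<in> spherical_ring a b \<Longrightarrow> p \<noteq> 0"
  by (auto simp: spherical_ring_gauge gauge_pos_iff[symmetric] intro: less_trans[rotated])

text \<open>
Logarithmic coordinates with \<open>u = tan \<psi>\<close> as third parameter, written as a point
\<open>(\<xi> + i \<eta>, u)\<close> of \<open>\<complex> \<times> \<real>\<close>, so that the change of variables formula applies to the chart. The first
component of the chart is \<open>i\<close> times the exponential of this exponent; this form is easy to
differentiate.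
\<close>

definition chart_exponent :: "heis \<Rightarrow> complex" where
  "chart_exponent p = Complex (Re (fst p) / 2 - ln (1 + (snd p)^2) / 4) ((arctan (snd p) - 3 * Im (fst p)) / 2)"

definition chart :: "heis \<Rightarrow> heis" where
  "chart p = log_coords (Re (fst p)) (arctan (snd p)) (Im (fst p))"

lemma one_plus_square_pos [simp]: "0 < 1 + (u::real)^2"
  by (metis add_pos_nonneg zero_le_power2 zero_less_one)

lemma one_plus_square_nz [simp]: "1 + (u::real)^2 \<noteq> 0"
  using one_plus_square_pos[of u] by linarith

lemma exp_half_ln: "exp (x - ln (1 + u^2) / 2) = exp x / sqrt (1 + (u::real)^2)"
  by (simp add: exp_diff ln_sqrt[symmetric])

lemma chart_eq: "chart p = (\<i> * exp (chart_exponent p), - snd p * exp (Re (fst p) - ln (1 + (snd p)^2) / 2))"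
proof -
  define u where "u = snd p"
  have c: "complex_of_real (sqrt (1 / sqrt (1 + u^2))) = exp (complex_of_real (- ln (1 + u^2) / 4))"
  proof -
    have "sqrt (1 / sqrt (1 + u^2)) = exp (- ln (1 + u^2) / 4)"
    proof (rule real_sqrt_unique)
      have "exp (- ln (1 + u^2) / 4)^2 = exp (0 - ln (1 + u^2) / 2)"
        by (simp add: exp_double[symmetric])
      thus "exp (- ln (1 + u^2) / 4)^2 = 1 / sqrt (1 + u^2)" unfolding exp_half_ln by simp
    qed simp
    thus ?thesis by (simp only: exp_of_real)
  qed
  have e: "chart_exponent p = complex_of_real (- ln (1 + u^2) / 4) + Complex (Re (fst p)) (arctan u - 3 * Im (fst p)) / 2"
    by (simp add: chart_exponent_def u_def complex_eq_iff)
  show ?thesis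
    unfolding chart_def log_coords_def cos_arctan sin_arctan exp_half_ln u_def[symmetric] c e exp_add
    by simp
qed

lemma norm_chart: "(norm (fst (chart p)))^2 = exp (Re (fst p) - ln (1 + (snd p)^2) / 2)"
  by (simp add: chart_eq norm_mult chart_exponent_def exp_double[symmetric])

lemma snd_chart: "snd (chart p) = - snd p * (norm (fst (chart p)))^2"
  unfolding norm_chart by (simp add: chart_eq)

lemma fst_chart_nz [simp]: "fst (chart p) \<noteq> 0" by (simp add: chart_eq)

lemma norm_fst_chart_pos [simp]: "0 < norm (fst (chart p))" by simp

lemma gauge_chart: "gauge (chart p) = exp (Re (fst p))"
proof -
  have "(gauge (chart p))^2 = exp (Re (fst p))^2"
    unfolding gauge_square using log_coords_gauge[of "arctan (snd p)"] arctan_lbound[of "snd p"] arctan_ubound[of "snd p"]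
    by (simp add: chart_def exp_double)
  thus ?thesis by simp
qed

lemma gauge_chart_norm: "gauge (chart p) = (norm (fst (chart p)))^2 * sqrt (1 + (snd p)^2)"
  unfolding gauge_chart norm_chart exp_half_ln by simp

definition chart_derivative :: "heis \<Rightarrow> heis \<Rightarrow> heis" where
  "chart_derivative p h =
     (fst (chart p) * Complex (Re (fst h) / 2 - snd p * snd h / (2 * (1 + (snd p)^2)))
        ((snd h / (1 + (snd p)^2) - 3 * Im (fst h)) / 2),
      - ((norm (fst (chart p)))^2) * (snd p * Re (fst h) + snd h / (1 + (snd p)^2)))"

lemma chart_has_derivative: "(chart has_derivative chart_derivative p) (at p within X)"
proof -
  define A where "A q = Re (fst q) / 2 - ln (1 + (snd q)^2) / 4" for q :: heis
  define B where "B q = (arctan (snd q) - 3 * Im (fst q)) / 2" for q :: heis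
  define A' where "A' h = Re (fst h) / 2 - snd p * snd h / (2 * (1 + (snd p)^2))" for h :: heis
  define B' where "B' h = (snd h / (1 + (snd p)^2) - 3 * Im (fst h)) / 2" for h :: heis
  have nz: "2 + 2 * (snd p)^2 \<noteq> 0" "16 + 16 * (snd p)^2 \<noteq> 0" "4 + 4 * (snd p)^2 \<noteq> 0"
    "16 + (snd p)^2 * 16 \<noteq> 0"
    using one_plus_square_nz[of "snd p"] by linarith+
  have A: "(A has_derivative A') (at p within X)"
    unfolding A_def[abs_def] A'_def[abs_def]
    by (auto intro!: derivative_eq_intros bounded_linear.has_derivative[OF bounded_linear_Re] simp: divide_simps nz fun_eq_iff) (simp add: algebra_simps)
  have B: "(B has_derivative B') (at p within X)"
    unfolding B_def[abs_def] B'_def[abs_def]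
    by (auto intro!: derivative_eq_intros bounded_linear.has_derivative[OF bounded_linear_Im] simp: divide_simps nz fun_eq_iff) (simp_all add: algebra_simps)
  have C: "(chart_exponent has_derivative (\<lambda>h. Complex (A' h) (B' h))) (at p within X)"
  proof -
    have "((\<lambda>q. complex_of_real (A q) + \<i> * complex_of_real (B q)) has_derivative
       (\<lambda>h. complex_of_real (A' h) + \<i> * complex_of_real (B' h))) (at p within X)"
      by (intro has_derivative_add has_derivative_mult_right has_derivative_of_real A B)
    moreover have "(\<lambda>q. complex_of_real (A q) + \<i> * complex_of_real (B q)) = chart_exponent"
       by (auto simp: chart_exponent_def A_def B_def complex_eq_iff fun_eq_iff)
    moreover have "(\<lambda>h. complex_of_real (A' h) + \<i> * complex_of_real (B' h)) = (\<lambda>h. Complex (A' h) (B' h))"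
       by (auto simp: complex_eq_iff fun_eq_iff)
    ultimately show ?thesis by simp
  qed
  have "((\<lambda>q. exp (chart_exponent q)) has_derivative (\<lambda>h. exp (chart_exponent p) * Complex (A' h) (B' h))) (at p within X)"
    using has_derivative_compose[OF C, of exp "\<lambda>x. exp (chart_exponent p) * x"]
    DERIV_exp[of "chart_exponent p"] unfolding has_field_derivative_def by blast
  hence F: "((\<lambda>q. \<i> * exp (chart_exponent q)) has_derivative (\<lambda>h. fst (chart p) * Complex (A' h) (B' h))) (at p within X)"
    using has_derivative_mult_right[of _ _ _ "\<i>"] by (simp add: chart_eq mult.assoc)
  have S: "((\<lambda>q. - snd q * exp (Re (fst q) - ln (1 + (snd q)^2) / 2)) has_derivative
     (\<lambda>h. - ((norm (fst (chart p)))^2) * (snd p * Re (fst h) + snd h / (1 + (snd p)^2)))) (at p within X)"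
  proof -
    define M where "M q = exp (Re (fst q) - ln (1 + (snd q)^2) / 2)" for q :: heis
    have M: "(M has_derivative (\<lambda>h. M p * (Re (fst h) - snd p * snd h / (1 + (snd p)^2)))) (at p within X)"
    proof -
      have M2: "M = (\<lambda>q. exp (2 * A q))" by (auto simp: M_def A_def fun_eq_iff)
      have "((\<lambda>q. exp (2 * A q)) has_derivative (\<lambda>h. exp (2 * A p) * (2 * A' h))) (at p within X)"
        using has_derivative_compose[OF has_derivative_mult_right[OF A, of 2], of exp "\<lambda>x. exp (2 * A p) * x"]
          DERIV_exp[of "2 * A p"] unfolding has_field_derivative_def by blast
      moreover have "2 * A' h = Re (fst h) - snd p * snd h / (1 + (snd p)^2)" for h
      proof -
        have "2 * (x / 2 - y / (2 * c)) = x - y / c" for x y c :: real by simp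
        thus ?thesis unfolding A'_def .
      qed
      ultimately show ?thesis unfolding M2 by simp
    qed
    have Mp: "M p = (norm (fst (chart p)))^2" by (simp add: M_def norm_chart)
    have "((\<lambda>q. - snd q * M q) has_derivative (\<lambda>h. - snd p * (M p * (Re (fst h) - snd p * snd h / (1 + (snd p)^2)))
        + - snd h * M p)) (at p within X)"
      by (intro has_derivative_mult M has_derivative_minus has_derivative_snd has_derivative_ident)
    moreover have "- snd p * (M p * (Re (fst h) - snd p * snd h / (1 + (snd p)^2))) + - snd h * M p
       = - ((norm (fst (chart p)))^2) * (snd p * Re (fst h) + snd h / (1 + (snd p)^2))" for h :: heis
    proof -
      have "- u * (m * (r - u * y / c)) + - y * m = - m * (u * r + y / c)" if c: "c = 1 + u^2" for u m r y c :: real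
      proof -
        have "c \<noteq> 0" using c by simp
        hence "y / c = y - u * (u * y / c)" by (simp add: field_simps) (simp add: c power2_eq_square algebra_simps)
        thus ?thesis by (simp only:) (simp add: algebra_simps)
      qed
      thus ?thesis unfolding Mp by blast
    qed
    ultimately show ?thesis by (simp add: M_def)
  qed
  have "chart = (\<lambda>q. (\<i> * exp (chart_exponent q), - snd q * exp (Re (fst q) - ln (1 + (snd q)^2) / 2)))"
    using chart_eq by auto
  moreover have "chart_derivative p = (\<lambda>h. (fst (chart p) * Complex (A' h) (B' h),
      - ((norm (fst (chart p)))^2) * (snd p * Re (fst h) + snd h / (1 + (snd p)^2))))"
    by (simp add: chart_derivative_def A'_def B'_def fun_eq_iff)
  ultimately show ?thesis using has_derivative_Pair[OF F S] by simp
qed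

lemma continuous_on_chart [continuous_intros]: "continuous_on X f \<Longrightarrow> continuous_on X (\<lambda>x. chart (f x))"
  using chart_has_derivative
  by (intro continuous_on_compose2[of UNIV chart X f] continuous_at_imp_continuous_on)
     (auto intro: has_derivative_continuous)

lemma measurable_chart [measurable]: "chart \<in> borel_measurable borel"
  by (intro borel_measurable_continuous_onI continuous_intros)

text \<open>
In these coordinates \<open>\<omega> = - |z|\<^sup>2 (u d\<xi> + 3 d\<eta>)\<close>, so \<open>\<omega> \<and> d\<omega>\<close>, which is four times the volume
form, is \<open>3 |z|\<^sup>4\<close> times the coordinate volume form, up to sign.
\<close>

lemma heis_det_chart: "heis_det (chart_derivative p) = 3 / 4 * (norm (fst (chart p)))^4"
proof -
  define z where "z = fst (chart p)"
  define u where "u = snd p"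
  define s where "s = 1 + u^2"
  have s: "s \<noteq> 0" unfolding s_def by simp
  have cz: "Im (cnj (z * x) * (z * y)) = (norm z)^2 * Im (cnj x * y)" for x y
  proof -
    have "cnj (z * x) * (z * y) = (z * cnj z) * (cnj x * y)" by simp
    also have "\<dots> = complex_of_real ((norm z)^2) * (cnj x * y)" by (simp only: complex_norm_square)
    moreover have "Im (complex_of_real r * e) = r * Im e" for r e by simp
    ultimately show ?thesis by (simp only:)
  qed
  have "heis_det (chart_derivative p) = 3 / 4 * (norm z)^2 * (norm z)^2 * ((1 + u^2) / s)"
    unfolding heis_det_def chart_derivative_def z_def[symmetric] u_def[symmetric] s_def[symmetric] fst_conv snd_conv cz
    using s by (simp add: field_simps power2_eq_square) (simp add: s_def algebra_simps power2_eq_square)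
  thus ?thesis using s unfolding s_def[symmetric] z_def[symmetric] by (simp add: power4_eq_xxxx power2_eq_square)
qed

text \<open>
The coordinate lines of \<open>u\<close> are horizontal; the norm is their speed.
\<close>

lemma chart_derivative_vertical:
  "contact_form (chart p) (chart_derivative p (0, 1)) = 0"
  "norm (fst (chart_derivative p (0, 1))) = norm (fst (chart p)) / (2 * sqrt (1 + (snd p)^2))"
proof -
  define z where "z = fst (chart p)"
  define u where "u = snd p"
  define s where "s = 1 + u^2"
  have s: "0 < s" unfolding s_def by simp
  define e where "e = Complex (- u / (2 * s)) (1 / (2 * s))"
  have cd: "chart_derivative p (0, 1) = (z * e, - ((norm z)^2) / s)"
    unfolding chart_derivative_def z_def[symmetric] u_def[symmetric] s_def[symmetric] e_def by (simp add: field_simps)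
  have "cnj z * (z * e) = complex_of_real ((norm z)^2) * e"
    unfolding complex_norm_square by (simp only: mult_ac)
  moreover have "Im (complex_of_real r * e) = r * Im e" for r by simp
  ultimately have "Im (cnj z * (z * e)) = (norm z)^2 / (2 * s)" by (simp only:) (simp add: e_def)
  thus "contact_form (chart p) (chart_derivative p (0, 1)) = 0"
    unfolding contact_form_def cd z_def[symmetric] by simp
  have "(norm e)^2 = (u^2 + 1) / (4 * s^2)"
    by (simp add: cmod_power2 e_def power_divide power_mult_distrib add_divide_distrib)
  also have "\<dots> = s / (4 * s^2)" by (simp add: s_def add.commute)
  also have "\<dots> = (1 / (2 * sqrt s))^2"
    using s by (simp add: power_divide power_mult_distrib) (simp add: power2_eq_square)
  finally have "(norm e)^2 = (1 / (2 * sqrt s))^2" .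
  hence "norm e = 1 / (2 * sqrt s)" using s by (simp add: power2_eq_iff_nonneg)
  thus "norm (fst (chart_derivative p (0, 1))) = norm (fst (chart p)) / (2 * sqrt (1 + (snd p)^2))"
    unfolding cd z_def[symmetric] u_def[symmetric] s_def[symmetric] by (simp add: norm_mult)
qed

text \<open>
The parameters \<open>\<xi> + i \<eta>\<close>; since \<open>\<eta>\<close> matters modulo \<open>4 \<pi> / 3\<close>, a half-open interval of this length
makes the chart injective.
\<close>

definition base_strip :: "real \<Rightarrow> real \<Rightarrow> complex set" where
  "base_strip \<alpha> \<beta> = {c. \<alpha> < Re c \<and> Re c < \<beta> \<and> - 2 * pi / 3 \<le> Im c \<and> Im c < 2 * pi / 3}"

lemma base_strip_borel [measurable]: "base_strip \<alpha> \<beta> \<in> sets borel"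
  unfolding base_strip_def by measurable

lemma emeasure_base_strip:
  assumes "\<alpha> \<le> \<beta>" shows "emeasure lborel (base_strip \<alpha> \<beta>) = ennreal ((\<beta> - \<alpha>) * (4 * pi / 3))"
proof -
  define l where "l = Complex \<alpha> (- 2 * pi / 3)"
  define u where "u = Complex \<beta> (2 * pi / 3)"
  have le: "\<And>b. b \<in> Basis \<Longrightarrow> l \<bullet> b \<le> u \<bullet> b" using assms by (auto simp: Basis_complex_def l_def u_def)
  have p: "(\<Prod>b\<in>Basis. (u - l) \<bullet> b) = (\<beta> - \<alpha>) * (4 * pi / 3)"
    by (simp add: Basis_complex_def l_def u_def)
  have "box l u \<subseteq> base_strip \<alpha> \<beta>" "base_strip \<alpha> \<beta> \<subseteq> cbox l u"
    by (auto simp: base_strip_def box_def cbox_def Basis_complex_def l_def u_def)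
  hence "emeasure lborel (box l u) \<le> emeasure lborel (base_strip \<alpha> \<beta>)"
     "emeasure lborel (base_strip \<alpha> \<beta>) \<le> emeasure lborel (cbox l u)"
    by (auto intro!: emeasure_mono)
  thus ?thesis using le p by (simp add: emeasure_lborel_box_eq emeasure_lborel_cbox_eq)
qed

lemma inj_on_chart: "inj_on chart (base_strip \<alpha> \<beta> \<times> UNIV)"
proof (rule inj_onI)
  fix p q assume pq: "p \<in> base_strip \<alpha> \<beta> \<times> UNIV" "q \<in> base_strip \<alpha> \<beta> \<times> UNIV" and eq: "chart p = chart q"
  have b: "- pi / 2 < arctan x" "arctan x < pi / 2" for x using arctan_lbound[of x] arctan_ubound[of x] by auto
  note D = log_coords_eqD[OF b b eq[unfolded chart_def]]
  have re: "Re (fst p) = Re (fst q)" and u: "snd p = snd q" using D(1,2) arctan_eq_iff by auto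
  have "exp (chart_exponent p) = exp (chart_exponent q)" using eq by (simp add: chart_eq)
  then obtain n :: int where "chart_exponent p = chart_exponent q + complex_of_real (of_int (2 * n) * pi) * \<i>"
    using exp_eq by auto
  hence "Im (chart_exponent p) = Im (chart_exponent q) + 2 * of_int n * pi"
    by (simp add: complex_eq_iff)
  hence n: "Im (fst q) - Im (fst p) = 4 * pi / 3 * of_int n"
    by (simp add: chart_exponent_def u field_simps)
  \<comment> \<open>two values in the half-open interval differ by less than its length, which excludes other branches\<close>
  have "\<bar>Im (fst q) - Im (fst p)\<bar> < 4 * pi / 3" using pq by (auto simp: base_strip_def abs_if)
  hence "4 * pi / 3 * \<bar>of_int n :: real\<bar> < 4 * pi / 3 * 1" unfolding n by (simp add: abs_mult)
  hence "\<bar>of_int n :: real\<bar> < 1" by (rule mult_left_less_imp_less) simp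
  hence "n = 0" by linarith
  thus "p = q" using n re u by (simp add: prod_eq_iff complex_eq_iff)
qed

lemma chart_surj:
  assumes "fst p \<noteq> 0"
  obtains q where "chart q = p" "- 2 * pi / 3 \<le> Im (fst q)" "Im (fst q) < 2 * pi / 3"
proof -
  define w where "w = (norm (fst p))^2"
  define u where "u = - snd p / w"
  have w: "0 < w" using assms by (simp add: w_def)
  have g: "gauge p = w * sqrt (1 + u^2)"
  proof -
    have "gauge p = sqrt (w^2 * (1 + u^2))"
      using w assms unfolding gauge_def u_def w_def by (simp add: field_simps power2_eq_square power4_eq_xxxx)
    thus ?thesis using w by (simp add: real_sqrt_mult)
  qed
  have gp: "0 < gauge p" unfolding g using w by (intro mult_pos_pos) auto
  \<comment> \<open>the point with the coordinates \<open>\<xi>\<close> and \<open>u\<close> of \<open>p\<close> and \<open>\<eta> = 0\<close>; it remains to turn it by an angle\<close>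
  define y where "y = \<i> * exp (chart_exponent (Complex (ln (gauge p)) 0, u))"
  define \<theta> where "\<theta> = Arg (fst p / y)"
  define q where "q = (Complex (ln (gauge p)) (- 2 * \<theta> / 3), u)"
  have y0: "y \<noteq> 0" by (simp add: y_def)
  have ny: "(norm y)^2 = w"
  proof -
    have "y = fst (chart (Complex (ln (gauge p)) 0, u))" by (simp add: chart_eq y_def)
    hence "(norm y)^2 = exp (ln (gauge p) - ln (1 + u^2) / 2)" using norm_chart by simp
    thus ?thesis unfolding exp_half_ln using gp g w by simp
  qed
  have "norm y = norm (fst p)" using ny w by (simp add: w_def power2_eq_iff_nonneg)
  hence n1: "norm (fst p / y) = 1" using y0 assms by (simp add: norm_divide)
  have cis: "cis \<theta> = fst p / y"
    using cis_Arg[of "fst p / y"] n1 y0 assms unfolding \<theta>_def by (simp add: sgn_eq)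
  have "chart_exponent q = chart_exponent (Complex (ln (gauge p)) 0, u) + \<i> * \<theta>"
    by (simp add: q_def chart_exponent_def complex_eq_iff field_simps)
  hence "\<i> * exp (chart_exponent q) = y * cis \<theta>" by (simp add: y_def exp_add cis_conv_exp)
  hence f: "fst (chart q) = fst p" using cis y0 by (simp add: chart_eq)
  hence "snd (chart q) = snd p" using w unfolding snd_chart by (simp add: q_def u_def w_def)
  with f have "chart q = p" by (simp add: prod_eq_iff)
  moreover have "- 2 * pi / 3 \<le> Im (fst q)" "Im (fst q) < 2 * pi / 3"
    using Arg_bounded[of "fst p / y"] unfolding \<theta>_def[symmetric] by (auto simp: q_def)
  ultimately show ?thesis using that by blast
qed

lemma chart_image:
  assumes "0 < a" "0 < b"
  shows "chart ` (base_strip (2 * ln a) (2 * ln b) \<times> UNIV) = spherical_ring a b - vertical_axis"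
proof -
  have sq: "a^2 = exp (2 * ln a)" "b^2 = exp (2 * ln b)" using assms by (simp_all add: exp_double)
  have ring: "chart q \<in> spherical_ring a b \<longleftrightarrow> 2 * ln a < Re (fst q) \<and> Re (fst q) < 2 * ln b" for q
    unfolding spherical_ring_gauge[OF assms] sq by (simp add: gauge_chart)
  show ?thesis
  proof (intro equalityI subsetI)
    fix p assume "p \<in> chart ` (base_strip (2 * ln a) (2 * ln b) \<times> UNIV)"
    thus "p \<in> spherical_ring a b - vertical_axis"
      using ring fst_chart_nz by (auto simp: base_strip_def vertical_axis_def) (metis fst_conv fst_chart_nz)
  next
    fix p assume p: "p \<in> spherical_ring a b - vertical_axis"
    hence "fst p \<noteq> 0" by (cases p) (auto simp: vertical_axis_def)
    then obtain q where q: "chart q = p" "- 2 * pi / 3 \<le> Im (fst q)" "Im (fst q) < 2 * pi / 3"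
      by (rule chart_surj)
    have "q \<in> base_strip (2 * ln a) (2 * ln b) \<times> UNIV"
      using q p ring[of q] by (cases q) (auto simp: base_strip_def)
    thus "p \<in> chart ` (base_strip (2 * ln a) (2 * ln b) \<times> UNIV)" using q by blast
  qed
qed

lemma vertical_axis_null: "vertical_axis \<in> null_sets lborel"
proof -
  have "vertical_axis \<subseteq> {p. (1, 0) \<bullet> p = 0}" by (auto simp: vertical_axis_def)
  moreover have "negligible {p :: heis. (1, 0) \<bullet> p = 0}"
    by (rule negligible_hyperplane) (simp add: prod_eq_iff)
  ultimately have "negligible vertical_axis" by (rule negligible_subset[rotated])
  moreover have "closed vertical_axis"
  proof -
    have "vertical_axis = {p. fst p = 0}" by (auto simp: vertical_axis_def)
    moreover have "closed {p :: heis. fst p = 0}" by (intro closed_Collect_eq continuous_intros)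
    ultimately show ?thesis by simp
  qed
  ultimately show ?thesis
    by (simp add: negligible_iff_null_sets null_sets_completion_iff)
qed

text \<open>
Polar coordinates adapted to the ring: the axis is a null set, and the chart parametrises the rest.
\<close>

theorem nn_integral_spherical_ring:
  fixes h :: "heis \<Rightarrow> real"
  assumes ab: "0 < a" "0 < b" and h [measurable]: "h \<in> borel_measurable borel" and nn: "\<And>p. 0 \<le> h p"
  shows "(\<integral>\<^sup>+p\<in>spherical_ring a b. ennreal (h p) \<partial>lborel) =
    (\<integral>\<^sup>+c\<in>base_strip (2 * ln a) (2 * ln b).
       (\<integral>\<^sup>+u. ennreal (3 / 4 * (norm (fst (chart (c, u))))^4 * h (chart (c, u))) \<partial>lborel) \<partial>lborel)"
proof -
  define B where "B = base_strip (2 * ln a) (2 * ln b)"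
  have [measurable]: "B \<in> sets borel" by (simp add: B_def)
  have B: "B \<times> UNIV \<in> sets (borel :: heis measure)"
    unfolding borel_prod[symmetric] by (intro pair_measureI) auto
  have ax: "vertical_axis \<in> sets borel" using vertical_axis_null by auto
  have ring: "spherical_ring a b \<in> sets borel" using open_spherical_ring[OF ab] by auto
  define F where "F p = 3 / 4 * (norm (fst (chart p)))^4 * h (chart p)" for p
  have [measurable]: "(\<lambda>p. h (chart p)) \<in> borel_measurable borel"
    using measurable_compose[OF measurable_chart h] .
  have [measurable]: "(\<lambda>p. norm (fst (chart p))) \<in> borel_measurable borel"
    by (intro borel_measurable_continuous_onI continuous_intros)
  have [measurable]: "F \<in> borel_measurable borel" unfolding F_def by measurable
  have "(\<integral>\<^sup>+p\<in>spherical_ring a b. ennreal (h p) \<partial>lborel) =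
        (\<integral>\<^sup>+p\<in>spherical_ring a b - vertical_axis. ennreal (h p) \<partial>lborel)"
    using AE_not_in[OF vertical_axis_null] by (intro nn_integral_cong_AE) (auto simp: indicator_def)
  also have "\<dots> = (\<integral>\<^sup>+p\<in>chart ` (B \<times> UNIV). ennreal (h p) \<partial>lborel)"
    unfolding B_def chart_image[OF ab] ..
  also have "\<dots> = (\<integral>\<^sup>+p\<in>B \<times> UNIV. ennreal (\<bar>heis_det (chart_derivative p)\<bar> * h (chart p)) \<partial>lborel)"
  proof (rule nn_integral_change_of_variables_heis[OF B])
    show "chart ` (B \<times> UNIV) \<in> sets borel" unfolding B_def chart_image[OF ab] using ring ax by auto
    show "inj_on chart (B \<times> UNIV)" unfolding B_def by (rule inj_on_chart)
    have "(\<lambda>p. indicator (B \<times> UNIV) p * (\<bar>heis_det (chart_derivative p)\<bar> * h (chart p))) =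
          (\<lambda>p. indicator (B \<times> UNIV) p * F p)"
      by (simp add: heis_det_chart F_def)
    also have "\<dots> \<in> borel_measurable borel" using B by measurable
    finally show "(\<lambda>p. indicator (B \<times> UNIV) p * (\<bar>heis_det (chart_derivative p)\<bar> * h (chart p))) \<in> borel_measurable borel" .
  qed (auto simp: nn chart_has_derivative)
  also have "\<dots> = (\<integral>\<^sup>+p. ennreal (F p) * indicator (B \<times> UNIV) p \<partial>(lborel \<Otimes>\<^sub>M lborel))"
    by (simp add: heis_det_chart F_def lborel_prod)
  also have "\<dots> = (\<integral>\<^sup>+c. (\<integral>\<^sup>+u. ennreal (F (c, u)) * indicator (B \<times> UNIV) (c, u) \<partial>lborel) \<partial>lborel)"
    using B by (intro lborel.nn_integral_fst[symmetric]) (simp add: lborel_prod)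
  also have "\<dots> = (\<integral>\<^sup>+c\<in>B. (\<integral>\<^sup>+u. ennreal (F (c, u)) \<partial>lborel) \<partial>lborel)"
    by (intro nn_integral_cong) (auto simp: indicator_def)
  finally show ?thesis unfolding B_def F_def .
qed

section \<open>A closed form of the stretch map\<close>

text \<open>
Both angles have the same sign and modulus below \<open>\<pi>/2\<close>, so their difference lies in the range on
which \<open>arctan\<close> inverts \<open>tan\<close>. The right side remains smooth when it is expressed in \<open>z\<close> and \<open>t\<close>, where
\<open>u = - t / |z|\<^sup>2\<close> has a pole at the axis.
\<close>

lemma arctan_divide_difference:
  assumes k: "0 < k"
  shows "arctan (u / k) = arctan u + arctan ((1 - k) * u / (k + u^2))"
proof -
  define d where "d = arctan (u / k) - arctan u"
  have d: "- (pi / 2) < d" "d < pi / 2"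
  proof -
    have b: "- (pi / 2) < arctan u" "arctan u < pi / 2" "- (pi / 2) < arctan (u / k)" "arctan (u / k) < pi / 2"
      using arctan_lbound arctan_ubound by auto
    consider "0 \<le> arctan u" "0 \<le> arctan (u / k)" | "arctan u \<le> 0" "arctan (u / k) \<le> 0"
      using k by (cases "0 \<le> u") (auto simp: zero_le_arctan_iff arctan_le_zero_iff divide_nonpos_pos)
    thus "- (pi / 2) < d" "d < pi / 2" using b unfolding d_def by (cases; linarith)+
  qed
  have c: "cos d \<noteq> 0" using d by (intro less_imp_neq[symmetric] cos_gt_zero_pi) auto
  have p: "0 < k + u^2" using k by (intro add_pos_nonneg) auto
  have "tan d = (u / k - u) / (1 + u / k * u)"
    unfolding d_def using c by (subst tan_diff) (auto simp: tan_arctan d_def)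
  also have "\<dots> = (1 - k) * u / (k + u^2)"
  proof -
    have "u / k - u = (1 - k) * u / k" "1 + u / k * u = (k + u^2) / k"
      using k by (simp_all add: field_simps power2_eq_square)
    thus ?thesis using k by simp
  qed
  finally have "arctan ((1 - k) * u / (k + u^2)) = d" using arctan_tan[of d] d by simp
  thus ?thesis by (simp add: d_def)
qed

definition zsq :: "heis \<Rightarrow> real" where "zsq p = (Re (fst p))^2 + (Im (fst p))^2"

lemma zsq_norm: "zsq p = (norm (fst p))^2" by (simp add: zsq_def cmod_power2)

lemma zsq_gauge: "(zsq p)^2 + (snd p)^2 = (gauge p)^2"
  by (simp add: gauge_square zsq_norm)

definition aniso_gauge_sq :: "real \<Rightarrow> heis \<Rightarrow> real" where
  "aniso_gauge_sq k p = k^2 * (zsq p)^2 + (snd p)^2"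

lemma weighted_pos:
  assumes "0 < c" "p \<noteq> 0" shows "0 < c * (zsq p)^2 + (snd p)^2"
proof -
  have "0 \<le> c * (zsq p)^2 + (snd p)^2" using assms by simp
  moreover have "c * (zsq p)^2 + (snd p)^2 \<noteq> 0"
  proof
    assume 0: "c * (zsq p)^2 + (snd p)^2 = 0"
    moreover have "0 \<le> c * (zsq p)^2" using assms by simp
    ultimately have "c * (zsq p)^2 = 0 \<and> (snd p)^2 = 0" by (simp add: add_nonneg_eq_0_iff)
    thus False using assms by (auto simp: zsq_norm prod_eq_iff)
  qed
  ultimately show ?thesis by linarith
qed

lemma aniso_gauge_sq_pos: "0 < k \<Longrightarrow> p \<noteq> 0 \<Longrightarrow> 0 < aniso_gauge_sq k p"
  unfolding aniso_gauge_sq_def by (rule weighted_pos) auto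

text \<open>
Off the axis \<open>f\<^sub>k(z, t) = (z e^(A+iB), t e^(2A) / k)\<close>, where \<open>A\<close> and \<open>B\<close> are the real functions
\<open>stretch_log\<close> and \<open>stretch_angle\<close> of \<open>|z|\<^sup>2\<close> and \<open>t\<close>. Both are smooth away from the origin, which
continues the formula over the punctured axis.
\<close>

definition stretch_log :: "real \<Rightarrow> heis \<Rightarrow> real" where
  "stretch_log k p = ln k / 2 + k / 4 * ln ((zsq p)^2 + (snd p)^2) - ln (aniso_gauge_sq k p) / 4"

definition stretch_angle :: "real \<Rightarrow> heis \<Rightarrow> real" where
  "stretch_angle k p = arctan (- (1 - k) * (snd p * zsq p) / (k * (zsq p)^2 + (snd p)^2)) / 2"

definition smooth_stretch :: "real \<Rightarrow> heis \<Rightarrow> heis" where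
  "smooth_stretch k p = (fst p * exp (Complex (stretch_log k p) (stretch_angle k p)), snd p * exp (2 * stretch_log k p) / k)"

text \<open>
The stretch map in the coordinates of the chart.
\<close>

definition chart_stretch :: "real \<Rightarrow> heis \<Rightarrow> heis" where
  "chart_stretch k q = (Complex (k * Re (fst q)) (Im (fst q)), snd q / k)"

lemma stretch_chart: "stretch k (chart q) = chart (chart_stretch k q)"
  using stretch_log_coords[of "arctan (snd q)" k "Re (fst q)" "Im (fst q)"]
    arctan_lbound[of "snd q"] arctan_ubound[of "snd q"]
  by (simp add: chart_def chart_stretch_def tan_arctan)

lemma smooth_stretch_chart:
  assumes k: "0 < k" shows "smooth_stretch k (chart q) = chart (chart_stretch k q)"
proof -
  define \<xi> u p where "\<xi> = Re (fst q)" and "u = snd q" and "p = chart q"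
  define w where "w = zsq p"
  have w: "0 < w" by (simp add: w_def p_def zsq_norm)
  have t: "snd p = - u * w" by (simp add: p_def snd_chart u_def w_def zsq_norm)
  have ku: "0 < k^2 + u^2" using k by (intro add_pos_nonneg) auto
  have "w = exp (\<xi> - ln (1 + u^2) / 2)" by (simp add: w_def p_def zsq_norm norm_chart \<xi>_def u_def)
  hence lw: "ln w = \<xi> - ln (1 + u^2) / 2" by simp
  have lN: "ln (w^2 + (snd p)^2) = 2 * \<xi>"
  proof -
    have "w^2 + (snd p)^2 = w^2 * (1 + u^2)" by (simp add: t power_mult_distrib algebra_simps)
    thus ?thesis using w lw by (simp add: ln_mult ln_realpow)
  qed
  have lD: "ln (aniso_gauge_sq k p) = 2 * \<xi> - ln (1 + u^2) + ln (k^2 + u^2)"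
  proof -
    have "aniso_gauge_sq k p = w^2 * (k^2 + u^2)"
      by (simp add: aniso_gauge_sq_def w_def[symmetric] t power_mult_distrib algebra_simps)
    thus ?thesis using w lw k by (simp add: ln_mult ln_realpow)
  qed
  have lk: "ln (1 + (u / k)^2) = ln (k^2 + u^2) - 2 * ln k"
  proof -
    have "1 + (u / k)^2 = (k^2 + u^2) / k^2" using k by (simp add: field_simps)
    thus ?thesis using k ku by (simp add: ln_div ln_realpow)
  qed
  have A: "stretch_log k p = (k * \<xi> / 2 - ln (1 + (u / k)^2) / 4) - (\<xi> / 2 - ln (1 + u^2) / 4)"
    unfolding stretch_log_def w_def[symmetric] lN lD lk by (simp add: field_simps)
  have B: "stretch_angle k p = (arctan (u / k) - arctan u) / 2"
  proof -
    have kp: "0 < k + u^2" using k by (intro add_pos_nonneg) auto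
    have "- (1 - k) * (snd p * w) = w^2 * ((1 - k) * u)" "k * w^2 + (snd p)^2 = w^2 * (k + u^2)"
      by (simp_all add: t power2_eq_square algebra_simps)
    hence "- (1 - k) * (snd p * w) / (k * w^2 + (snd p)^2) = (1 - k) * u / (k + u^2)"
      using w by simp
    thus ?thesis unfolding stretch_angle_def w_def[symmetric] arctan_divide_difference[OF k] by simp
  qed
  have "chart_exponent (chart_stretch k q) = chart_exponent q + Complex (stretch_log k p) (stretch_angle k p)"
    unfolding A B by (simp add: chart_exponent_def chart_stretch_def complex_eq_iff \<xi>_def u_def diff_divide_distrib)
  hence f: "fst (chart (chart_stretch k q)) = fst (smooth_stretch k p)"
    by (simp add: chart_eq smooth_stretch_def exp_add p_def)
  have "snd (chart (chart_stretch k q)) = snd (smooth_stretch k p)"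
    unfolding snd_chart f
    using t by (simp add: smooth_stretch_def norm_mult power_mult_distrib chart_stretch_def exp_double u_def w_def zsq_norm)
  with f show ?thesis by (simp add: prod_eq_iff p_def)
qed

lemma smooth_stretch_axis:
  assumes "0 < k" "t \<noteq> 0" shows "smooth_stretch k (0, t) = (0, t * \<bar>t\<bar> powr (k - 1))"
proof -
  have "ln (t^2) = 2 * ln \<bar>t\<bar>" using assms ln_realpow[of "\<bar>t\<bar>" 2] by simp
  hence "2 * stretch_log k (0, t) = ln k + (k - 1) * ln \<bar>t\<bar>"
    by (simp add: stretch_log_def zsq_def aniso_gauge_sq_def field_simps)
  thus ?thesis using assms by (simp add: smooth_stretch_def exp_add powr_def)
qed

lemma stretch_eq_smooth_stretch:
  assumes k: "0 < k" and p: "p \<noteq> 0" shows "stretch k p = smooth_stretch k p"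
proof (cases "fst p = 0")
  case True
  then obtain t where t: "p = (0, t)" "t \<noteq> 0" using p by (cases p) (auto simp: zero_prod_def)
  show ?thesis unfolding t(1) smooth_stretch_axis[OF k t(2)] by (simp add: stretch_def vertical_axis_def)
next
  case False
  then obtain q where "chart q = p" by (rule chart_surj)
  thus ?thesis using stretch_chart[of k q] smooth_stretch_chart[OF k, of q] by simp
qed

lemma C2_on_smooth_stretch:
  assumes k: "0 < k" shows "C2_on (- {0}) (smooth_stretch k)"
proof -
  have [intro]: "C2_on S (\<lambda>p :: heis. fst p)" "C2_on S (\<lambda>p :: heis. snd p)"
     "C2_on S (\<lambda>p :: heis. Re (fst p))" "C2_on S (\<lambda>p :: heis. Im (fst p))" for S
    by (intro C2_on_bounded_linear bounded_linear_fst bounded_linear_snd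
       bounded_linear_compose[OF bounded_linear_Re] bounded_linear_compose[OF bounded_linear_Im])+
  have w [intro]: "C2_on S zsq" for S
    unfolding zsq_def[abs_def] power2_eq_square by (intro C2_on_add C2_on_mult) auto
  have lin: "C2_on S (\<lambda>p. c * (zsq p)^2 + (snd p)^2)" for S c
    unfolding power2_eq_square by (intro C2_on_add C2_on_mult C2_on_const) auto
  have lnc: "C2_on (- {0}) (\<lambda>p. ln (c * (zsq p)^2 + (snd p)^2))" if "0 < c" for c
    using that by (intro C2_on_ln lin) (auto intro: weighted_pos)
  have A: "C2_on (- {0}) (stretch_log k)"
  proof -
    have "stretch_log k = (\<lambda>p. ln k / 2 + k / 4 * ln (1 * (zsq p)^2 + (snd p)^2) + (- 1 / 4) * ln (k^2 * (zsq p)^2 + (snd p)^2))"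
      by (auto simp: stretch_log_def aniso_gauge_sq_def)
    moreover have "C2_on (- {0}) \<dots>"
      using k by (intro C2_on_add[OF C2_on_add[OF C2_on_const C2_on_mult[OF C2_on_const lnc]] C2_on_mult[OF C2_on_const lnc]]) auto
    ultimately show ?thesis by simp
  qed
  have B: "C2_on (- {0}) (stretch_angle k)"
  proof -
    have nz: "k * (zsq p)^2 + (snd p)^2 \<noteq> 0" if "p \<in> - {0}" for p
      using weighted_pos[OF k, of p] that by auto
    have "C2_on (- {0}) (\<lambda>p :: heis. snd p * zsq p)"
      by (intro C2_on_mult w C2_on_bounded_linear bounded_linear_snd)
    thus ?thesis unfolding stretch_angle_def[abs_def]
      by (intro C2_on_divide[OF C2_on_arctan[OF C2_on_divide[OF C2_on_mult[OF C2_on_const] lin nz]] C2_on_const]) auto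
  qed
  have C: "C2_on (- {0}) (\<lambda>p. Complex (stretch_log k p) (stretch_angle k p))"
  proof -
    have "C2_on (- {0}) (\<lambda>p. complex_of_real (stretch_log k p) + \<i> * complex_of_real (stretch_angle k p))"
      by (intro C2_on_add C2_on_mult C2_on_const C2_on_compose[OF C2_on_bounded_linear[OF bounded_linear_of_real, of UNIV] A]
          C2_on_compose[OF C2_on_bounded_linear[OF bounded_linear_of_real, of UNIV] B]) auto
    thus ?thesis by (simp add: Complex_eq)
  qed
  have "C2_on (- {0}) (\<lambda>p. (fst p * exp (Complex (stretch_log k p) (stretch_angle k p)),
      snd p * exp (2 * stretch_log k p) * (1 / k)))"
    by (intro C2_on_Pair C2_on_mult C2_on_exp C C2_on_const A) auto
  moreover have "smooth_stretch k = (\<lambda>p. (fst p * exp (Complex (stretch_log k p) (stretch_angle k p)),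
      snd p * exp (2 * stretch_log k p) * (1 / k)))" by (auto simp: smooth_stretch_def)
  ultimately show ?thesis by simp
qed

text \<open>
Differentials of \<open>stretch_log\<close> and \<open>stretch_angle\<close> at a point with \<open>|z|\<^sup>2 = w\<close>, on a tangent vector
along which \<open>w\<close> and \<open>t\<close> change by \<open>dw\<close> and \<open>dt\<close>.
\<close>

definition stretch_log_d :: "real \<Rightarrow> real \<Rightarrow> real \<Rightarrow> real \<Rightarrow> real \<Rightarrow> real" where
  "stretch_log_d k w t dw dt = k / 2 * ((w * dw + t * dt) / (w^2 + t^2)) - (k^2 * w * dw + t * dt) / (2 * (k^2 * w^2 + t^2))"

definition stretch_angle_d :: "real \<Rightarrow> real \<Rightarrow> real \<Rightarrow> real \<Rightarrow> real \<Rightarrow> real" where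
  "stretch_angle_d k w t dw dt = (t * dw - w * dt) / 2 * (k / (k^2 * w^2 + t^2) - 1 / (w^2 + t^2))"

lemma stretch_angle_d_quotient:
  fixes k w t dw dt :: real
  assumes E: "k * w^2 + t^2 \<noteq> 0" and N: "w^2 + t^2 \<noteq> 0" and D: "k^2 * w^2 + t^2 \<noteq> 0"
  shows "- (1 - k) * ((dt * w + t * dw) * (k * w^2 + t^2) - t * w * (2 * k * w * dw + 2 * t * dt)) / (k * w^2 + t^2)^2
      / (1 + (- (1 - k) * (t * w) / (k * w^2 + t^2))^2) / 2 = stretch_angle_d k w t dw dt"
proof -
  define E0 where "E0 = k * w^2 + t^2"
  define N0 where "N0 = w^2 + t^2"
  define D0 where "D0 = k^2 * w^2 + t^2"
  have nz: "E0 \<noteq> 0" "N0 \<noteq> 0" "D0 \<noteq> 0" using assms by (simp_all add: E0_def N0_def D0_def)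
  have ND: "E0^2 + ((1 - k) * (t * w))^2 = N0 * D0"
    unfolding E0_def N0_def D0_def by algebra
  have den: "1 + (- (1 - k) * (t * w) / E0)^2 = N0 * D0 / E0^2"
  proof -
    have "(- (1 - k) * (t * w) / E0)^2 = ((1 - k) * (t * w))^2 / E0^2"
      by (simp only: power_divide mult_minus_left power2_minus)
    thus ?thesis unfolding ND[symmetric] using nz by (simp only: add_divide_distrib) simp
  qed
  have num: "- (1 - k) * ((dt * w + t * dw) * E0 - t * w * (2 * k * w * dw + 2 * t * dt)) = (t * dw - w * dt) * (k * N0 - D0)"
    unfolding E0_def N0_def D0_def by algebra
  have "- (1 - k) * ((dt * w + t * dw) * E0 - t * w * (2 * k * w * dw + 2 * t * dt)) / E0^2 / (N0 * D0 / E0^2) / 2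
     = (t * dw - w * dt) * (k * N0 - D0) / (N0 * D0) / 2"
    unfolding num using nz by simp
  also have "\<dots> = (t * dw - w * dt) / 2 * (k / D0 - 1 / N0)"
    using nz by (simp add: field_simps)
  finally show ?thesis
    unfolding stretch_angle_d_def E0_def[symmetric] N0_def[symmetric] D0_def[symmetric] den .
qed

text \<open>
This identity makes \<open>e^(2A)\<close> the dilation of the stretch map: the pullback of \<open>\<omega>\<close> is \<open>e^(2A)\<close> times the
left side plus \<open>2 Im (cnj z dz)\<close>.
\<close>

lemma stretch_contact_identity:
  fixes k w t dw dt :: real
  assumes k: "k \<noteq> 0" and N: "w^2 + t^2 \<noteq> 0" and D: "k^2 * w^2 + t^2 \<noteq> 0"
  shows "(dt + 2 * t * stretch_log_d k w t dw dt) / k + 2 * w * stretch_angle_d k w t dw dt = dt"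
proof -
  define N0 where "N0 = w^2 + t^2"
  define D0 where "D0 = k^2 * w^2 + t^2"
  have nz: "N0 \<noteq> 0" "D0 \<noteq> 0" using assms by (simp_all add: N0_def D0_def)
  have "(dt + 2 * t * stretch_log_d k w t dw dt) / k + 2 * w * stretch_angle_d k w t dw dt
     = dt / k + (t * (w * dw + t * dt) / N0 - t * (k^2 * w * dw + t * dt) / (k * D0))
        + w * (t * dw - w * dt) * (k / D0 - 1 / N0)"
    unfolding stretch_log_d_def stretch_angle_d_def N0_def[symmetric] D0_def[symmetric]
    using nz k by (simp add: field_simps)
  also have "\<dots> = dt / k + dt * ((w^2 + t^2) / N0) - dt * (k^2 * w^2 + t^2) / (k * D0)"
    using nz k by (simp add: field_simps power2_eq_square)
  also have "\<dots> = dt" unfolding N0_def[symmetric] D0_def[symmetric] using nz by simp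
  finally show ?thesis .
qed

lemma stretch_has_derivatives:
  fixes v :: heis
  assumes k: "0 < k" and p: "p \<noteq> 0"
  defines "dw \<equiv> (\<lambda>v :: heis. 2 * (Re (fst p) * Re (fst v) + Im (fst p) * Im (fst v)))"
  defines "A' \<equiv> (\<lambda>v. stretch_log_d k (zsq p) (snd p) (dw v) (snd v))"
  defines "B' \<equiv> (\<lambda>v. stretch_angle_d k (zsq p) (snd p) (dw v) (snd v))"
  shows "(smooth_stretch k has_derivative
     (\<lambda>v. (exp (Complex (stretch_log k p) (stretch_angle k p)) * (fst v + fst p * Complex (A' v) (B' v)),
           exp (2 * stretch_log k p) * (snd v + 2 * snd p * A' v) / k))) (at p)"
proof -
  define w t where "w = zsq p" and "t = snd p"
  have N: "0 < w^2 + t^2" "0 < k^2 * w^2 + t^2" "0 < k * w^2 + t^2"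
    using weighted_pos[OF _ p, of 1] weighted_pos[OF _ p, of "k^2"] weighted_pos[OF k p] k by (auto simp: w_def t_def)
  have dz: "(zsq has_derivative dw) (at p)"
    unfolding zsq_def[abs_def] dw_def
    by (auto intro!: derivative_eq_intros bounded_linear.has_derivative[OF bounded_linear_Re]
         bounded_linear.has_derivative[OF bounded_linear_Im] simp: fun_eq_iff algebra_simps)
  have dt: "(snd has_derivative snd) (at p)" by (rule bounded_linear_imp_has_derivative[OF bounded_linear_snd])
  have dq: "((\<lambda>q. c * (zsq q)^2 + (snd q)^2) has_derivative (\<lambda>v. 2 * (c * w * dw v + t * snd v))) (at p)" for c
    by (rule has_derivative_eq_rhs, (rule derivative_intros dz dt)+) (auto simp: w_def t_def algebra_simps)
  have dln: "((\<lambda>q. ln (c * (zsq q)^2 + (snd q)^2)) has_derivative (\<lambda>v. 2 * (c * w * dw v + t * snd v) / (c * w^2 + t^2))) (at p)"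
    if "0 < c * w^2 + t^2" for c
    by (rule has_derivative_eq_rhs, rule has_derivative_ln[OF _ dq])
       (use that in \<open>auto simp: w_def t_def divide_inverse mult_ac\<close>)
  have A: "(stretch_log k has_derivative A') (at p)"
  proof -
    have "((\<lambda>q. ln k / 2 + (k / 4 * ln (1 * (zsq q)^2 + (snd q)^2) + (- 1 / 4) * ln (k^2 * (zsq q)^2 + (snd q)^2))) has_derivative
      (\<lambda>v. 0 + (k / 4 * (2 * (1 * w * dw v + t * snd v) / (1 * w^2 + t^2)) + (- 1 / 4) * (2 * (k^2 * w * dw v + t * snd v) / (k^2 * w^2 + t^2))))) (at p)"
      by (intro has_derivative_add has_derivative_const has_derivative_mult_right dln) (use N in auto)
    moreover have "stretch_log k = (\<lambda>q. ln k / 2 + (k / 4 * ln (1 * (zsq q)^2 + (snd q)^2) + (- 1 / 4) * ln (k^2 * (zsq q)^2 + (snd q)^2)))"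
      by (auto simp: stretch_log_def aniso_gauge_sq_def)
    moreover have "A' = (\<lambda>v. 0 + (k / 4 * (2 * (1 * w * dw v + t * snd v) / (1 * w^2 + t^2)) + (- 1 / 4) * (2 * (k^2 * w * dw v + t * snd v) / (k^2 * w^2 + t^2))))"
    proof -
      have "k / 2 * (a / n) - b / (2 * d) = 0 + (k / 4 * (2 * a / n) + (- 1 / 4) * (2 * b / d))" for a b n d :: real
        by simp
      thus ?thesis unfolding A'_def stretch_log_d_def w_def[symmetric] t_def[symmetric] mult_1 by blast
    qed
    ultimately show ?thesis by simp
  qed
  have B: "(stretch_angle k has_derivative B') (at p)"
  proof -
    \<comment> \<open>the argument of \<open>arctan\<close>; \<open>num\<close> is the numerator of its differential\<close>
    define \<beta> where "\<beta> q = - (1 - k) * (snd q * zsq q) / (k * (zsq q)^2 + (snd q)^2)" for q :: heis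
    define num where "num v = - (1 - k) * ((snd v * w + t * dw v) * (k * w^2 + t^2) - t * w * (2 * k * w * dw v + 2 * t * snd v))" for v :: heis
    have "((\<lambda>q. - (1 - k) * (snd q * zsq q)) has_derivative (\<lambda>v. - (1 - k) * (t * dw v + snd v * w))) (at p)"
      unfolding w_def t_def by (intro has_derivative_mult_right has_derivative_mult dz dt)
    from has_derivative_divide'[OF this dq[of k]] N
    have "(\<beta> has_derivative (\<lambda>v. (- (1 - k) * (t * dw v + snd v * w) * (k * w^2 + t^2)
       - - (1 - k) * (t * w) * (2 * (k * w * dw v + t * snd v))) / ((k * w^2 + t^2) * (k * w^2 + t^2)))) (at p)"
      unfolding \<beta>_def[abs_def] by (simp add: w_def t_def)
    hence d\<beta>: "(\<beta> has_derivative (\<lambda>v. num v / (k * w^2 + t^2)^2)) (at p)"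
      by (rule has_derivative_eq_rhs) (auto simp: num_def power2_eq_square algebra_simps)
    have "((\<lambda>q. arctan (\<beta> q)) has_derivative (\<lambda>v. inverse (1 + (\<beta> p)^2) * (num v / (k * w^2 + t^2)^2))) (at p)"
      using has_derivative_compose[OF d\<beta>, of arctan "\<lambda>x. inverse (1 + (\<beta> p)^2) * x"] DERIV_arctan[of "\<beta> p"]
      unfolding has_field_derivative_def by blast
    note d = has_derivative_mult_right[OF this, of "1 / 2"]
    have sa: "stretch_angle k = (\<lambda>q. 1 / 2 * arctan (\<beta> q))"
      by (simp add: fun_eq_iff stretch_angle_def \<beta>_def)
    have "(1 / 2 :: real) * (inverse y * x) = x / y / 2" for x y by (simp add: field_simps)
    with d have "(stretch_angle k has_derivative (\<lambda>v. num v / (k * w^2 + t^2)^2 / (1 + (\<beta> p)^2) / 2)) (at p)"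
      unfolding sa by (simp only:)
    moreover have "num v / (k * w^2 + t^2)^2 / (1 + (\<beta> p)^2) / 2 = B' v" for v
      unfolding num_def \<beta>_def B'_def w_def[symmetric] t_def[symmetric]
      by (rule stretch_angle_d_quotient) (use N in \<open>auto simp del: sum_power2_eq_zero_iff\<close>)
    ultimately show ?thesis by simp
  qed
  define e where "e = exp (Complex (stretch_log k p) (stretch_angle k p))"
  have "((\<lambda>q. complex_of_real (stretch_log k q) + \<i> * complex_of_real (stretch_angle k q)) has_derivative
     (\<lambda>v. complex_of_real (A' v) + \<i> * complex_of_real (B' v))) (at p)"
    by (intro has_derivative_add has_derivative_mult_right has_derivative_of_real A B)
  hence C: "((\<lambda>q. Complex (stretch_log k q) (stretch_angle k q)) has_derivative (\<lambda>v. Complex (A' v) (B' v))) (at p)"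
    by (simp add: Complex_eq)
  have "((\<lambda>q. exp (Complex (stretch_log k q) (stretch_angle k q))) has_derivative (\<lambda>v. e * Complex (A' v) (B' v))) (at p)"
    unfolding e_def
    using has_derivative_compose[OF C, of exp "\<lambda>x. exp (Complex (stretch_log k p) (stretch_angle k p)) * x"]
      DERIV_exp[of "Complex (stretch_log k p) (stretch_angle k p)"] unfolding has_field_derivative_def by blast
  from has_derivative_mult[OF bounded_linear_imp_has_derivative[OF bounded_linear_fst] this]
  have F: "((\<lambda>q. fst q * exp (Complex (stretch_log k q) (stretch_angle k q))) has_derivative
      (\<lambda>v. e * (fst v + fst p * Complex (A' v) (B' v)))) (at p)"
    by (rule has_derivative_eq_rhs) (auto simp: e_def algebra_simps)
  have "((\<lambda>q. exp (2 * stretch_log k q)) has_derivative (\<lambda>v. exp (2 * stretch_log k p) * (2 * A' v))) (at p)"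
    using has_derivative_compose[OF has_derivative_mult_right[OF A, of 2], of exp "\<lambda>x. exp (2 * stretch_log k p) * x"]
      DERIV_exp[of "2 * stretch_log k p"] unfolding has_field_derivative_def by blast
  note d = has_derivative_mult_right[OF has_derivative_mult[OF dt this], of "1 / k"]
  have sk: "snd q * exp (2 * stretch_log k q) / k = 1 / k * (snd q * exp (2 * stretch_log k q))" for q :: heis
    by simp
  have S: "((\<lambda>q. snd q * exp (2 * stretch_log k q) / k) has_derivative
      (\<lambda>v. exp (2 * stretch_log k p) * (snd v + 2 * snd p * A' v) / k)) (at p)"
    unfolding sk by (rule has_derivative_eq_rhs[OF d]) (simp add: fun_eq_iff algebra_simps add_divide_distrib)
  show ?thesis
    using has_derivative_Pair[OF F S] by (simp add: smooth_stretch_def[abs_def] e_def)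
qed

section \<open>Distortion of the stretch map\<close>

text \<open>
The complex component of the derivative of the stretch map at \<open>p\<close> in direction \<open>v\<close>.
\<close>

definition stretch_velocity :: "real \<Rightarrow> heis \<Rightarrow> heis \<Rightarrow> complex" where
  "stretch_velocity k p v = exp (Complex (stretch_log k p) (stretch_angle k p)) * (fst v + fst p *
      (let dw = 2 * (Re (fst p) * Re (fst v) + Im (fst p) * Im (fst v)) in
       Complex (stretch_log_d k (zsq p) (snd p) dw (snd v)) (stretch_angle_d k (zsq p) (snd p) dw (snd v))))"

lemma stretch_contact_C2:
  assumes k: "0 < k"
  obtains D D2 where "contact_C2 (- {0}) (stretch k) D D2 (\<lambda>p. exp (2 * stretch_log k p))"
    and "\<And>p v. p \<noteq> 0 \<Longrightarrow> fst (D p v) = stretch_velocity k p v"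
proof -
  have op: "open (- {0 :: heis})" by auto
  have "C2_on (- {0}) (stretch k)"
    by (rule C2_on_cong[OF op _ C2_on_smooth_stretch[OF k]]) (simp add: stretch_eq_smooth_stretch k)
  then obtain D D2 where D: "\<And>p. p \<in> - {0} \<Longrightarrow> (stretch k has_derivative blinfun_apply (D p)) (at p)" and
    D2: "\<And>p. p \<in> - {0} \<Longrightarrow> (D has_derivative blinfun_apply (D2 p)) (at p)"
    unfolding C2_on_def by blast
  define dw where "dw p v = 2 * (Re (fst p) * Re (fst v) + Im (fst p) * Im (fst v))" for p v :: heis
  define A' where "A' p v = stretch_log_d k (zsq p) (snd p) (dw p v) (snd v)" for p v
  define B' where "B' p v = stretch_angle_d k (zsq p) (snd p) (dw p v) (snd v)" for p v
  define e where "e p = exp (Complex (stretch_log k p) (stretch_angle k p))" for p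
  have Dp: "D p v = (e p * (fst v + fst p * Complex (A' p v) (B' p v)),
           exp (2 * stretch_log k p) * (snd v + 2 * snd p * A' p v) / k)" if p: "p \<noteq> 0" for p v
  proof -
    have "(stretch k has_derivative (\<lambda>v. (e p * (fst v + fst p * Complex (A' p v) (B' p v)),
           exp (2 * stretch_log k p) * (snd v + 2 * snd p * A' p v) / k))) (at p)"
      by (rule has_derivative_transform_within_open[OF _ op])
         (use p stretch_has_derivatives[OF k p] in \<open>auto simp: stretch_eq_smooth_stretch k e_def A'_def B'_def dw_def\<close>)
    from has_derivative_unique[OF D this] p show ?thesis by auto
  qed
  have "contact_form (stretch k p) (D p v) = exp (2 * stretch_log k p) * contact_form p v" if p: "p \<noteq> 0" for p v
  proof -
    define E2 where "E2 = exp (2 * stretch_log k p)"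
    define L where "L = Complex (A' p v) (B' p v)"
    have e2: "e p * cnj (e p) = complex_of_real E2"
      unfolding complex_norm_square[symmetric] by (simp add: e_def E2_def exp_double)
    have wz: "fst p * cnj (fst p) = complex_of_real (zsq p)"
      unfolding complex_norm_square[symmetric] by (simp add: zsq_norm)
    have "cnj (fst p * e p) * (e p * (fst v + fst p * L))
       = (e p * cnj (e p)) * (cnj (fst p) * fst v + (fst p * cnj (fst p)) * L)"
      by (simp add: algebra_simps)
    also have "\<dots> = complex_of_real E2 * (cnj (fst p) * fst v + complex_of_real (zsq p) * L)"
      unfolding e2 wz ..
    finally have im: "Im (cnj (fst p * e p) * (e p * (fst v + fst p * L)))
       = E2 * (Im (cnj (fst p) * fst v) + zsq p * B' p v)"
      by (simp add: L_def)
    have nz: "(zsq p)^2 + (snd p)^2 \<noteq> 0" "k^2 * (zsq p)^2 + (snd p)^2 \<noteq> 0"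
      using weighted_pos[OF _ p, of 1] weighted_pos[OF _ p, of "k^2"] k by auto
    have "contact_form (stretch k p) (D p v) =
       E2 * (snd v + 2 * snd p * A' p v) / k + 2 * (E2 * (Im (cnj (fst p) * fst v) + zsq p * B' p v))"
      unfolding contact_form_def Dp[OF p] stretch_eq_smooth_stretch[OF k p] smooth_stretch_def fst_conv snd_conv
      unfolding e_def[symmetric] E2_def[symmetric] L_def[symmetric] im ..
    also have "\<dots> = E2 * ((snd v + 2 * snd p * A' p v) / k + 2 * zsq p * B' p v + 2 * Im (cnj (fst p) * fst v))"
      by (simp add: distrib_left)
    also have "(snd v + 2 * snd p * A' p v) / k + 2 * zsq p * B' p v = snd v"
      unfolding A'_def B'_def by (rule stretch_contact_identity) (use k nz in auto)
    finally show ?thesis by (simp add: E2_def contact_form_def)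
  qed
  hence "contact_C2 (- {0}) (stretch k) D D2 (\<lambda>p. exp (2 * stretch_log k p))"
    using D D2 by unfold_locales auto
  thus ?thesis using Dp by (intro that) (auto simp: stretch_velocity_def e_def A'_def B'_def dw_def Let_def)
qed

text \<open>
The left side is \<open>|dL(X) + i dL(Y)|\<^sup>2\<close> for \<open>L = A + i B\<close> at \<open>z = x + i y\<close>; up to the factor
\<open>|z e\<^sup>L|\<^sup>2 / 4\<close> this is \<open>|Zbar f|\<^sup>2\<close>.
\<close>

lemma stretch_conformal_defect:
  fixes k w t :: real
  assumes N: "w^2 + t^2 \<noteq> 0" and D: "k^2 * w^2 + t^2 \<noteq> 0"
  defines "A \<equiv> stretch_log_d k w t" and "B \<equiv> stretch_angle_d k w t"
  shows "(A (2 * x) (2 * y) - B (2 * y) (- 2 * x))^2 + (B (2 * x) (2 * y) + A (2 * y) (- 2 * x))^2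
    = (x^2 + y^2) * ((1 - k^2)^2 * w^2 / ((w^2 + t^2) * (k^2 * w^2 + t^2)))"
proof -
  define N0 where "N0 = w^2 + t^2"
  define D0 where "D0 = k^2 * w^2 + t^2"
  have nz: "N0 \<noteq> 0" "D0 \<noteq> 0" using assms by (simp_all add: N0_def D0_def)
  define P where "P = (k + 1) * w * (D0 - k * N0) / (2 * N0 * D0)"
  define Q where "Q = (k + 1) * t * (D0 - N0) / (2 * N0 * D0)"
  have re: "A (2 * x) (2 * y) - B (2 * y) (- 2 * x) = 2 * (x * P + y * Q)"
    unfolding A_def B_def stretch_log_d_def stretch_angle_d_def N0_def[symmetric] D0_def[symmetric] P_def Q_def
    using nz by (simp add: field_simps power2_eq_square)
  have im: "B (2 * x) (2 * y) + A (2 * y) (- 2 * x) = 2 * (y * P - x * Q)"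
    unfolding A_def B_def stretch_log_d_def stretch_angle_d_def N0_def[symmetric] D0_def[symmetric] P_def Q_def
    using nz by (simp add: field_simps power2_eq_square)
  have poly: "w^2 * (D0 - k * N0)^2 + t^2 * (D0 - N0)^2 = (1 - k)^2 * w^2 * (N0 * D0)"
    unfolding N0_def D0_def by algebra
  have "P^2 + Q^2 = (k + 1)^2 * (w^2 * (D0 - k * N0)^2 + t^2 * (D0 - N0)^2) / (4 * (N0 * D0)^2)"
    unfolding P_def Q_def power_divide add_divide_distrib[symmetric]
  proof (rule arg_cong2[where f = "(/)"])
    show "((k + 1) * w * (D0 - k * N0))^2 + ((k + 1) * t * (D0 - N0))^2
        = (k + 1)^2 * (w^2 * (D0 - k * N0)^2 + t^2 * (D0 - N0)^2)" by algebra
    show "(2 * N0 * D0)^2 = 4 * (N0 * D0)^2" by algebra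
  qed
  also have "\<dots> = (k + 1)^2 * (1 - k)^2 * w^2 / (4 * (N0 * D0))"
    unfolding poly using nz by (simp add: power2_eq_square)
  also have "(k + 1)^2 * (1 - k)^2 = (1 - k^2)^2" by algebra
  finally have PQ: "P^2 + Q^2 = (1 - k^2)^2 * w^2 / (4 * (N0 * D0))" .
  have "(2 * (x * P + y * Q))^2 + (2 * (y * P - x * Q))^2 = 4 * (x^2 + y^2) * (P^2 + Q^2)" by algebra
  moreover have "4 * r * (c / (4 * n)) = r * (c / n)" for r c n :: real by simp
  ultimately show ?thesis unfolding re im PQ N0_def[symmetric] D0_def[symmetric] by (simp only:)
qed

text \<open>
With \<open>N\<close> and \<open>M\<close> for numerator and denominator, \<open>|Zbar f|\<^sup>2 = l (N - M)\<^sup>2 / (4 N M)\<close> by the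
preceding lemma. As \<open>|Z f|\<^sup>2\<close> exceeds it by the dilation \<open>l\<close>, it is \<open>l (N + M)\<^sup>2 / (4 N M)\<close>, and the
distortion is the ratio of \<open>2 N\<close> to \<open>2 M\<close>.
\<close>

lemma distortion_stretch:
  assumes k: "0 < k" "k \<le> 1" and p: "p \<noteq> 0"
  shows "distortion (stretch k) p = (gauge p)^2 / aniso_gauge_sq k p"
proof -
  obtain D D2 where cc: "contact_C2 (- {0}) (stretch k) D D2 (\<lambda>p. exp (2 * stretch_log k p))"
    and explicit: "\<And>p v. p \<noteq> 0 \<Longrightarrow> fst (D p v) = stretch_velocity k p v"
    using stretch_contact_C2[OF k(1)] by blast
  interpret contact_C2 "- {0}" "stretch k" D D2 "\<lambda>p. exp (2 * stretch_log k p)" by (rule cc)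
  have pc: "p \<in> - {0}" using p by simp
  define l where "l = exp (2 * stretch_log k p)"
  define e where "e = exp (Complex (stretch_log k p) (stretch_angle k p))"
  define x y w t where "x = Re (fst p)" and "y = Im (fst p)" and "w = zsq p" and "t = snd p"
  define N where "N = w^2 + t^2"
  define M where "M = k^2 * w^2 + t^2"
  have pos: "0 < N" "0 < M"
    using weighted_pos[OF _ p, of 1] weighted_pos[OF _ p, of "k^2"] k by (auto simp: N_def M_def w_def t_def)
  have NM: "N - M = (1 - k^2) * w^2" by (simp add: N_def M_def algebra_simps)
  have k2: "0 \<le> 1 - k^2" using k by (simp add: power_le_one)
  hence le: "M \<le> N" using NM by (smt (verit) mult_nonneg_nonneg zero_le_power2)
  define A where "A = stretch_log_d k w t"
  define B where "B = stretch_angle_d k w t"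
  have DX: "fst (D p (X_vec p)) = e * (1 + fst p * Complex (A (2 * x) (2 * y)) (B (2 * x) (2 * y)))"
    unfolding explicit[OF p] stretch_velocity_def by (simp add: X_vec_def e_def A_def B_def x_def y_def w_def t_def Let_def)
  have DY: "fst (D p (Y_vec p)) = e * (\<i> + fst p * Complex (A (2 * y) (- 2 * x)) (B (2 * y) (- 2 * x)))"
    unfolding explicit[OF p] stretch_velocity_def by (simp add: Y_vec_def e_def A_def B_def x_def y_def w_def t_def Let_def)
  \<comment> \<open>\<open>dL(X) + i dL(Y)\<close>: the term \<open>1 + i i\<close> that comes from \<open>z\<close> itself vanishes\<close>
  define G where "G = Complex (A (2 * x) (2 * y)) (B (2 * x) (2 * y)) + \<i> * Complex (A (2 * y) (- 2 * x)) (B (2 * y) (- 2 * x))"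
  have zb: "Zbar_field (\<lambda>q. fst (stretch k q)) p = e * fst p * G / 2"
    unfolding Z_fields(2)[OF pc] DX DY G_def by (simp add: algebra_simps)
  have "(norm G)^2 = (A (2 * x) (2 * y) - B (2 * y) (- 2 * x))^2 + (B (2 * x) (2 * y) + A (2 * y) (- 2 * x))^2"
    by (simp add: cmod_power2 G_def)
  also have "\<dots> = w * ((1 - k^2)^2 * w^2 / (N * M))"
  proof -
    have nz: "w^2 + t^2 \<noteq> 0" "k^2 * w^2 + t^2 \<noteq> 0" using pos unfolding N_def M_def by linarith+
    have "w = x^2 + y^2" by (simp add: w_def zsq_def x_def y_def)
    thus ?thesis using stretch_conformal_defect[OF nz, of x y] unfolding A_def B_def N_def M_def by (simp only:)
  qed
  finally have G2: "(norm G)^2 = w * ((1 - k^2)^2 * w^2 / (N * M))" .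
  have "(norm (Zbar_field (\<lambda>q. fst (stretch k q)) p))^2 = (norm e)^2 * w * (norm G)^2 / 4"
    unfolding zb by (simp add: norm_mult norm_divide power_mult_distrib power_divide w_def zsq_norm)
  also have "(norm e)^2 = l" by (simp add: e_def l_def exp_double)
  also have "l * w * (norm G)^2 / 4 = l * ((1 - k^2) * w^2)^2 / (4 * (N * M))"
    unfolding G2 by (simp add: power2_eq_square mult_ac)
  also have "\<dots> = (sqrt l * (N - M) / (2 * sqrt (N * M)))^2"
    unfolding NM[symmetric] using pos by (simp add: power_divide power_mult_distrib l_def)
  finally have zb2: "(norm (Zbar_field (\<lambda>q. fst (stretch k q)) p))^2 = (sqrt l * (N - M) / (2 * sqrt (N * M)))^2" .
  have "(norm (Z_field (\<lambda>q. fst (stretch k q)) p))^2 = l + (sqrt l * (N - M) / (2 * sqrt (N * M)))^2"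
    using dilation_eq_Z_fields[OF pc] zb2 by (simp add: l_def)
  also have "\<dots> = (sqrt l * (N + M) / (2 * sqrt (N * M)))^2"
    using pos by (simp add: power_divide power_mult_distrib l_def field_simps power2_eq_square)
  finally have z2: "(norm (Z_field (\<lambda>q. fst (stretch k q)) p))^2 = (sqrt l * (N + M) / (2 * sqrt (N * M)))^2" .
  have "norm (Zbar_field (\<lambda>q. fst (stretch k q)) p) = sqrt l * (N - M) / (2 * sqrt (N * M))"
    by (rule power2_eq_imp_eq[OF zb2]) (use le pos in \<open>auto simp: l_def\<close>)
  moreover have "norm (Z_field (\<lambda>q. fst (stretch k q)) p) = sqrt l * (N + M) / (2 * sqrt (N * M))"
    by (rule power2_eq_imp_eq[OF z2]) (use le pos in \<open>auto simp: l_def\<close>)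
  ultimately have "distortion (stretch k) p * l = (sqrt l * (N + M) / (2 * sqrt (N * M)) + sqrt l * (N - M) / (2 * sqrt (N * M)))^2"
    using distortion_dilation(2)[OF pc] by (simp add: l_def)
  also have "\<dots> = (sqrt l * N / sqrt (N * M))^2"
    by (simp add: add_divide_distrib[symmetric] distrib_left[symmetric])
  also have "\<dots> = l * (N / M)" using pos by (simp add: power_divide power_mult_distrib l_def power2_eq_square)
  finally have "l * distortion (stretch k) p = l * (N / M)" by (simp only: mult.commute)
  moreover have "l \<noteq> 0" by (simp add: l_def)
  ultimately have "distortion (stretch k) p = N / M" by (simp only: mult_cancel_left) simp
  thus ?thesis by (simp add: N_def M_def zsq_gauge aniso_gauge_sq_def w_def t_def)
qed

lemma distortion_stretch_chart:
  assumes k: "0 < k" "k \<le> 1"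
  shows "distortion (stretch k) (chart q) = (1 + (snd q)^2) / (k^2 + (snd q)^2)"
proof -
  define w where "w = (norm (fst (chart q)))^2"
  have w: "0 < w" by (simp add: w_def)
  have "aniso_gauge_sq k (chart q) = w^2 * (k^2 + (snd q)^2)"
    by (simp add: aniso_gauge_sq_def zsq_norm snd_chart w_def power_mult_distrib algebra_simps)
  moreover have "(gauge (chart q))^2 = w^2 * (1 + (snd q)^2)"
    by (simp add: gauge_chart_norm w_def power_mult_distrib)
  moreover have "chart q \<noteq> 0" using fst_chart_nz[of q] by (metis fst_zero)
  ultimately show ?thesis using w distortion_stretch[OF k, of "chart q"] by simp
qed

lemma stretch_axis: "stretch k (0, t) = (0, t * \<bar>t\<bar> powr (k - 1))"
  by (simp add: stretch_def vertical_axis_def)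

lemma vertical_axis_iff: "p \<in> vertical_axis \<longleftrightarrow> fst p = 0"
  by (cases p) (simp add: vertical_axis_def)

lemma not_axis_chart:
  assumes "p \<notin> vertical_axis" obtains q where "p = chart q"
  using assms chart_surj[of p] unfolding vertical_axis_iff by metis

lemma chart_not_axis: "chart q \<notin> vertical_axis"
  by (simp add: vertical_axis_iff)

lemma axis_power: "t \<noteq> 0 \<Longrightarrow> \<bar>t * \<bar>t\<bar> powr (k - 1)\<bar> = \<bar>t\<bar> powr k" for t :: real
  by (simp add: abs_mult powr_diff)

lemma gauge_stretch: "p \<noteq> 0 \<Longrightarrow> gauge (stretch k p) = gauge p powr k"
proof (cases "p \<in> vertical_axis")
  case True
  assume "p \<noteq> 0"
  then obtain t where p: "p = (0, t)" "t \<noteq> 0" using True by (cases p) (auto simp: vertical_axis_def zero_prod_def)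
  have "gauge (0, s) = \<bar>s\<bar>" for s by (simp add: gauge_def)
  thus ?thesis using axis_power[OF p(2)] by (simp add: p stretch_axis)
next
  case False
  then obtain q where "p = chart q" by (rule not_axis_chart)
  thus ?thesis by (simp add: stretch_chart gauge_chart chart_stretch_def powr_def)
qed

lemma stretch_inverse: "0 < k \<Longrightarrow> p \<noteq> 0 \<Longrightarrow> stretch (1 / k) (stretch k p) = p"
proof (cases "p \<in> vertical_axis")
  case True
  assume k: "0 < k" and "p \<noteq> 0"
  then obtain t where p: "p = (0, t)" "t \<noteq> 0" using True by (cases p) (auto simp: vertical_axis_def zero_prod_def)
  have "t * \<bar>t\<bar> powr (k - 1) * \<bar>t * \<bar>t\<bar> powr (k - 1)\<bar> powr (1 / k - 1) = t * (\<bar>t\<bar> powr (k - 1) * \<bar>t\<bar> powr (k * (1 / k - 1)))"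
    unfolding axis_power[OF p(2)] powr_powr by simp
  also have "\<dots> = t * \<bar>t\<bar> powr (k - 1 + k * (1 / k - 1))" by (simp add: powr_add)
  also have "k - 1 + k * (1 / k - 1) = 0" using k by (simp add: right_diff_distrib)
  finally show ?thesis using p(2) by (simp add: p stretch_axis)
next
  case False
  assume k: "0 < k"
  from False obtain q where q: "p = chart q" by (rule not_axis_chart)
  have "chart_stretch (1 / k) (chart_stretch k q) = q"
    using k by (simp add: chart_stretch_def prod_eq_iff complex_eq_iff)
  thus ?thesis by (simp add: stretch_chart q)
qed

lemma stretch_mem_axis_iff: "stretch k p \<in> vertical_axis \<longleftrightarrow> p \<in> vertical_axis"
proof (cases "p \<in> vertical_axis")
  case True thus ?thesis by (simp add: stretch_def) (simp add: vertical_axis_def)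
next
  case False
  then obtain q where "p = chart q" by (rule not_axis_chart)
  thus ?thesis by (simp add: stretch_chart chart_not_axis)
qed

lemma stretch_mem_ring:
  assumes ab: "0 < a" "0 < b" and k: "0 < k" and p: "p \<in> spherical_ring a b"
  shows "stretch k p \<in> spherical_ring (a powr k) (b powr k)"
proof -
  have e: "(x powr k)^2 = (x^2) powr k" if "0 < x" for x :: real
    using that by (simp add: power2_eq_square powr_mult)
  have "a^2 < gauge p" "gauge p < b^2" using p ab by (auto simp: spherical_ring_gauge)
  hence "(a^2) powr k < gauge p powr k" "gauge p powr k < (b^2) powr k"
    using k ab by (auto intro!: powr_less_mono2)
  moreover have "gauge (stretch k p) = gauge p powr k" by (rule gauge_stretch[OF spherical_ring_nonzero[OF ab p]])
  ultimately show ?thesis using ab by (simp add: spherical_ring_gauge e)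
qed

lemma continuous_on_stretch: "0 < k \<Longrightarrow> continuous_on (- {0}) (stretch k)"
  using stretch_contact_C2[of k] contact_C2.continuous_on_f by metis

lemma maps_boundary_stretch:
  assumes k: "0 < k" and a: "0 < a"
  shows "maps_boundary \<Omega> (stretch k) (koranyi_sphere a) (koranyi_sphere (a powr k))"
  unfolding maps_boundary_def
proof
  fix q assume q: "q \<in> koranyi_sphere a"
  hence gq: "gauge q = a^2" using a by (simp add: koranyi_sphere_gauge)
  hence q0: "q \<noteq> 0" using a by (simp add: gauge_pos_iff[symmetric])
  have "gauge (stretch k q) = (a powr k)^2"
    using gauge_stretch[OF q0] a by (simp add: gq power2_eq_square powr_mult)
  hence im: "stretch k q \<in> koranyi_sphere (a powr k)" using a by (simp add: koranyi_sphere_gauge)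
  have "isCont (stretch k) q"
    using continuous_on_stretch[OF k] q0 by (simp add: continuous_on_eq_continuous_at open_Compl)
  hence "(stretch k \<longlongrightarrow> stretch k q) (at q within \<Omega>)"
    unfolding isCont_def by (rule Lim_at_imp_Lim_at_within)
  from tendsto_infdist[OF this, of "koranyi_sphere (a powr k)"]
  show "((\<lambda>p. infdist (stretch k p) (koranyi_sphere (a powr k))) \<longlongrightarrow> 0) (at q within \<Omega>)"
    using im by (simp add: infdist_zero)
qed

lemma powr_powr_inverse: "0 < a \<Longrightarrow> 0 < k \<Longrightarrow> (a powr k) powr (1 / k) = (a :: real)"
  by (simp add: powr_powr)

text \<open>
The inverse is the stretch map with parameter \<open>1 / k\<close>, so the closed formula covers its regularity
as well.
\<close>

lemma op_contact_stretch:
  assumes ab: "0 < a" "0 < b" and k: "0 < k"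
  shows "op_contact_transformation (spherical_ring a b) (spherical_ring (a powr k) (b powr k)) (stretch k)"
proof -
  define \<Omega> \<Omega>' where "\<Omega> = spherical_ring a b" and "\<Omega>' = spherical_ring (a powr k) (b powr k)"
  have ab': "0 < a powr k" "0 < b powr k" using ab by auto
  have nz: "\<Omega> \<subseteq> - {0}" "\<Omega>' \<subseteq> - {0}"
    using spherical_ring_nonzero[OF ab, of 0] spherical_ring_nonzero[OF ab', of 0] unfolding \<Omega>_def \<Omega>'_def by auto
  have fwd: "stretch k p \<in> \<Omega>'" if "p \<in> \<Omega>" for p
    using stretch_mem_ring[OF ab k] that by (simp add: \<Omega>_def \<Omega>'_def)
  have bwd: "stretch (1 / k) p \<in> \<Omega>" if "p \<in> \<Omega>'" for p
    using stretch_mem_ring[OF ab', of "1 / k" p] that k ab by (simp add: \<Omega>_def \<Omega>'_def powr_powr_inverse)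
  have inv1: "stretch (1 / k) (stretch k p) = p" if "p \<in> \<Omega>" for p
    using stretch_inverse[OF k] nz that by blast
  have inv2: "stretch k (stretch (1 / k) p) = p" if "p \<in> \<Omega>'" for p
    using stretch_inverse[of "1 / k" p] nz that k by auto
  have bij: "bij_betw (stretch k) \<Omega> \<Omega>'"
    by (rule bij_betw_byWitness[where f' = "stretch (1 / k)"]) (use fwd bwd inv1 inv2 in auto)
  have C2: "C2_on S (stretch j)" if "0 < j" "S \<subseteq> - {0}" for j S
    using C2_on_subset[OF _ that(2)] C2_on_cong[OF _ _ C2_on_smooth_stretch[OF that(1)], of "stretch j"]
    by (simp add: stretch_eq_smooth_stretch that(1) open_Compl)
  have "C2_on \<Omega>' (inv_into \<Omega> (stretch k))"
  proof (rule C2_on_cong)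
    show "open \<Omega>'" using open_spherical_ring[OF ab'] by (simp add: \<Omega>'_def)
    show "C2_on \<Omega>' (stretch (1 / k))" using k nz by (intro C2) auto
    show "stretch (1 / k) p = inv_into \<Omega> (stretch k) p" if "p \<in> \<Omega>'" for p
      using bij inv2[OF that] bwd[OF that] by (intro inv_into_f_eq[symmetric]) (auto simp: bij_betw_def)
  qed
  moreover have "C2_on \<Omega> (stretch k)" using k nz by (intro C2) auto
  ultimately have diff: "C2_diffeomorphism \<Omega> \<Omega>' (stretch k)"
    using bij by (simp add: C2_diffeomorphism_def)
  obtain D D2 where "contact_C2 (- {0}) (stretch k) D D2 (\<lambda>p. exp (2 * stretch_log k p))"
    using stretch_contact_C2[OF k] by metis
  then interpret contact_C2 "- {0}" "stretch k" D D2 "\<lambda>p. exp (2 * stretch_log k p)" .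
  have ct: "contact_form (stretch k p) (frechet_derivative (stretch k) (at p) v) = exp (2 * stretch_log k p) * contact_form p v"
    if "p \<in> \<Omega>" for p v
  proof -
    have p: "p \<in> - {0}" using that nz(1) by blast
    show ?thesis unfolding frechet_derivative_at[OF D[OF p], symmetric] by (rule contact[OF p])
  qed
  have "\<exists>l. (\<forall>p\<in>\<Omega>. 0 < l p) \<and>
      (\<forall>p\<in>\<Omega>. \<forall>v. contact_form (stretch k p) (frechet_derivative (stretch k) (at p) v) = l p * contact_form p v)"
    by (intro exI[of _ "\<lambda>p. exp (2 * stretch_log k p)"] conjI ballI allI ct exp_gt_zero)
  with diff show ?thesis unfolding op_contact_transformation_def \<Omega>_def[symmetric] \<Omega>'_def[symmetric] ..
qed

lemma stretch_axis_image:
  assumes ab: "0 < a" "0 < b" and k: "0 < k"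
  shows "stretch k ` (vertical_axis \<inter> spherical_ring a b) = vertical_axis \<inter> spherical_ring (a powr k) (b powr k)"
proof -
  have "bij_betw (stretch k) (spherical_ring a b) (spherical_ring (a powr k) (b powr k))"
    using op_contact_stretch[OF ab k] by (simp add: op_contact_transformation_def C2_diffeomorphism_def)
  hence "stretch k ` spherical_ring a b = spherical_ring (a powr k) (b powr k)" by (simp add: bij_betw_def)
  moreover have "stretch k ` (vertical_axis \<inter> S) = vertical_axis \<inter> stretch k ` S" for S
    by (auto simp: stretch_mem_axis_iff)
  ultimately show ?thesis by simp
qed

section \<open>One-dimensional estimates\<close>

abbreviation tail_weight :: "real \<Rightarrow> real" where
  "tail_weight u \<equiv> (1 + u\<^sup>2) powr (- 2 / 3)"

text \<open>
For \<open>u \<ge> 0\<close> the weight is dominated by a multiple of \<open>(1 + u)^(-4/3)\<close>, which has an elementary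
primitive with a limit at infinity; the weight is even.
\<close>

lemma tail_weight_finite: "(\<integral>\<^sup>+u. ennreal (tail_weight u) \<partial>lborel) < \<infinity>"
proof -
  define W where "W u = ennreal (tail_weight u)" for u
  define V where "V u = 2 powr (2 / 3) * (1 + u) powr (- 4 / 3)" for u :: real
  have [measurable]: "V \<in> borel_measurable borel" unfolding V_def by measurable
  have [measurable]: "W \<in> borel_measurable borel" unfolding W_def by measurable
  have le: "tail_weight u \<le> V u" if "0 \<le> u" for u
  proof -
    have "(1 + u)^2 / 2 \<le> 1 + u^2"
      using zero_le_power2[of "1 - u"] by (simp add: power2_eq_square algebra_simps)
    moreover have "0 < (1 + u)^2 / 2" using that by simp
    ultimately have "tail_weight u \<le> ((1 + u)^2 / 2) powr (- 2 / 3)"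
      by (intro powr_mono2') auto
    also have "\<dots> = V u"
    proof -
      have "(1 + u)^2 = (1 + u) powr 2" using that by simp
      hence "((1 + u)^2 / 2) powr (- 2 / 3) = ((1 + u) powr 2) powr (- 2 / 3) / 2 powr (- 2 / 3)"
        using that by (simp add: powr_divide)
      also have "\<dots> = V u" unfolding V_def powr_powr by (simp add: powr_minus field_simps)
      finally show ?thesis .
    qed
    finally show ?thesis .
  qed
  define F where "F u = 2 powr (2 / 3) * (- 3 * (1 + u) powr (- 1 / 3))" for u :: real
  have "(\<integral>\<^sup>+u. ennreal (V u) * indicator {0..} u \<partial>lborel) = 0 - F 0"
  proof (rule nn_integral_FTC_atLeast)
    show "(F has_real_derivative V x) (at x)" if "0 \<le> x" for x
    proof -
      have "((\<lambda>u. (1 + u) powr (- 1 / 3)) has_real_derivative (- 1 / 3) * (1 + x) powr (- 1 / 3 - 1) * 1) (at x)"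
        using that by (intro DERIV_chain2[OF has_real_derivative_powr]) (auto intro!: derivative_eq_intros)
      hence "(F has_real_derivative 2 powr (2 / 3) * (- 3 * ((- 1 / 3) * (1 + x) powr (- 1 / 3 - 1) * 1))) (at x)"
        unfolding F_def[abs_def] by (intro DERIV_cmult)
      thus ?thesis by (simp add: V_def)
    qed
    have "((\<lambda>u::real. (1 + u) powr (- 1 / 3)) \<longlongrightarrow> 0) at_top" by real_asymp
    from tendsto_mult_left[OF tendsto_mult_left[OF this]] show "(F \<longlongrightarrow> 0) at_top"
      unfolding F_def[abs_def] by (metis mult_zero_right)
  qed (auto simp: V_def)
  hence V: "(\<integral>\<^sup>+u. ennreal (V u) * indicator {0..} u \<partial>lborel) < \<infinity>" by simp
  have "(\<integral>\<^sup>+u. W u * indicator {0..} u \<partial>lborel) \<le> (\<integral>\<^sup>+u. ennreal (V u) * indicator {0..} u \<partial>lborel)"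
    using le by (intro nn_integral_mono) (auto simp: indicator_def W_def intro!: ennreal_leI)
  hence W: "(\<integral>\<^sup>+u. W u * indicator {0..} u \<partial>lborel) < \<infinity>" using V by (rule le_less_trans)
  have "(\<integral>\<^sup>+u. W u \<partial>lborel) \<le> (\<integral>\<^sup>+u. W u * indicator {0..} u + W (0 + (- 1) * u) * indicator {0..} (0 + (- 1) * u) \<partial>lborel)"
    by (intro nn_integral_mono) (auto simp: indicator_def W_def)
  also have "\<dots> = (\<integral>\<^sup>+u. W u * indicator {0..} u \<partial>lborel) + (\<integral>\<^sup>+u. W (0 + (- 1) * u) * indicator {0..} (0 + (- 1) * u) \<partial>lborel)"
    by (rule nn_integral_add) auto
  also have "(\<integral>\<^sup>+u. W (0 + (- 1) * u) * indicator {0..} (0 + (- 1) * u) \<partial>lborel) = (\<integral>\<^sup>+u. W u * indicator {0..} u \<partial>lborel)"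
    using nn_integral_real_affine[of "\<lambda>u. W u * indicator {0..} u" "- 1" 0] by simp
  also have "(\<integral>\<^sup>+u. W u * indicator {0..} u \<partial>lborel) + (\<integral>\<^sup>+u. W u * indicator {0..} u \<partial>lborel) < \<infinity>"
    using W by simp
  finally show ?thesis unfolding W_def .
qed

lemma tail_weight_pos: "0 < (\<integral>\<^sup>+u. ennreal (tail_weight u) \<partial>lborel)"
proof -
  have "(2::real) powr (- 2 / 3) \<le> tail_weight u" if "u \<in> {0..1}" for u
    using that by (intro powr_mono2') (auto simp: power_le_one)
  hence "(\<integral>\<^sup>+u. ennreal (2 powr (- 2 / 3)) * indicator {0..1::real} u \<partial>lborel) \<le> (\<integral>\<^sup>+u. ennreal (tail_weight u) \<partial>lborel)"
    by (intro nn_integral_mono) (auto simp: indicator_def intro!: ennreal_leI)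
  moreover have "(\<integral>\<^sup>+u. ennreal (2 powr (- 2 / 3)) * indicator {0..1::real} u \<partial>lborel) = ennreal (2 powr (- 2 / 3))"
    by (simp add: nn_integral_cmult_indicator)
  moreover have "0 < ennreal (2 powr (- 2 / 3))" by simp
  ultimately show ?thesis by (metis less_le_trans)
qed

text \<open>
If \<open>P\<close> is a primitive of \<open>W\<close>, then \<open>W (g u) g' u\<close> is the derivative of \<open>P (g u)\<close>, whose increment
over a long interval is, up to sign, at least the increment of \<open>P\<close> over \<open>[-n, n]\<close>.
\<close>

lemma nn_integral_path_ge:
  fixes g g' W :: "real \<Rightarrow> real"
  assumes g: "\<And>u. (g has_real_derivative g' u) (at u)" and g': "continuous_on UNIV g'"
    and W: "continuous_on UNIV W" "\<And>x. 0 \<le> W x"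
    and lim: "(filterlim g at_top at_top \<and> filterlim g at_bot at_bot) \<or> (filterlim g at_bot at_top \<and> filterlim g at_top at_bot)"
  shows "(\<integral>\<^sup>+v. ennreal (W v) \<partial>lborel) \<le> (\<integral>\<^sup>+u. ennreal (W (g u) * \<bar>g' u\<bar>) \<partial>lborel)"
proof -
  obtain P where P: "\<And>x. (P has_real_derivative W x) (at x)"
    using einterval_antiderivative[of "-\<infinity>" "\<infinity>" W] W(1)
    by (auto simp: has_real_derivative_iff_has_vector_derivative continuous_on_eq_continuous_at)
  have P_mono: "P x \<le> P y" if "x \<le> y" for x y
    using that P W(2) by (intro DERIV_nonneg_imp_nondecreasing[of x y P]) auto
  have cg: "continuous_on UNIV g"
    using g by (intro continuous_at_imp_continuous_on) (auto intro: DERIV_isCont)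
  define R where "R = (\<integral>\<^sup>+u. ennreal (W (g u) * \<bar>g' u\<bar>) \<partial>lborel)"
  have seg: "(\<integral>\<^sup>+v. ennreal (W v) * indicator {- real n..real n} v \<partial>lborel) \<le> R" for n
  proof -
    obtain x y where xy: "x \<le> y" and ends: "(g x \<le> - real n \<and> real n \<le> g y) \<or> (g y \<le> - real n \<and> real n \<le> g x)"
    proof -
      have big: "\<exists>y\<ge>0. Q y" if "eventually Q at_top" for Q :: "real \<Rightarrow> bool"
        using that unfolding eventually_at_top_linorder by (metis max.cobounded1 max.cobounded2)
      have small: "\<exists>x\<le>0. Q x" if "eventually Q at_bot" for Q :: "real \<Rightarrow> bool"
        using that unfolding eventually_at_bot_linorder by (metis min.cobounded1 min.cobounded2)
      show ?thesis
        using lim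
      proof
        assume "filterlim g at_top at_top \<and> filterlim g at_bot at_bot"
        hence "\<exists>y\<ge>0. real n \<le> g y" "\<exists>x\<le>0. g x \<le> - real n"
          by (auto simp: filterlim_at_top filterlim_at_bot intro: big small)
        thus ?thesis by (meson that order_trans)
      next
        assume "filterlim g at_bot at_top \<and> filterlim g at_top at_bot"
        hence "\<exists>y\<ge>0. g y \<le> - real n" "\<exists>x\<le>0. real n \<le> g x"
          by (auto simp: filterlim_at_top filterlim_at_bot intro: big small)
        thus ?thesis by (meson that order_trans)
      qed
    qed
    define h where "h u = W (g u) * g' u" for u
    have ch: "continuous_on UNIV h" unfolding h_def
      by (intro continuous_intros continuous_on_compose2[OF W(1) cg] g') auto
    have "((\<lambda>u. P (g u)) has_vector_derivative h u) (at u within {x..y})" for u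
      using DERIV_chain2[OF P g] unfolding h_def has_real_derivative_iff_has_vector_derivative[symmetric]
      by (rule has_field_derivative_at_within)
    hence I: "(h has_integral P (g y) - P (g x)) {x..y}"
      by (intro fundamental_theorem_of_calculus xy) auto
    have int: "(\<lambda>u. norm (h u)) integrable_on {x..y}"
      by (intro integrable_continuous_interval continuous_intros continuous_on_subset[OF ch]) auto
    have "norm (integral {x..y} h) \<le> integral {x..y} (\<lambda>u. norm (h u))"
      using I int by (intro integral_norm_bound_integral) (auto simp: has_integral_integrable)
    hence le: "\<bar>P (g y) - P (g x)\<bar> \<le> integral {x..y} (\<lambda>u. norm (h u))"
      using I by (simp add: integral_unique)
    have "P (real n) - P (- real n) \<le> \<bar>P (g y) - P (g x)\<bar>"
      using ends P_mono[of "g x" "- real n"] P_mono[of "real n" "g y"] P_mono[of "g y" "- real n"] P_mono[of "real n" "g x"]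
      by (auto simp: abs_if)
    hence "ennreal (P (real n) - P (- real n)) \<le> ennreal (integral {x..y} (\<lambda>u. norm (h u)))"
      using le by (intro ennreal_leI) simp
    also have "\<dots> = (\<integral>\<^sup>+u. ennreal (norm (h u)) * indicator {x..y} u \<partial>lborel)"
      using int by (intro nn_integral_has_integral_lebesgue'[symmetric]) (auto simp: integrable_integral)
    also have "\<dots> \<le> R" unfolding R_def
      by (intro nn_integral_mono) (auto simp: indicator_def h_def abs_mult W(2))
    also have "ennreal (P (real n) - P (- real n)) = (\<integral>\<^sup>+v. ennreal (W v) * indicator {- real n..real n} v \<partial>lborel)"
      using W P by (intro nn_integral_FTC_Icc[symmetric]) (auto intro: borel_measurable_continuous_onI has_field_derivative_at_within)
    finally show ?thesis .
  qed
  have mono: "incseq (\<lambda>n v. ennreal (W v) * indicator {- real n..real n} v)"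
    by (auto simp: incseq_def le_fun_def indicator_def)
  have "(\<integral>\<^sup>+v. ennreal (W v) \<partial>lborel) = (\<integral>\<^sup>+v. (SUP n. ennreal (W v) * indicator {- real n..real n} v) \<partial>lborel)"
  proof (intro nn_integral_cong antisym)
    fix v :: real
    obtain n where n: "\<bar>v\<bar> \<le> real n" using real_arch_simple by blast
    show "ennreal (W v) \<le> (SUP n. ennreal (W v) * indicator {- real n..real n} v)"
      using n by (intro SUP_upper2[of n]) (auto simp: indicator_def)
    show "(SUP n. ennreal (W v) * indicator {- real n..real n} v) \<le> ennreal (W v)"
      by (intro SUP_least) (auto simp: indicator_def)
  qed
  also have "\<dots> = (SUP n. (\<integral>\<^sup>+v. ennreal (W v) * indicator {- real n..real n} v \<partial>lborel))"
  proof (rule nn_integral_monotone_convergence_SUP[OF mono])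
    have [measurable]: "W \<in> borel_measurable borel" using W(1) by (rule borel_measurable_continuous_onI)
    show "(\<lambda>v. ennreal (W v) * indicator {- real n..real n} v) \<in> borel_measurable lborel" for n by measurable
  qed
  also have "\<dots> \<le> R" using seg by (intro SUP_least)
  finally show ?thesis unfolding R_def .
qed

definition radial_density :: "heis \<Rightarrow> real" where
  "radial_density p = 1 / (norm (fst p) * gauge p)"

abbreviation radial_mass :: "real \<Rightarrow> real \<Rightarrow> ennreal" where
  "radial_mass a b \<equiv> \<integral>\<^sup>+p\<in>spherical_ring a b. ennreal (radial_density p powr (4 / 3)) \<partial>lborel"

abbreviation distortion_mass :: "real \<Rightarrow> real \<Rightarrow> (heis \<Rightarrow> heis) \<Rightarrow> ennreal" where
  "distortion_mass a b f \<equiv>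
     \<integral>\<^sup>+p\<in>spherical_ring a b. ennreal (distortion f p powr (2 / 3) * radial_density p powr (4 / 3)) \<partial>lborel"

lemma radial_density_nonneg [simp]: "0 \<le> radial_density p"
  by (simp add: radial_density_def)

lemma measurable_radial_density [measurable]: "radial_density \<in> borel_measurable borel"
proof -
  have "(\<lambda>p. norm (fst p) * gauge p) \<in> borel_measurable borel"
    by (intro borel_measurable_continuous_onI continuous_intros)
  thus ?thesis unfolding radial_density_def[abs_def] by measurable
qed

text \<open>
The density of \<open>r^(4/3)\<close> with respect to \<open>d\<xi> d\<eta> du\<close> depends on \<open>u\<close> only.
\<close>

lemma radial_density_chart:
  "norm (fst (chart p)) ^ 4 * radial_density (chart p) powr (4 / 3) = tail_weight (snd p)"
proof -
  define n where "n = norm (fst (chart p))"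
  define s where "s = 1 + (snd p)^2"
  have n: "0 < n" by (simp add: n_def)
  have s: "0 < s" by (simp add: s_def)
  have g: "gauge (chart p) = n^2 * sqrt s" by (simp add: gauge_chart_norm n_def s_def)
  have "n * gauge (chart p) = n powr 3 * s powr (1 / 2)"
    unfolding g using n s by (simp add: powr_half_sqrt power2_eq_square power3_eq_cube)
  hence "radial_density (chart p) = n powr (- 3) * s powr (- 1 / 2)"
    unfolding radial_density_def n_def[symmetric] by (simp add: powr_minus field_simps)
  hence "radial_density (chart p) powr (4 / 3) = n powr (- 4) * s powr (- 2 / 3)"
    using n s by (simp add: powr_mult powr_powr)
  moreover have "n ^ 4 * n powr (- 4) = 1" using n by (simp add: powr_minus)
  ultimately show ?thesis by (simp add: n_def[symmetric] s_def[symmetric] mult.assoc[symmetric])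
qed

text \<open>
Converts slope into length: \<open>2 N / |z|\<^sup>3\<close> bounds the change of the slope \<open>- t / |z|\<^sup>2\<close> per unit of
horizontal length, and \<open>2 r^(1/3)\<close> is the resulting density for curves.
\<close>

lemma density_pullback:
  assumes z: "fst q \<noteq> 0"
  shows "tail_weight (- snd q / (norm (fst q))^2) * (2 * gauge q / norm (fst q) ^ 3) = 2 * radial_density q powr (1 / 3)"
proof -
  define n where "n = norm (fst q)"
  define G where "G = gauge q"
  have n: "0 < n" using z by (simp add: n_def)
  have G: "0 < G" using z by (auto simp: G_def gauge_pos_iff)
  have "1 + (- snd q / n^2)^2 = G^2 / n^4"
    using n unfolding G_def gauge_square n_def[symmetric]
    by (simp add: field_simps power2_eq_square power4_eq_xxxx)
  also have "\<dots> = G powr 2 * n powr (- 4)" using n G by (simp add: powr_minus divide_inverse)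
  finally have "tail_weight (- snd q / n^2) = (G powr 2 * n powr (- 4)) powr (- 2 / 3)"
    by (simp only:)
  also have "\<dots> = G powr (- 4 / 3) * n powr (8 / 3)"
    using n G by (simp add: powr_mult powr_powr del: powr_numeral)
  finally have "tail_weight (- snd q / n^2) = G powr (- 4 / 3) * n powr (8 / 3)" .
  moreover have "G / n ^ 3 = G powr 1 * n powr (- 3)" using n G by (simp add: powr_minus divide_inverse)
  moreover have "tail_weight (- snd q / n^2) * (2 * G / n ^ 3) = 2 * (tail_weight (- snd q / n^2) * (G / n ^ 3))"
    by simp
  ultimately have "tail_weight (- snd q / n^2) * (2 * G / n ^ 3) = 2 * ((G powr (- 4 / 3) * n powr (8 / 3)) * (G powr 1 * n powr (- 3)))"
    by (simp only:)
  also have "\<dots> = 2 * ((G powr (- 4 / 3) * G powr 1) * (n powr (8 / 3) * n powr (- 3)))"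
    by (simp only: mult_ac)
  also have "\<dots> = 2 * (G powr (- 1 / 3) * n powr (- 1 / 3))"
    unfolding powr_add[symmetric] by simp
  also have "G powr (- 1 / 3) * n powr (- 1 / 3) = radial_density q powr (1 / 3)"
    using n G unfolding radial_density_def n_def[symmetric] G_def[symmetric]
    by (simp add: powr_divide powr_mult powr_minus field_simps)
  finally show ?thesis by (simp add: n_def G_def)
qed

text \<open>
Young's inequality with exponents \<open>4\<close> and \<open>4/3\<close>. The factor \<open>k^(1/4)\<close> is distributed such that
equality holds when \<open>R\<close>, \<open>l\<close>, \<open>K\<close> and \<open>r\<close> are the values of the stretch map.
\<close>

lemma Young_4_density:
  fixes k R l K r :: real
  assumes k: "0 < k" and nn: "0 \<le> R" "0 \<le> l" "0 \<le> K" "0 \<le> r"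
  shows "R powr (1 / 3) * sqrt (K * l) * r \<le> R powr (4 / 3) * l^2 / (4 * k) + 3 / 4 * k powr (1 / 3) * (K powr (2 / 3) * r powr (4 / 3))"
proof -
  define a where "a = R powr (1 / 3) * sqrt l / k powr (1 / 4)"
  define b where "b = k powr (1 / 4) * (sqrt K * r)"
  have "a * b \<le> a powr 4 / 4 + b powr (4 / 3) / (4 / 3)"
    by (rule Youngs_inequality) (use nn in \<open>auto simp: a_def b_def\<close>)
  moreover have "a * b = R powr (1 / 3) * sqrt (K * l) * r"
    using k by (simp add: a_def b_def real_sqrt_mult)
  moreover have "a powr 4 = R powr (4 / 3) * l^2 / k"
  proof -
    have "a powr 4 = (R powr (1 / 3)) powr 4 * (sqrt l) powr 4 / (k powr (1 / 4)) powr 4"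
      unfolding a_def using nn by (simp add: powr_mult powr_divide)
    also have "(sqrt l) powr 4 = l^2"
    proof (cases "l = 0")
      case False
      hence "(sqrt l) powr 4 = l powr 2" using nn by (simp add: powr_half_sqrt[symmetric] powr_powr)
      thus ?thesis using False nn by simp
    qed simp
    finally show ?thesis using k by (simp add: powr_powr)
  qed
  moreover have "b powr (4 / 3) = k powr (1 / 3) * (K powr (2 / 3) * r powr (4 / 3))"
  proof -
    have "b powr (4 / 3) = (k powr (1 / 4)) powr (4 / 3) * ((sqrt K) powr (4 / 3) * r powr (4 / 3))"
      unfolding b_def using nn by (simp add: powr_mult)
    also have "(sqrt K) powr (4 / 3) = K powr (2 / 3)"
      using nn by (simp add: powr_half_sqrt[symmetric] powr_powr)
    finally show ?thesis by (simp add: powr_powr)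
  qed
  ultimately show ?thesis by simp
qed

section \<open>Images of the horizontal curves between the two halves of the axis\<close>

text \<open>
For horizontal \<open>v = (\<zeta>, \<tau>)\<close> one has \<open>\<tau> = -2 Im (cnj z \<zeta>)\<close>, and the numerator is twice the inner
product of \<open>(|z|\<^sup>2, t)\<close> with the imaginary and real part of \<open>cnj z \<zeta>\<close>; the bound is Cauchy-Schwarz.
\<close>

lemma height_derivative_bound:
  assumes z: "fst q \<noteq> 0" and v: "contact_form q v = 0"
  shows "\<bar>(- snd v * (norm (fst q))^2 + snd q * (2 * Re (cnj (fst q) * fst v))) / ((norm (fst q))^2)^2\<bar>
    \<le> 2 * gauge q / norm (fst q) ^ 3 * norm (fst v)"
proof -
  define n where "n = norm (fst q)"
  define A where "A = Im (cnj (fst q) * fst v)"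
  define B where "B = Re (cnj (fst q) * fst v)"
  define t where "t = snd q"
  have n: "0 < n" using z by (simp add: n_def)
  have sv: "snd v = - 2 * A" using v by (simp add: contact_form_def A_def)
  have AB: "A^2 + B^2 = (n * norm (fst v))^2"
  proof -
    have "A^2 + B^2 = (norm (cnj (fst q) * fst v))^2" unfolding cmod_power2 A_def B_def by simp
    thus ?thesis by (simp add: norm_mult n_def)
  qed
  have "\<bar>n^2 * A + t * B\<bar> \<le> gauge q * (n * norm (fst v))"
  proof (rule power2_le_imp_le)
    have "(n^2 * A + t * B)^2 \<le> (n^4 + t^2) * (A^2 + B^2)"
    proof -
      have "(n^4 + t^2) * (A^2 + B^2) - (n^2 * A + t * B)^2 = (n^2 * B - t * A)^2" by algebra
      thus ?thesis using zero_le_power2[of "n^2 * B - t * A"] by linarith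
    qed
    also have "\<dots> = (gauge q * (n * norm (fst v)))^2"
      unfolding AB power_mult_distrib[of "gauge q"] gauge_square n_def t_def ..
    finally show "\<bar>n^2 * A + t * B\<bar>^2 \<le> (gauge q * (n * norm (fst v)))^2" by simp
  qed (use n in auto)
  moreover have "- snd v * n^2 + t * (2 * B) = 2 * (n^2 * A + t * B)" by (simp add: sv algebra_simps)
  ultimately have "\<bar>- snd v * n^2 + t * (2 * B)\<bar> \<le> 2 * (gauge q * (n * norm (fst v)))" by (simp add: abs_mult)
  hence "\<bar>(- snd v * n^2 + t * (2 * B)) / (n^2)^2\<bar> \<le> 2 * (gauge q * (n * norm (fst v))) / (n^2)^2"
    using n by (simp add: divide_right_mono)
  also have "\<dots> = 2 * gauge q / n^3 * norm (fst v)"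
    using n by (simp add: field_simps power2_eq_square power3_eq_cube)
  finally show ?thesis by (simp only: n_def t_def B_def)
qed

lemma chart_tendsto:
  "((\<lambda>u. chart (c, u)) \<longlongrightarrow> (0, - exp (Re c))) at_top"
  "((\<lambda>u. chart (c, u)) \<longlongrightarrow> (0, exp (Re c))) at_bot"
proof -
  define n where "n u = norm (fst (chart (c, u)))" for u
  have nsq: "(n u)^2 = exp (Re c) / sqrt (1 + u^2)" for u
    by (simp add: n_def norm_chart exp_half_ln)
  have n: "n u = sqrt (exp (Re c) * (1 / sqrt (1 + u^2)))" for u
    using nsq[of u] by (simp add: n_def real_sqrt_unique)
  have s: "snd (chart (c, u)) = - exp (Re c) * (u / sqrt (1 + u^2))" for u
    using snd_chart[of "(c, u)"] nsq[of u] by (simp add: n_def)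
  have "((\<lambda>u::real. 1 / sqrt (1 + u^2)) \<longlongrightarrow> 0) at_top" "((\<lambda>u::real. 1 / sqrt (1 + u^2)) \<longlongrightarrow> 0) at_bot"
    by real_asymp+
  hence "(n \<longlongrightarrow> sqrt (exp (Re c) * 0)) at_top" "(n \<longlongrightarrow> sqrt (exp (Re c) * 0)) at_bot"
    unfolding n[abs_def] by (intro tendsto_intros; simp)+
  hence f: "((\<lambda>u. fst (chart (c, u))) \<longlongrightarrow> 0) at_top" "((\<lambda>u. fst (chart (c, u))) \<longlongrightarrow> 0) at_bot"
    unfolding n_def by (auto intro: tendsto_norm_zero_cancel)
  have "((\<lambda>u::real. u / sqrt (1 + u^2)) \<longlongrightarrow> 1) at_top" "((\<lambda>u::real. u / sqrt (1 + u^2)) \<longlongrightarrow> - 1) at_bot"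
    by real_asymp+
  from tendsto_mult_left[OF this(1), of "- exp (Re c)"] tendsto_mult_left[OF this(2), of "- exp (Re c)"]
  have "((\<lambda>u. snd (chart (c, u))) \<longlongrightarrow> - exp (Re c)) at_top" "((\<lambda>u. snd (chart (c, u))) \<longlongrightarrow> exp (Re c)) at_bot"
    unfolding s by simp_all
  from tendsto_Pair[OF f(1) this(1)] tendsto_Pair[OF f(2) this(2)]
  show "((\<lambda>u. chart (c, u)) \<longlongrightarrow> (0, - exp (Re c))) at_top"
    "((\<lambda>u. chart (c, u)) \<longlongrightarrow> (0, exp (Re c))) at_bot" by simp_all
qed

lemma axis_mem_ring: "0 < a \<Longrightarrow> 0 < b \<Longrightarrow> (0, s) \<in> spherical_ring a b \<longleftrightarrow> a^2 < \<bar>s\<bar> \<and> \<bar>s\<bar> < b^2"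
  by (simp add: spherical_ring_gauge) (simp add: gauge_def)

text \<open>
The slope blows up at a point of the axis, with the sign opposite to that of the height \<open>s\<close>.
\<close>

lemma slope_filterlim:
  fixes T w :: "real \<Rightarrow> real"
  assumes T: "(T \<longlongrightarrow> s) F" and w: "(w \<longlongrightarrow> 0) F" and pos: "\<And>u. 0 < w u"
  shows "s < 0 \<Longrightarrow> filterlim (\<lambda>u. - T u / w u) at_top F" "0 < s \<Longrightarrow> filterlim (\<lambda>u. - T u / w u) at_bot F"
proof -
  have iw: "filterlim (\<lambda>u. inverse (w u)) at_top F"
    using w pos by (intro filterlim_inverse_at_top) auto
  have mT: "((\<lambda>u. - T u) \<longlongrightarrow> - s) F" by (intro tendsto_minus T)
  show "filterlim (\<lambda>u. - T u / w u) at_top F" if "s < 0"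
    unfolding divide_inverse using that by (intro filterlim_tendsto_pos_mult_at_top[OF mT _ iw]) simp
  show "filterlim (\<lambda>u. - T u / w u) at_bot F" if "0 < s"
    unfolding divide_inverse using that by (intro filterlim_tendsto_neg_mult_at_bot[OF mT _ iw]) simp
qed

locale ring_contact = contact_C2 "spherical_ring a b" f D D2 l
  for a b :: real and f D D2 l +
  fixes k :: real
  assumes a: "0 < a" and ab: "a < b" and k: "0 < k"
    and bij: "bij_betw f (spherical_ring a b) (spherical_ring (a powr k) (b powr k))"
    and axis: "f ` (vertical_axis \<inter> spherical_ring a b) = vertical_axis \<inter> spherical_ring (a powr k) (b powr k)"
begin

lemma b: "0 < b" and a': "0 < a powr k" and b': "0 < b powr k"
  using a ab by auto

text \<open>
On each half of the axis the height of the image is continuous without zeros, hence of constant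
sign. Were the signs on the two halves equal, then one half of the target axis would not be reached.
\<close>

lemma axis_sides:
  assumes t: "a^2 < t" "t < b^2"
  shows "snd (f (0, t)) * snd (f (0, - t)) < 0"
proof -
  define \<sigma> where "\<sigma> s = snd (f (0, s))" for s
  define I where "I = {a^2<..<b^2}"
  define J where "J = {- (b^2) <..< (- (a^2))}"
  have a2: "0 < a^2" using a by simp
  have IJ: "(0, s) \<in> spherical_ring a b \<longleftrightarrow> s \<in> I \<union> J" for s
    unfolding axis_mem_ring[OF a b] I_def J_def Un_iff greaterThanLessThan_iff using a2 by linarith
  have im: "\<sigma> s \<noteq> 0" "(0, \<sigma> s) \<in> spherical_ring (a powr k) (b powr k)" if "s \<in> I \<union> J" for s
  proof -
    have "f (0, s) \<in> vertical_axis \<inter> spherical_ring (a powr k) (b powr k)"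
    proof -
      have "(0, s) \<in> vertical_axis \<inter> spherical_ring a b" using that IJ by (simp add: vertical_axis_iff)
      thus ?thesis unfolding axis[symmetric] by (rule imageI)
    qed
    moreover from this have "f (0, s) = (0, \<sigma> s)" by (simp add: vertical_axis_iff \<sigma>_def prod_eq_iff)
    ultimately show mem: "(0, \<sigma> s) \<in> spherical_ring (a powr k) (b powr k)" by simp
    show "\<sigma> s \<noteq> 0" using spherical_ring_nonzero[OF a' b' mem] by (simp add: zero_prod_def)
  qed
  have cont: "continuous_on (I \<union> J) \<sigma>"
    unfolding \<sigma>_def[abs_def]
    by (intro continuous_on_snd continuous_on_compose2[OF continuous_on_f] continuous_intros) (auto simp: IJ)
  have same: "0 < \<sigma> x * \<sigma> y" if S: "S = I \<or> S = J" and xy: "x \<in> S" "y \<in> S" for S x y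
  proof (rule ccontr)
    assume neg: "\<not> 0 < \<sigma> x * \<sigma> y"
    have nz: "\<sigma> s \<noteq> 0" if "s \<in> S" for s using im S that by blast
    have "connected (\<sigma> ` S)"
      using S cont by (intro connected_continuous_image) (auto simp: I_def J_def intro: continuous_on_subset)
    moreover have "(\<sigma> x \<le> 0 \<and> 0 \<le> \<sigma> y) \<or> (\<sigma> y \<le> 0 \<and> 0 \<le> \<sigma> x)"
      using neg by (auto simp: zero_less_mult_iff not_less)
    ultimately have "0 \<in> \<sigma> ` S" using xy by (meson connectedD_interval imageI)
    thus False using nz by auto
  qed
  have tI: "t \<in> I" "- t \<in> J" using t by (auto simp: I_def J_def)
  show ?thesis
  proof (rule ccontr)
    assume "\<not> snd (f (0, t)) * snd (f (0, - t)) < 0"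
    hence "\<not> \<sigma> t * \<sigma> (- t) < 0" by (simp add: \<sigma>_def)
    moreover have "\<sigma> t * \<sigma> (- t) \<noteq> 0" using im(1)[of t] im(1)[of "- t"] tI by simp
    ultimately have tt: "0 < \<sigma> t * \<sigma> (- t)" by linarith
    have "(0, \<sigma> t) \<in> spherical_ring (a powr k) (b powr k)" using im(2)[of t] tI by simp
    hence "(0, - \<sigma> t) \<in> vertical_axis \<inter> spherical_ring (a powr k) (b powr k)"
      by (simp add: axis_mem_ring[OF a' b'] vertical_axis_iff)
    then obtain p where p: "p \<in> vertical_axis" "p \<in> spherical_ring a b" "f p = (0, - \<sigma> t)"
      unfolding axis[symmetric] by auto
    obtain s where s: "p = (0, s)" using p(1) by (cases p) (auto simp: vertical_axis_def)
    have sIJ: "s \<in> I \<or> s \<in> J" using p(2) IJ by (auto simp: s)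
    have "\<sigma> s = - \<sigma> t" using p(3) by (simp add: \<sigma>_def s)
    moreover have "0 < \<sigma> t * \<sigma> s"
      using sIJ
    proof
      assume "s \<in> I" thus ?thesis using same[of I t s] tI by auto
    next
      assume "s \<in> J"
      hence "0 < \<sigma> (- t) * \<sigma> s" using same[of J "- t" s] tI by auto
      thus ?thesis using tt by (auto simp: zero_less_mult_iff)
    qed
    ultimately show False by (auto simp: zero_less_mult_iff)
  qed
qed

lemma off_axis:
  assumes "p \<in> spherical_ring a b" "p \<notin> vertical_axis"
  shows "fst (f p) \<noteq> 0"
proof
  assume "fst (f p) = 0"
  hence "f p \<in> vertical_axis \<inter> spherical_ring (a powr k) (b powr k)"
    using bij assms(1) by (auto simp: vertical_axis_iff bij_betw_def)
  then obtain q where "q \<in> vertical_axis" "q \<in> spherical_ring a b" "f q = f p"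
    unfolding axis[symmetric] by auto
  thus False using assms bij by (auto simp: bij_betw_def inj_on_def)
qed

text \<open>
The curve tends to opposite points of the axis at its two ends. The slope of its image thus tends
to opposite infinities, and its variation is bounded by the horizontal length of the image curve,
which is at most \<open>(K l)^(1/2)\<close> times the length \<open>|z|\<^sup>3 / (2 N) du\<close> of the curve.
\<close>

lemma curve_estimate:
  assumes c: "c \<in> base_strip (2 * ln a) (2 * ln b)"
  shows "(\<integral>\<^sup>+u. ennreal (tail_weight u) \<partial>lborel) \<le>
    (\<integral>\<^sup>+u. ennreal (radial_density (f (chart (c, u))) powr (1 / 3) * sqrt (distortion f (chart (c, u)) * l (chart (c, u)))
        * (norm (fst (chart (c, u))) ^ 3 / gauge (chart (c, u)))) \<partial>lborel)"
proof -
  define \<gamma> where "\<gamma> u = chart (c, u)" for u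
  define v where "v u = chart_derivative (c, u) (0, 1)" for u
  define P where "P u = fst (f (\<gamma> u))" for u
  define T where "T u = snd (f (\<gamma> u))" for u
  define \<zeta> where "\<zeta> u = fst (D (\<gamma> u) (v u))" for u
  define \<tau> where "\<tau> u = snd (D (\<gamma> u) (v u))" for u
  have \<gamma>: "\<gamma> u \<in> spherical_ring a b" "\<gamma> u \<notin> vertical_axis" for u
    using chart_image[OF a b] c unfolding \<gamma>_def by (auto dest!: equalityD1 simp: subset_iff)
  have P0: "P u \<noteq> 0" for u unfolding P_def by (rule off_axis[OF \<gamma>])
  define g where "g u = - T u / (norm (P u))^2" for u
  define g' where "g' u = (- \<tau> u * (norm (P u))^2 + T u * (2 * Re (cnj (P u) * \<zeta> u))) / ((norm (P u))^2)^2" for u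
  have d\<gamma>: "(\<gamma> has_vector_derivative v u) (at u)" for u
  proof -
    have "((\<lambda>u. (c, u)) has_derivative (\<lambda>h. (0, h))) (at u)" by (auto intro!: derivative_eq_intros)
    from has_derivative_compose[OF this chart_has_derivative]
    have d: "(\<gamma> has_derivative (\<lambda>h. chart_derivative (c, u) (0, h))) (at u)" by (simp add: \<gamma>_def[abs_def])
    have "(0, h) = h *\<^sub>R (0, 1 :: real)" for h by simp
    hence "chart_derivative (c, u) (0, h) = h *\<^sub>R v u" for h
      unfolding v_def using linear_cmul[OF has_derivative_linear[OF chart_has_derivative]] by metis
    with d show ?thesis by (simp add: has_vector_derivative_def)
  qed
  have df: "((\<lambda>u. f (\<gamma> u)) has_vector_derivative D (\<gamma> u) (v u)) (at u)" for u
    using has_derivative_compose[OF d\<gamma>[unfolded has_vector_derivative_def] D[OF \<gamma>(1)]]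
    by (simp add: has_vector_derivative_def blinfun.scaleR_right)
  have dT: "(T has_real_derivative \<tau> u) (at u)" for u
    using has_derivative_snd[OF df[unfolded has_vector_derivative_def]]
    by (simp add: T_def[abs_def] \<tau>_def has_real_derivative_iff_has_vector_derivative has_vector_derivative_def)
  have dP: "(P has_derivative (\<lambda>h. h *\<^sub>R \<zeta> u)) (at u)" for u
    using has_derivative_fst[OF df[unfolded has_vector_derivative_def]]
    by (simp add: P_def[abs_def] \<zeta>_def)
  have dw: "((\<lambda>u. (norm (P u))^2) has_real_derivative 2 * Re (cnj (P u) * \<zeta> u)) (at u)" for u
  proof -
    have "((\<lambda>u. (norm (P u))^2) has_derivative (\<lambda>h. 2 * (P u \<bullet> (h *\<^sub>R \<zeta> u)))) (at u)"
      unfolding power2_norm_eq_inner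
      by (rule has_derivative_eq_rhs[OF has_derivative_inner[OF dP dP]]) (simp add: inner_commute)
    thus ?thesis unfolding has_field_derivative_def
      by (rule has_derivative_eq_rhs) (auto simp: inner_complex_def algebra_simps)
  qed
  have dg: "(g has_real_derivative g' u) (at u)" for u
  proof -
    have "(g has_real_derivative (- \<tau> u * (norm (P u))^2 - - T u * (2 * Re (cnj (P u) * \<zeta> u))) / ((norm (P u))^2 * (norm (P u))^2)) (at u)"
      unfolding g_def[abs_def] by (intro DERIV_divide DERIV_minus dT dw) (simp add: P0)
    thus ?thesis by (simp add: g'_def power2_eq_square[of "(norm (P u))^2"])
  qed
  have c\<gamma>: "continuous_on UNIV \<gamma>" unfolding \<gamma>_def[abs_def] by (intro continuous_intros)
  have cf: "continuous_on UNIV (\<lambda>u. f (\<gamma> u))" "continuous_on UNIV (\<lambda>u. D (\<gamma> u))"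
    using continuous_on_compose2[OF continuous_on_f c\<gamma>] continuous_on_compose2[OF continuous_on_D c\<gamma>] \<gamma>(1) by auto
  have cv: "continuous_on UNIV v"
  proof -
    have nz: "2 + 2 * u^2 \<noteq> 0" for u :: real using one_plus_square_nz[of u] by linarith
    have "continuous_on UNIV (\<lambda>u. (fst (chart (c, u)) * Complex (- (u / (2 * (1 + u^2)))) (1 / (1 + u^2) / 2),
        - ((norm (fst (chart (c, u))))^2) * (1 / (1 + u^2))))"
      unfolding Complex_eq by (intro continuous_intros) (auto simp: nz)
    moreover have "v u = (fst (chart (c, u)) * Complex (- (u / (2 * (1 + u^2)))) (1 / (1 + u^2) / 2),
        - ((norm (fst (chart (c, u))))^2) * (1 / (1 + u^2)))" for u
      by (simp add: v_def chart_derivative_def)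
    ultimately show ?thesis by simp
  qed
  have cg': "continuous_on UNIV g'"
    unfolding g'_def P_def \<zeta>_def \<tau>_def T_def
    by (intro continuous_intros cf cv) (use P0 in \<open>auto simp: P_def\<close>)
  have pos: "0 < (norm (P u))^2" for u using P0 by simp
  have ring: "a^2 < exp (Re c)" "exp (Re c) < b^2"
  proof -
    have "a^2 = exp (2 * ln a)" "b^2 = exp (2 * ln b)" using a b by (simp_all add: exp_double)
    thus "a^2 < exp (Re c)" "exp (Re c) < b^2" using c by (simp_all add: base_strip_def)
  qed
  have end_limits: "(T \<longlongrightarrow> snd (f (0, s))) F \<and> ((\<lambda>u. (norm (P u))^2) \<longlongrightarrow> 0) F"
    if lim: "(\<gamma> \<longlongrightarrow> (0, s)) F" and s: "\<bar>s\<bar> = exp (Re c)" for s F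
  proof -
    have mem: "(0, s) \<in> spherical_ring a b" using ring s by (simp add: axis_mem_ring a b)
    hence "isCont f (0, s)"
      using continuous_on_f open_dom by (simp add: continuous_on_eq_continuous_at)
    from isCont_tendsto_compose[OF this lim] have L: "((\<lambda>u. f (\<gamma> u)) \<longlongrightarrow> f (0, s)) F" .
    have "f (0, s) \<in> vertical_axis" using axis mem by (auto simp: vertical_axis_iff)
    hence "fst (f (0, s)) = 0" by (simp add: vertical_axis_iff)
    with tendsto_fst[OF L] have "(P \<longlongrightarrow> 0) F" by (simp add: P_def[abs_def])
    hence "((\<lambda>u. (norm (P u))^2) \<longlongrightarrow> (norm (0::complex))^2) F" by (intro tendsto_intros)
    thus ?thesis using tendsto_snd[OF L] by (simp add: T_def[abs_def])
  qed
  have top: "(\<gamma> \<longlongrightarrow> (0, - exp (Re c))) at_top" and bot: "(\<gamma> \<longlongrightarrow> (0, exp (Re c))) at_bot"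
    using chart_tendsto[of c] by (simp_all add: \<gamma>_def[abs_def])
  have opp: "snd (f (0, exp (Re c))) * snd (f (0, - exp (Re c))) < 0" using axis_sides[OF ring] .
  have lim: "(filterlim g at_top at_top \<and> filterlim g at_bot at_bot) \<or> (filterlim g at_bot at_top \<and> filterlim g at_top at_bot)"
    using slope_filterlim[of T _ at_top "\<lambda>u. (norm (P u))^2", OF _ _ pos] slope_filterlim[of T _ at_bot "\<lambda>u. (norm (P u))^2", OF _ _ pos]
      end_limits[OF top] end_limits[OF bot] opp unfolding g_def[abs_def] mult_less_0_iff by auto
  have "(\<integral>\<^sup>+u. ennreal (tail_weight u) \<partial>lborel) \<le> (\<integral>\<^sup>+u. ennreal (tail_weight (g u) * \<bar>g' u\<bar>) \<partial>lborel)"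
    by (rule nn_integral_path_ge[OF dg cg' _ _ lim]) (auto intro!: continuous_intros)
  also have "\<dots> \<le> (\<integral>\<^sup>+u. ennreal (radial_density (f (\<gamma> u)) powr (1 / 3) * sqrt (distortion f (\<gamma> u) * l (\<gamma> u))
        * (norm (fst (\<gamma> u)) ^ 3 / gauge (\<gamma> u))) \<partial>lborel)"
  proof (intro nn_integral_mono ennreal_leI)
    fix u
    have hor: "contact_form (\<gamma> u) (v u) = 0" and nv: "norm (fst (v u)) = norm (fst (\<gamma> u)) / (2 * sqrt (1 + u^2))"
      unfolding \<gamma>_def v_def using chart_derivative_vertical[of "(c, u)"] by simp_all
    have "norm (fst (v u)) = norm (fst (\<gamma> u)) ^ 3 / (2 * gauge (\<gamma> u))"
      using norm_fst_chart_pos[of "(c, u)"] unfolding nv \<gamma>_def gauge_chart_norm by (simp add: power2_eq_square power3_eq_cube)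
    hence z: "norm (\<zeta> u) \<le> sqrt (distortion f (\<gamma> u) * l (\<gamma> u)) * (norm (fst (\<gamma> u)) ^ 3 / (2 * gauge (\<gamma> u)))"
      using derivative_horizontal_bound[OF \<gamma>(1) hor] by (simp add: \<zeta>_def)
    have "contact_form (f (\<gamma> u)) (D (\<gamma> u) (v u)) = 0" using contact[OF \<gamma>(1)] hor by simp
    from height_derivative_bound[OF _ this] P0[of u]
    have "\<bar>g' u\<bar> \<le> 2 * gauge (f (\<gamma> u)) / norm (P u) ^ 3 * norm (\<zeta> u)"
      unfolding g'_def P_def T_def \<zeta>_def \<tau>_def by simp
    hence "tail_weight (g u) * \<bar>g' u\<bar> \<le> tail_weight (g u) * (2 * gauge (f (\<gamma> u)) / norm (P u) ^ 3 * norm (\<zeta> u))"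
      by (intro mult_left_mono) auto
    also have "\<dots> = 2 * radial_density (f (\<gamma> u)) powr (1 / 3) * norm (\<zeta> u)"
      using density_pullback[of "f (\<gamma> u)"] P0[of u] unfolding g_def P_def T_def by (simp only: mult.assoc[symmetric]) simp
    also have "\<dots> \<le> 2 * radial_density (f (\<gamma> u)) powr (1 / 3) *
        (sqrt (distortion f (\<gamma> u) * l (\<gamma> u)) * (norm (fst (\<gamma> u)) ^ 3 / (2 * gauge (\<gamma> u))))"
      by (intro mult_left_mono z) auto
    also have "\<dots> = radial_density (f (\<gamma> u)) powr (1 / 3) * sqrt (distortion f (\<gamma> u) * l (\<gamma> u))
        * (norm (fst (\<gamma> u)) ^ 3 / gauge (\<gamma> u))" by simp
    finally show "tail_weight (g u) * \<bar>g' u\<bar> \<le> radial_density (f (\<gamma> u)) powr (1 / 3) * sqrt (distortion f (\<gamma> u) * l (\<gamma> u))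
        * (norm (fst (\<gamma> u)) ^ 3 / gauge (\<gamma> u))" .
  qed
  finally show ?thesis unfolding \<gamma>_def .
qed

end

section \<open>The integral of the distortion\<close>

definition tail_mass :: ennreal where
  "tail_mass = (\<integral>\<^sup>+u. ennreal (tail_weight u) \<partial>lborel)"

lemma emeasure_base_strip_ln:
  assumes "0 < a" "a < b"
  shows "emeasure lborel (base_strip (2 * ln a) (2 * ln b)) = ennreal (8 * pi / 3 * (ln b - ln a))"
  using assms by (subst emeasure_base_strip) (auto simp: field_simps)

lemma nn_integral_base_strip_const:
  assumes ab: "0 < a" "a < b"
  shows "(\<integral>\<^sup>+c\<in>base_strip (2 * ln a) (2 * ln b). (ennreal (3 / 4) * y) \<partial>lborel) = ennreal (2 * pi * (ln b - ln a)) * y"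
proof -
  have ln: "0 < ln b - ln a" using ab by simp
  have "(\<integral>\<^sup>+c\<in>base_strip (2 * ln a) (2 * ln b). (ennreal (3 / 4) * y) \<partial>lborel)
     = ennreal (3 / 4) * y * ennreal (8 * pi / 3 * (ln b - ln a))"
    by (subst nn_integral_cmult_indicator) (simp_all add: emeasure_base_strip_ln[OF ab])
  also have "\<dots> = ennreal (3 / 4 * (8 * pi / 3 * (ln b - ln a))) * y"
    using ln by (subst ennreal_mult) (auto simp: mult_ac)
  also have "3 / 4 * (8 * pi / 3 * (ln b - ln a)) = 2 * pi * (ln b - ln a)" by simp
  finally show ?thesis .
qed

lemma radial_mass_eq:
  assumes ab: "0 < a" "a < b"
  shows "radial_mass a b = ennreal (2 * pi * (ln b - ln a)) * tail_mass"
proof -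
  have b: "0 < b" using ab by simp
  have e: "3 / 4 * norm (fst (chart (c, u))) ^ 4 * radial_density (chart (c, u)) powr (4 / 3) = 3 / 4 * tail_weight u" for c u
    using radial_density_chart[of "(c, u)"] by simp
  have "radial_mass a b
    = (\<integral>\<^sup>+c\<in>base_strip (2 * ln a) (2 * ln b). (\<integral>\<^sup>+u. ennreal (3 / 4 * tail_weight u) \<partial>lborel) \<partial>lborel)"
    by (subst nn_integral_spherical_ring[OF ab(1) b]) (simp_all only: e, simp_all)
  also have "(\<integral>\<^sup>+u. ennreal (3 / 4 * tail_weight u) \<partial>lborel) = ennreal (3 / 4) * tail_mass"
  proof -
    have "ennreal (3 / 4 * tail_weight u) = ennreal (3 / 4) * ennreal (tail_weight u)" for u by (intro ennreal_mult') simp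
    thus ?thesis unfolding tail_mass_def by (simp only:) (rule nn_integral_cmult, measurable)
  qed
  also note nn_integral_base_strip_const[OF ab]
  finally show ?thesis .
qed

lemma radial_mass_real:
  assumes ab: "0 < a" "a < b"
  obtains x where "0 < x"
    "radial_mass a b = ennreal x"
proof (rule that)
  have j: "0 < enn2real tail_mass" "tail_mass = ennreal (enn2real tail_mass)"
    using tail_weight_finite tail_weight_pos unfolding tail_mass_def by (simp_all add: enn2real_positive_iff)
  have ln: "0 < ln b - ln a" using ab by simp
  show "0 < 2 * pi * (ln b - ln a) * enn2real tail_mass" using j(1) ln by simp
  show "radial_mass a b
      = ennreal (2 * pi * (ln b - ln a) * enn2real tail_mass)"
    unfolding radial_mass_eq[OF ab] using ln by (subst (1) j(2)) (simp add: ennreal_mult')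
qed

context ring_contact
begin

text \<open>
The map \<open>f\<close> and its dilation are continuous on the ring only; extended by zero they are Borel
functions on the whole space.
\<close>

definition zero_extension :: "(heis \<Rightarrow> 'x::zero) \<Rightarrow> heis \<Rightarrow> 'x" where
  "zero_extension h p = (if p \<in> spherical_ring a b then h p else 0)"

lemma measurable_zero_extension:
  fixes h :: "heis \<Rightarrow> 'x::{topological_space, zero}"
  assumes "continuous_on (spherical_ring a b) h" shows "zero_extension h \<in> borel_measurable borel"
  unfolding zero_extension_def[abs_def] using assms open_dom by (intro borel_measurable_continuous_on_if) auto

lemma measurable_ring [measurable]: "spherical_ring a b \<in> sets borel"
  using open_dom by auto

lemma measurable_pullback: "(\<lambda>p. radial_density (zero_extension f p)) \<in> borel_measurable borel"
  by (rule measurable_compose[OF measurable_zero_extension[OF continuous_on_f] measurable_radial_density])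

text \<open>
Change of variables with Jacobian \<open>l\<^sup>2\<close>; the mass of a ring is proportional to the logarithm of the
ratio of its radii, which the passage to the image ring multiplies by \<open>k\<close>.
\<close>

lemma pullback_mass:
  "(\<integral>\<^sup>+p\<in>spherical_ring a b. ennreal (radial_density (f p) powr (4 / 3) * (l p)^2) \<partial>lborel)
    = ennreal k * radial_mass a b"
proof -
  note [measurable] = measurable_pullback measurable_zero_extension[OF continuous_on_dilation]
  have im: "f ` spherical_ring a b = spherical_ring (a powr k) (b powr k)" using bij by (simp add: bij_betw_def)
  have det: "\<bar>heis_det (D p)\<bar> = (l p)^2" if "p \<in> spherical_ring a b" for p using heis_det_contact[OF that] by simp
  have "(\<integral>\<^sup>+p\<in>f ` spherical_ring a b. ennreal (radial_density p powr (4 / 3)) \<partial>lborel) =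
    (\<integral>\<^sup>+p\<in>spherical_ring a b. ennreal (\<bar>heis_det (D p)\<bar> * radial_density (f p) powr (4 / 3)) \<partial>lborel)"
  proof (rule nn_integral_change_of_variables_heis)
    show "f ` spherical_ring a b \<in> sets borel" unfolding im using open_spherical_ring[OF a' b'] by auto
    show "inj_on f (spherical_ring a b)" using bij by (simp add: bij_betw_def)
    show "(f has_derivative D p) (at p within spherical_ring a b)" if "p \<in> spherical_ring a b" for p
      using D[OF that] by (rule has_derivative_at_withinI)
    have "(\<lambda>p. indicator (spherical_ring a b) p * (\<bar>heis_det (D p)\<bar> * radial_density (f p) powr (4 / 3)))
      = (\<lambda>p. indicator (spherical_ring a b) p * ((zero_extension l p)^2 * radial_density (zero_extension f p) powr (4 / 3)))"
      by (auto simp: fun_eq_iff indicator_def det zero_extension_def)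
    also have "\<dots> \<in> borel_measurable borel" by measurable
    finally show "(\<lambda>p. indicator (spherical_ring a b) p * (\<bar>heis_det (D p)\<bar> * radial_density (f p) powr (4 / 3))) \<in> borel_measurable borel" .
  qed auto
  also have "\<dots> = (\<integral>\<^sup>+p\<in>spherical_ring a b. ennreal (radial_density (f p) powr (4 / 3) * (l p)^2) \<partial>lborel)"
    by (intro nn_integral_cong) (auto simp: indicator_def det mult.commute)
  finally have "(\<integral>\<^sup>+p\<in>spherical_ring a b. ennreal (radial_density (f p) powr (4 / 3) * (l p)^2) \<partial>lborel)
    = ennreal (2 * pi * (ln (b powr k) - ln (a powr k))) * tail_mass"
    unfolding im using a ab k by (subst (asm) radial_mass_eq) (auto intro: powr_less_mono2)
  also have "2 * pi * (ln (b powr k) - ln (a powr k)) = k * (2 * pi * (ln b - ln a))"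
    using a b by (simp add: ln_powr algebra_simps)
  also have "ennreal (k * (2 * pi * (ln b - ln a))) = ennreal k * ennreal (2 * pi * (ln b - ln a))"
    using k by (simp add: ennreal_mult')
  finally show ?thesis unfolding radial_mass_eq[OF a ab] by (simp add: mult.assoc)
qed

text \<open>
The curve estimate is integrated over the base of the chart after Young's inequality has been
applied under the integral sign. The total mass \<open>m\<close> then appears on both sides, with the factors
\<open>1\<close> and \<open>1/4\<close>.
\<close>

theorem distortion_integral_ge:
  "ennreal (k powr (- 1 / 3)) * radial_mass a b
   \<le> distortion_mass a b f"
proof -
  note [measurable] = measurable_pullback measurable_zero_extension[OF continuous_on_dilation] measurable_zero_extension[OF continuous_on_distortion]
  define S where "S = base_strip (2 * ln a) (2 * ln b)"
  define m where "m = radial_mass a b"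
  define M where "M = distortion_mass a b f"
  define h1 where "h1 p = indicator (spherical_ring a b) p * (radial_density (zero_extension f p) powr (4 / 3) * (zero_extension l p)^2)" for p
  define h2 where "h2 p = indicator (spherical_ring a b) p * (zero_extension (distortion f) p powr (2 / 3) * radial_density p powr (4 / 3))" for p
  define h where "h p = 1 / (4 * k) * h1 p + 3 / 4 * k powr (1 / 3) * h2 p" for p
  have [measurable]: "h1 \<in> borel_measurable borel" "h2 \<in> borel_measurable borel"
    unfolding h1_def[abs_def] h2_def[abs_def] by measurable
  have [measurable]: "h \<in> borel_measurable borel" unfolding h_def[abs_def] by measurable
  have nn: "0 \<le> h1 p" "0 \<le> h2 p" "0 \<le> h p" for p using k by (simp_all add: h1_def h2_def h_def)
  have i1: "(\<integral>\<^sup>+p\<in>spherical_ring a b. ennreal (h1 p) \<partial>lborel) = ennreal k * m"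
    unfolding m_def pullback_mass[symmetric]
    by (intro nn_integral_cong) (auto simp: h1_def indicator_def zero_extension_def)
  have i2: "(\<integral>\<^sup>+p\<in>spherical_ring a b. ennreal (h2 p) \<partial>lborel) = M"
    unfolding M_def by (intro nn_integral_cong) (auto simp: h2_def indicator_def zero_extension_def)
  have hp: "ennreal (h p) = ennreal (1 / (4 * k)) * ennreal (h1 p) + ennreal (3 / 4 * k powr (1 / 3)) * ennreal (h2 p)" for p
  proof -
    have "ennreal (h p) = ennreal (1 / (4 * k) * h1 p) + ennreal (3 / 4 * k powr (1 / 3) * h2 p)"
      unfolding h_def using k nn by (intro ennreal_plus) auto
    moreover have "ennreal (1 / (4 * k) * h1 p) = ennreal (1 / (4 * k)) * ennreal (h1 p)"
      "ennreal (3 / 4 * k powr (1 / 3) * h2 p) = ennreal (3 / 4 * k powr (1 / 3)) * ennreal (h2 p)"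
      using k by (intro ennreal_mult'; simp)+
    ultimately show ?thesis by (simp only:)
  qed
  have "(\<integral>\<^sup>+p\<in>spherical_ring a b. ennreal (h p) \<partial>lborel) =
     (\<integral>\<^sup>+p. ennreal (1 / (4 * k)) * (ennreal (h1 p) * indicator (spherical_ring a b) p)
        + ennreal (3 / 4 * k powr (1 / 3)) * (ennreal (h2 p) * indicator (spherical_ring a b) p) \<partial>lborel)"
    unfolding hp by (simp only: distrib_right mult.assoc)
  also have "\<dots> = ennreal (1 / (4 * k)) * (\<integral>\<^sup>+p\<in>spherical_ring a b. ennreal (h1 p) \<partial>lborel)
     + ennreal (3 / 4 * k powr (1 / 3)) * (\<integral>\<^sup>+p\<in>spherical_ring a b. ennreal (h2 p) \<partial>lborel)"
    by (subst nn_integral_add) (auto simp: nn_integral_cmult)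
  also have "\<dots> = ennreal (1 / 4) * m + ennreal (3 / 4 * k powr (1 / 3)) * M"
    unfolding i1 i2 using k by (simp add: mult.assoc[symmetric] ennreal_mult'[symmetric])
  finally have split_integral: "(\<integral>\<^sup>+p\<in>spherical_ring a b. ennreal (h p) \<partial>lborel) = ennreal (1 / 4) * m + ennreal (3 / 4 * k powr (1 / 3)) * M" .
  have Sm [measurable]: "S \<in> sets borel" by (simp add: S_def)
  have pt: "ennreal (3 / 4) * tail_mass \<le> (\<integral>\<^sup>+u. ennreal (3 / 4 * (norm (fst (chart (c, u))))^4 * h (chart (c, u))) \<partial>lborel)"
    if c: "c \<in> S" for c
  proof -
    define H where "H u = radial_density (f (chart (c, u))) powr (1 / 3) * sqrt (distortion f (chart (c, u)) * l (chart (c, u)))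
        * (norm (fst (chart (c, u))) ^ 3 / gauge (chart (c, u)))" for u
    have mem: "chart (c, u) \<in> spherical_ring a b" for u
      using chart_image[OF a b] c unfolding S_def by (auto dest!: equalityD1 simp: subset_iff)
    have Hh: "H u \<le> (norm (fst (chart (c, u))))^4 * h (chart (c, u))" for u
    proof -
      define p where "p = chart (c, u)"
      have p: "p \<in> spherical_ring a b" using mem by (simp add: p_def)
      define n where "n = norm (fst p)"
      have n: "0 < n" by (simp add: n_def p_def)
      have "n ^ 3 / gauge p = n^4 * radial_density p"
        using n by (simp add: radial_density_def n_def[symmetric] power3_eq_cube power4_eq_xxxx)
      hence "H u = n^4 * (radial_density (f p) powr (1 / 3) * sqrt (distortion f p * l p) * radial_density p)"
        by (simp add: H_def p_def[symmetric] n_def[symmetric])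
      also have "\<dots> \<le> n^4 * (radial_density (f p) powr (4 / 3) * (l p)^2 / (4 * k)
          + 3 / 4 * k powr (1 / 3) * (distortion f p powr (2 / 3) * radial_density p powr (4 / 3)))"
        using distortion_dilation(1)[OF p] l_pos[OF p] k by (intro mult_left_mono Young_4_density) auto
      also have "\<dots> = n^4 * h p" using p by (simp add: h_def h1_def h2_def zero_extension_def)
      finally show ?thesis by (simp add: p_def n_def)
    qed
    have [measurable]: "(\<lambda>u. ennreal ((norm (fst (chart (c, u))))^4 * h (chart (c, u)))) \<in> borel_measurable borel"
    proof -
      have 1: "(\<lambda>u. chart (c, u)) \<in> borel_measurable borel" by (intro borel_measurable_continuous_onI continuous_intros)
      have [measurable]: "(\<lambda>u. h (chart (c, u))) \<in> borel_measurable borel" by (rule measurable_compose[OF 1]) measurable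
      have [measurable]: "(\<lambda>u. norm (fst (chart (c, u)))) \<in> borel_measurable borel"
        by (intro borel_measurable_continuous_onI continuous_intros)
      show ?thesis by measurable
    qed
    have "tail_mass \<le> (\<integral>\<^sup>+u. ennreal (H u) \<partial>lborel)"
      unfolding tail_mass_def H_def using c by (intro curve_estimate) (simp add: S_def)
    also have "\<dots> \<le> (\<integral>\<^sup>+u. ennreal ((norm (fst (chart (c, u))))^4 * h (chart (c, u))) \<partial>lborel)"
      using Hh by (intro nn_integral_mono ennreal_leI)
    finally have "ennreal (3 / 4) * tail_mass \<le> ennreal (3 / 4) * (\<integral>\<^sup>+u. ennreal ((norm (fst (chart (c, u))))^4 * h (chart (c, u))) \<partial>lborel)"
      by (rule mult_left_mono) simp
    also have "\<dots> = (\<integral>\<^sup>+u. ennreal (3 / 4) * ennreal ((norm (fst (chart (c, u))))^4 * h (chart (c, u))) \<partial>lborel)"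
      by (rule nn_integral_cmult[symmetric]) measurable
    also have "\<dots> = (\<integral>\<^sup>+u. ennreal (3 / 4 * (norm (fst (chart (c, u))))^4 * h (chart (c, u))) \<partial>lborel)"
      by (intro nn_integral_cong) (simp only: mult.assoc ennreal_mult'[of "3/4"])
    finally show ?thesis .
  qed
  have "m = (\<integral>\<^sup>+c\<in>S. (ennreal (3 / 4) * tail_mass) \<partial>lborel)"
    unfolding m_def radial_mass_eq[OF a ab] S_def nn_integral_base_strip_const[OF a ab] ..
  also have "\<dots> \<le> (\<integral>\<^sup>+c\<in>S. (\<integral>\<^sup>+u. ennreal (3 / 4 * (norm (fst (chart (c, u))))^4 * h (chart (c, u))) \<partial>lborel) \<partial>lborel)"
    using pt by (intro nn_integral_mono) (auto simp: indicator_def)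
  also have "\<dots> = (\<integral>\<^sup>+p\<in>spherical_ring a b. ennreal (h p) \<partial>lborel)"
    unfolding S_def by (rule nn_integral_spherical_ring[OF a b, symmetric]) (use nn in auto)
  finally have ineq: "m \<le> ennreal (1 / 4) * m + ennreal (3 / 4 * k powr (1 / 3)) * M" unfolding split_integral .
  obtain x where x: "0 < x" "m = ennreal x" unfolding m_def by (rule radial_mass_real[OF a ab])
  show ?thesis unfolding m_def[symmetric] M_def[symmetric]
  proof (cases M)
    case (real y)
    have "ennreal x \<le> ennreal (1 / 4 * x + 3 / 4 * k powr (1 / 3) * y)"
      using ineq x real k by (simp add: ennreal_mult'[symmetric] ennreal_plus[symmetric] del: ennreal_plus)
    hence "x \<le> 1 / 4 * x + 3 / 4 * k powr (1 / 3) * y" using x real by (subst (asm) ennreal_le_iff) auto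
    hence "x \<le> k powr (1 / 3) * y" by simp
    hence "k powr (- 1 / 3) * x \<le> k powr (- 1 / 3) * (k powr (1 / 3) * y)" by (intro mult_left_mono) auto
    also have "\<dots> = y" using k by (simp add: mult.assoc[symmetric] powr_add[symmetric])
    finally show "ennreal (k powr (- 1 / 3)) * m \<le> M" using x real by (simp add: ennreal_mult'[symmetric] ennreal_leI)
  qed simp
qed

end

section \<open>Mean and maximal distortion\<close>

lemma ring_maps_contact:
  assumes ab: "0 < a" "a < b" and k: "0 < k" and f: "f \<in> ring_maps a b k"
  obtains D D2 l where "ring_contact a b f D D2 l k"
proof -
  have b: "0 < b" using ab by simp
  have op: "op_contact_transformation (spherical_ring a b) (spherical_ring (a powr k) (b powr k)) f"
    using f by (simp add: ring_maps_def contact_quasiconformal_def)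
  obtain D D2 l where c: "contact_C2 (spherical_ring a b) f D D2 l"
    using contact_C2_ex[OF op open_spherical_ring[OF ab(1) b]] .
  interpret contact_C2 "spherical_ring a b" f D D2 l by (rule c)
  have "ring_contact a b f D D2 l k"
    by unfold_locales (use ab k f op in \<open>auto simp: ring_maps_def op_contact_transformation_def C2_diffeomorphism_def\<close>)
  thus ?thesis by (rule that)
qed

lemma rho0_powr:
  assumes ab: "0 < a" "a < b" and p: "p \<in> spherical_ring a b"
  shows "rho0 a b p powr (4 / 3) = (1 / (4 * pi * ln (b / a))) powr (4 / 3) * radial_density p powr (4 / 3)"
proof -
  obtain z t where zt: "p = (z, t)" by fastforce
  have "norm (complex_of_real ((norm z)^2) - \<i> * complex_of_real t) = gauge (z, t)"
  proof -
    have "complex_of_real ((norm z)^2) - \<i> * complex_of_real t = Complex ((norm z)^2) (- t)"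
      by (simp add: complex_eq_iff)
    thus ?thesis by (simp only: complex_norm gauge_def fst_conv snd_conv) simp
  qed
  hence "rho0 a b p = 1 / (4 * pi * ln (b / a)) * radial_density p"
    using p by (simp add: rho0_def radial_density_def zt)
  thus ?thesis by (simp only: powr_mult)
qed

lemma mean_distortion_ratio:
  assumes ab: "0 < a" "a < b"
    and K: "(\<lambda>p. indicator (spherical_ring a b) p * distortion f p) \<in> borel_measurable borel"
  shows "mean_distortion_2_3 (spherical_ring a b) f (rho0 a b) =
    distortion_mass a b f /
    radial_mass a b"
proof -
  define C where "C = (1 / (4 * pi * ln (b / a))) powr (4 / 3)"
  have "0 < 4 * pi * ln (b / a)" using ab by simp
  hence C: "0 < C" unfolding C_def by (metis divide_pos_pos powr_gt_zero less_irrefl zero_less_one)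
  have [measurable]: "spherical_ring a b \<in> sets borel" using open_spherical_ring ab by auto
  define M where "M = distortion_mass a b f"
  define m where "m = radial_mass a b"
  have num: "(\<integral>\<^sup>+p\<in>spherical_ring a b. ennreal (distortion f p powr (2/3) * rho0 a b p powr (4/3)) \<partial>lborel) = ennreal C * M"
  proof -
    define F where "F p = ennreal ((indicator (spherical_ring a b) p * distortion f p) powr (2 / 3) * radial_density p powr (4 / 3)) * indicator (spherical_ring a b) p" for p
    have [measurable]: "F \<in> borel_measurable borel" unfolding F_def using K by measurable
    have "ennreal (distortion f p powr (2/3) * rho0 a b p powr (4/3)) * indicator (spherical_ring a b) p = ennreal C * F p" for p
    proof (cases "p \<in> spherical_ring a b")
      case True
      have "distortion f p powr (2/3) * rho0 a b p powr (4/3) = C * (distortion f p powr (2 / 3) * radial_density p powr (4 / 3))"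
        unfolding rho0_powr[OF ab True] C_def[symmetric] by simp
      hence "ennreal (distortion f p powr (2/3) * rho0 a b p powr (4/3))
          = ennreal C * ennreal (distortion f p powr (2 / 3) * radial_density p powr (4 / 3))"
        using C by (simp only:) (intro ennreal_mult', simp)
      moreover have "F p = ennreal (distortion f p powr (2 / 3) * radial_density p powr (4 / 3))" "indicator (spherical_ring a b) p = (1 :: ennreal)"
        using True by (simp_all add: F_def)
      ultimately show ?thesis by (simp only: mult_1_right)
    qed (simp add: F_def)
    hence "(\<integral>\<^sup>+p\<in>spherical_ring a b. ennreal (distortion f p powr (2/3) * rho0 a b p powr (4/3)) \<partial>lborel) = ennreal C * (\<integral>\<^sup>+p. F p \<partial>lborel)"
      by (simp add: nn_integral_cmult)
    also have "(\<integral>\<^sup>+p. F p \<partial>lborel) = M" unfolding M_def by (intro nn_integral_cong) (auto simp: F_def indicator_def)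
    finally show ?thesis .
  qed
  have den: "(\<integral>\<^sup>+p\<in>spherical_ring a b. ennreal (rho0 a b p powr (4/3)) \<partial>lborel) = ennreal C * m"
  proof -
    have "ennreal (rho0 a b p powr (4/3)) * indicator (spherical_ring a b) p = ennreal C * (ennreal (radial_density p powr (4 / 3)) * indicator (spherical_ring a b) p)" for p
      using C by (cases "p \<in> spherical_ring a b") (simp_all add: rho0_powr[OF ab] C_def[symmetric] ennreal_mult')
    thus ?thesis unfolding m_def by (simp add: nn_integral_cmult)
  qed
  obtain x where x: "0 < x" "m = ennreal x" unfolding m_def by (rule radial_mass_real[OF ab])
  have "ennreal C * M / (ennreal C * m) = M / m"
  proof (cases M)
    case (real y)
    thus ?thesis using C x by (simp add: ennreal_mult'[symmetric] divide_ennreal)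
  next
    case top
    thus ?thesis using C x by (simp add: ennreal_mult_top ennreal_mult'[symmetric] ennreal_top_divide)
  qed
  thus ?thesis unfolding mean_distortion_2_3_def num den by (simp add: M_def m_def)
qed

lemma (in ring_contact) measurable_distortion:
  "(\<lambda>p. indicator (spherical_ring a b) p * distortion f p) \<in> borel_measurable borel"
  using borel_measurable_continuous_on_indicator[OF measurable_ring continuous_on_distortion] by simp

lemma (in ring_contact) mean_distortion_ge:
  "ennreal (k powr (- 1 / 3)) \<le> mean_distortion_2_3 (spherical_ring a b) f (rho0 a b)"
proof -
  define M where "M = distortion_mass a b f"
  define m where "m = radial_mass a b"
  obtain x where x: "0 < x" "m = ennreal x" unfolding m_def by (rule radial_mass_real[OF a ab])
  have "ennreal (k powr (- 1 / 3)) * m \<le> M" using distortion_integral_ge by (simp add: M_def m_def)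
  hence "ennreal (k powr (- 1 / 3)) * m / m \<le> M / m" by (rule divide_right_mono_ennreal)
  moreover have "ennreal (k powr (- 1 / 3)) * m / m = ennreal (k powr (- 1 / 3))"
    using x by (simp add: ennreal_mult'[symmetric] divide_ennreal)
  ultimately show ?thesis
    unfolding mean_distortion_ratio[OF a ab measurable_distortion] M_def m_def by simp
qed

text \<open>
If the essential supremum were smaller, a bound \<open>s < k^(-1/2)\<close> of the distortion almost everywhere
would make the integral of \<open>K^(2/3) r^(4/3)\<close> too small.
\<close>

lemma (in ring_contact) max_distortion_ge:
  "ereal (k powr (- 1 / 2)) \<le> max_distortion (spherical_ring a b) f"
proof (rule ccontr)
  assume "\<not> ?thesis"
  hence "max (max_distortion (spherical_ring a b) f) 0 < ereal (k powr (- 1 / 2))" using k by simp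
  then obtain s where s: "max (max_distortion (spherical_ring a b) f) 0 < ereal s" "ereal s < ereal (k powr (- 1 / 2))"
    using ereal_dense2 by blast
  have s0: "0 < s" "s < k powr (- 1 / 2)" using s by auto
  have "AE p in restrict_space lborel (spherical_ring a b). ereal (distortion f p) \<le> max_distortion (spherical_ring a b) f"
    unfolding max_distortion_def by (rule esssup_AE)
  hence "AE p in restrict_space lborel (spherical_ring a b). distortion f p \<le> s"
  proof eventually_elim
    case (elim p)
    moreover have "max_distortion (spherical_ring a b) f < ereal s" using s(1) by simp
    ultimately have "ereal (distortion f p) < ereal s" by (rule le_less_trans)
    thus ?case by simp
  qed
  hence ae: "AE p in lborel. p \<in> spherical_ring a b \<longrightarrow> distortion f p \<le> s"
    by (simp add: AE_restrict_space_iff)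
  define m where "m = radial_mass a b"
  define M where "M = distortion_mass a b f"
  have "M \<le> (\<integral>\<^sup>+p. ennreal (s powr (2 / 3)) * (ennreal (radial_density p powr (4 / 3)) * indicator (spherical_ring a b) p) \<partial>lborel)"
    unfolding M_def
  proof (rule nn_integral_mono_AE, use ae in eventually_elim)
    case (elim p)
    show ?case
    proof (cases "p \<in> spherical_ring a b")
      case True
      have "distortion f p powr (2 / 3) \<le> s powr (2 / 3)"
        using elim True distortion_dilation(1)[OF True] by (intro powr_mono2) auto
      hence "distortion f p powr (2 / 3) * radial_density p powr (4 / 3) \<le> s powr (2 / 3) * radial_density p powr (4 / 3)"
        by (intro mult_right_mono) auto
      thus ?thesis using True by (simp add: ennreal_mult'[symmetric] ennreal_leI)
    qed simp
  qed
  also have "\<dots> = ennreal (s powr (2 / 3)) * m" unfolding m_def by (rule nn_integral_cmult) measurable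
  finally have "ennreal (k powr (- 1 / 3)) * m \<le> ennreal (s powr (2 / 3)) * m"
    using distortion_integral_ge by (simp add: M_def m_def)
  moreover obtain x where x: "0 < x" "m = ennreal x" unfolding m_def by (rule radial_mass_real[OF a ab])
  ultimately have "k powr (- 1 / 3) * x \<le> s powr (2 / 3) * x"
    by (simp add: ennreal_mult'[symmetric])
  hence le: "k powr (- 1 / 3) \<le> s powr (2 / 3)" using x by simp
  have "s powr (2 / 3) < (k powr (- 1 / 2)) powr (2 / 3)" using s0 by (intro powr_less_mono2) auto
  also have "\<dots> = k powr (- 1 / 3)" by (simp add: powr_powr)
  finally show False using le by simp
qed

lemma esssup_restrict_lborel_cong:
  assumes "\<And>p. p \<in> \<Omega> \<Longrightarrow> f p = g p"
  shows "esssup (restrict_space lborel \<Omega>) f = esssup (restrict_space lborel \<Omega>) g"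
proof -
  have sp: "p \<in> \<Omega>" if "p \<in> space (restrict_space lborel \<Omega>)" for p using that by (simp add: space_restrict_space)
  have m: "f \<in> borel_measurable (restrict_space lborel \<Omega>) \<longleftrightarrow> g \<in> borel_measurable (restrict_space lborel \<Omega>)"
    using assms sp by (intro measurable_cong) auto
  show ?thesis
  proof (cases "f \<in> borel_measurable (restrict_space lborel \<Omega>)")
    case True
    thus ?thesis using m assms sp by (intro esssup_AE_cong AE_I2) auto
  qed (use m in \<open>simp add: esssup_non_measurable\<close>)
qed

text \<open>
The distortion is at most \<open>k^(-2)\<close> and takes this value on the plane \<open>t = 0\<close>. By continuity it exceeds
any smaller number on a nonempty open set, which is not a null set.
\<close>

lemma max_distortion_stretch:
  assumes ab: "0 < a" "a < b" and k: "0 < k" "k < 1"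
  shows "max_distortion (spherical_ring a b) (stretch k) = ereal (1 / k^2)"
proof -
  have b: "0 < b" using ab by simp
  define \<Omega> where "\<Omega> = spherical_ring a b"
  obtain D D2 where "contact_C2 (- {0}) (stretch k) D D2 (\<lambda>p. exp (2 * stretch_log k p))"
    using stretch_contact_C2[OF k(1)] by metis
  then interpret contact_C2 "- {0}" "stretch k" D D2 "\<lambda>p. exp (2 * stretch_log k p)" .
  have sub: "\<Omega> \<subseteq> - {0}" using spherical_ring_nonzero[OF ab(1) b, of 0] unfolding \<Omega>_def by auto
  have cont: "continuous_on \<Omega> (distortion (stretch k))" by (rule continuous_on_subset[OF continuous_on_distortion sub])
  have op: "open \<Omega>" using open_spherical_ring[OF ab(1) b] by (simp add: \<Omega>_def)
  have "distortion (stretch k) \<in> borel_measurable (restrict_space borel \<Omega>)"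
    using cont by (rule borel_measurable_continuous_on_restrict)
  hence meas: "(\<lambda>p. ereal (distortion (stretch k) p)) \<in> borel_measurable (restrict_space lborel \<Omega>)"
    by (intro borel_measurable_ereal) (simp add: measurable_def space_restrict_space sets_restrict_space)
  have upper: "distortion (stretch k) p \<le> 1 / k^2" if "p \<in> \<Omega>" for p
  proof -
    have p: "p \<noteq> 0" using that sub by auto
    have "k^2 * (gauge p)^2 \<le> aniso_gauge_sq k p"
      unfolding zsq_gauge[symmetric] aniso_gauge_sq_def distrib_left
      using k by (intro add_left_mono mult_left_le_one_le) (auto simp: power_le_one)
    thus ?thesis unfolding distortion_stretch[OF k(1) less_imp_le[OF k(2)] p]
      using k aniso_gauge_sq_pos[OF k(1) p] by (simp add: field_simps)
  qed
  have "esssup (restrict_space lborel \<Omega>) (\<lambda>p. ereal (distortion (stretch k) p)) \<le> ereal (1 / k^2)"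
    using op by (intro esssup_I meas AE_I2) (auto simp: space_restrict_space intro: upper)
  moreover have "ereal (1 / k^2) \<le> esssup (restrict_space lborel \<Omega>) (\<lambda>p. ereal (distortion (stretch k) p))"
  proof (rule ccontr)
    assume "\<not> ?thesis"
    hence "esssup (restrict_space lborel \<Omega>) (\<lambda>p. ereal (distortion (stretch k) p)) < ereal (1 / k^2)"
      by (simp only: not_le)
    from ereal_dense2[OF this] obtain s
      where s: "esssup (restrict_space lborel \<Omega>) (\<lambda>p. ereal (distortion (stretch k) p)) < ereal s" "ereal s < ereal (1 / k^2)"
      by blast
    have "AE p in restrict_space lborel \<Omega>. ereal (distortion (stretch k) p) \<le> esssup (restrict_space lborel \<Omega>) (\<lambda>p. ereal (distortion (stretch k) p))"
      by (rule esssup_AE)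
    hence "AE p in restrict_space lborel \<Omega>. distortion (stretch k) p \<le> s"
    proof eventually_elim
      case (elim p)
      hence "ereal (distortion (stretch k) p) < ereal s" using s(1) by (rule le_less_trans)
      thus ?case by simp
    qed
    hence ae: "AE p in lborel. p \<in> \<Omega> \<longrightarrow> distortion (stretch k) p \<le> s"
      using op by (simp add: AE_restrict_space_iff)
    define U where "U = {p \<in> \<Omega>. s < distortion (stretch k) p}"
    have "open U"
    proof -
      have "U = \<Omega> \<inter> distortion (stretch k) -` {s<..}" by (auto simp: U_def)
      thus ?thesis using continuous_open_preimage[OF cont op, of "{s<..}"] by simp
    qed
    moreover have "negligible U"
    proof -
      have "AE p in lborel. p \<notin> U" using ae by (auto simp: U_def elim!: eventually_mono)
      hence "U \<in> null_sets lborel" using \<open>open U\<close> by (subst (asm) AE_iff_null_sets[symmetric]) auto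
      thus ?thesis using \<open>open U\<close> by (simp add: negligible_iff_null_sets null_sets_completion_iff)
    qed
    \<comment> \<open>the point with \<open>u = 0\<close> on the sphere of radius the geometric mean of \<open>a\<close> and \<open>b\<close>\<close>
    moreover have "chart (Complex (ln a + ln b) 0, 0) \<in> U"
    proof -
      have "chart (Complex (ln a + ln b) 0, 0) \<in> chart ` (base_strip (2 * ln a) (2 * ln b) \<times> UNIV)"
        using ab by (intro imageI) (simp add: base_strip_def)
      hence "chart (Complex (ln a + ln b) 0, 0) \<in> \<Omega>" unfolding chart_image[OF ab(1) b] \<Omega>_def by simp
      thus ?thesis using s(2) k by (simp add: U_def distortion_stretch_chart)
    qed
    ultimately show False using open_not_negligible by blast
  qed
  ultimately show ?thesis unfolding max_distortion_def \<Omega>_def by (rule antisym)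
qed

text \<open>
In the chart the integrand becomes \<open>(k\<^sup>2 + u\<^sup>2)^(-2/3)\<close>, and \<open>u = k v\<close> reduces it to
\<open>(1 + v\<^sup>2)^(-2/3)\<close> at the cost of the factor \<open>k k^(-4/3)\<close>.
\<close>

lemma mean_distortion_stretch:
  assumes ab: "0 < a" "a < b" and k: "0 < k" "k < 1"
    and K: "(\<lambda>p. indicator (spherical_ring a b) p * distortion (stretch k) p) \<in> borel_measurable borel"
  shows "mean_distortion_2_3 (spherical_ring a b) (stretch k) (rho0 a b) = ennreal (k powr (- 1 / 3))"
proof -
  note [measurable] = K
  have b: "0 < b" using ab by simp
  define S where "S = base_strip (2 * ln a) (2 * ln b)"
  define m where "m = radial_mass a b"
  define h where "h p = (indicator (spherical_ring a b) p * distortion (stretch k) p) powr (2 / 3) * radial_density p powr (4 / 3)" for p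
  have [measurable]: "h \<in> borel_measurable borel" unfolding h_def[abs_def] by measurable
  have k2: "0 < k^2 + u^2" for u using k by (intro add_pos_nonneg) auto
  define V where "V u = (k^2 + u^2) powr (- 2 / 3)" for u :: real
  have [measurable]: "V \<in> borel_measurable borel" unfolding V_def by measurable
  have "distortion_mass a b (stretch k)
     = (\<integral>\<^sup>+p\<in>spherical_ring a b. ennreal (h p) \<partial>lborel)"
    by (intro nn_integral_cong) (auto simp: h_def indicator_def)
  also have "\<dots> = (\<integral>\<^sup>+c\<in>S. (\<integral>\<^sup>+u. ennreal (3 / 4 * (norm (fst (chart (c, u))))^4 * h (chart (c, u))) \<partial>lborel) \<partial>lborel)"
    unfolding S_def by (rule nn_integral_spherical_ring[OF ab(1) b]) (auto simp: h_def)
  also have "\<dots> = (\<integral>\<^sup>+c\<in>S. (ennreal (3 / 4) * (\<integral>\<^sup>+u. ennreal (V u) \<partial>lborel)) \<partial>lborel)"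
  proof (intro nn_integral_cong)
    fix c
    show "(\<integral>\<^sup>+u. ennreal (3 / 4 * (norm (fst (chart (c, u))))^4 * h (chart (c, u))) \<partial>lborel) * indicator S c
      = ennreal (3 / 4) * (\<integral>\<^sup>+u. ennreal (V u) \<partial>lborel) * indicator S c"
    proof (cases "c \<in> S")
      case True
      have mem: "chart (c, u) \<in> spherical_ring a b" for u
        using chart_image[OF ab(1) b] True unfolding S_def by (auto dest!: equalityD1 simp: subset_iff)
      have "3 / 4 * (norm (fst (chart (c, u))))^4 * h (chart (c, u)) = 3 / 4 * V u" for u
      proof -
        have "3 / 4 * (norm (fst (chart (c, u))))^4 * h (chart (c, u))
          = 3 / 4 * (((1 + u^2) / (k^2 + u^2)) powr (2 / 3) * ((norm (fst (chart (c, u))))^4 * radial_density (chart (c, u)) powr (4 / 3)))"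
          using mem k by (simp add: h_def distortion_stretch_chart)
        also have "\<dots> = 3 / 4 * (((1 + u^2) / (k^2 + u^2)) powr (2 / 3) * tail_weight u)"
          unfolding radial_density_chart by simp
        also have "((1 + u^2) / (k^2 + u^2)) powr (2 / 3) * tail_weight u = V u"
          using k2[of u] by (simp add: V_def powr_divide powr_minus field_simps)
        finally show ?thesis .
      qed
      hence "(\<integral>\<^sup>+u. ennreal (3 / 4 * (norm (fst (chart (c, u))))^4 * h (chart (c, u))) \<partial>lborel) = (\<integral>\<^sup>+u. ennreal (3 / 4) * ennreal (V u) \<partial>lborel)"
        by (simp only: ennreal_mult'[of "3 / 4"])
      also have "\<dots> = ennreal (3 / 4) * (\<integral>\<^sup>+u. ennreal (V u) \<partial>lborel)" by (rule nn_integral_cmult) measurable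
      finally show ?thesis by simp
    qed simp
  qed
  also have "(\<integral>\<^sup>+u. ennreal (V u) \<partial>lborel) = ennreal (k powr (- 1 / 3)) * tail_mass"
  proof -
    have "(\<integral>\<^sup>+u. ennreal (V u) \<partial>lborel) = ennreal k * (\<integral>\<^sup>+u. ennreal (V (0 + k * u)) \<partial>lborel)"
      using nn_integral_real_affine[of "\<lambda>u. ennreal (V u)" k 0] k by simp
    also have "(\<lambda>u. ennreal (V (0 + k * u))) = (\<lambda>u. ennreal (k powr (- 4 / 3)) * ennreal (tail_weight u))"
    proof
      fix u
      have "V (0 + k * u) = (k^2 * (1 + u^2)) powr (- 2 / 3)" by (simp add: V_def power_mult_distrib distrib_left)
      also have "\<dots> = (k^2) powr (- 2 / 3) * tail_weight u" by (simp add: powr_mult)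
      also have "(k^2) powr (- 2 / 3) = k powr (- 4 / 3)" using k by (simp add: powr_powr flip: powr_numeral)
      finally show "ennreal (V (0 + k * u)) = ennreal (k powr (- 4 / 3)) * ennreal (tail_weight u)"
        by (simp add: ennreal_mult')
    qed
    also have "ennreal k * (\<integral>\<^sup>+u. ennreal (k powr (- 4 / 3)) * ennreal (tail_weight u) \<partial>lborel) = ennreal (k * k powr (- 4 / 3)) * tail_mass"
      unfolding tail_mass_def using k by (subst nn_integral_cmult) (auto simp: ennreal_mult' mult.assoc)
    also have "k * k powr (- 4 / 3) = k powr (- 1 / 3)"
      using k powr_add[of k 1 "- 4 / 3"] by simp
    finally show ?thesis .
  qed
  also have "(\<integral>\<^sup>+c\<in>S. (ennreal (3 / 4) * (ennreal (k powr (- 1 / 3)) * tail_mass)) \<partial>lborel)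
      = ennreal (k powr (- 1 / 3)) * (ennreal (2 * pi * (ln b - ln a)) * tail_mass)"
    unfolding S_def nn_integral_base_strip_const[OF ab] by (rule mult.left_commute)
  finally have M: "distortion_mass a b (stretch k)
     = ennreal (k powr (- 1 / 3)) * m" unfolding m_def radial_mass_eq[OF ab] .
  obtain x where x: "0 < x" "m = ennreal x" unfolding m_def by (rule radial_mass_real[OF ab])
  show ?thesis
    unfolding mean_distortion_ratio[OF ab K] M m_def[symmetric] using x by (simp add: ennreal_mult'[symmetric] divide_ennreal)
qed

lemma stretch_ring_maps:
  assumes ab: "0 < a" "a < b" and k: "0 < k" "k < 1"
  shows "stretch k \<in> ring_maps a b k"
  using assms op_contact_stretch[of a b k] stretch_axis_image[of a b k] maps_boundary_stretch[OF k(1)] max_distortion_stretch[OF ab k]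
  by (simp add: ring_maps_def contact_quasiconformal_def)

section \<open>Rotations around the axis\<close>

lemma rotation_eq: "rotation \<theta> p = (fst p * exp (\<i> * complex_of_real \<theta>), snd p)"
  by (simp add: rotation_def split_beta)

lemma norm_rotation_factor: "norm (exp (\<i> * complex_of_real \<theta>)) = 1"
  by (simp add: norm_exp_eq_Re)

lemma bounded_linear_rotation: "bounded_linear (rotation \<theta>)"
proof -
  have "bounded_linear (\<lambda>p. (fst p * exp (\<i> * complex_of_real \<theta>), snd p))"
    by (intro bounded_linear_Pair bounded_linear_mult_const bounded_linear_fst bounded_linear_snd)
  thus ?thesis by (simp add: rotation_eq[abs_def])
qed

lemma rotation_inverse: "rotation \<theta> (rotation (- \<theta>) p) = p" "rotation (- \<theta>) (rotation \<theta> p) = p"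
  by (simp_all add: rotation_eq mult.assoc flip: exp_add)

lemma norm_fst_rotation: "norm (fst (rotation \<theta> p)) = norm (fst p)"
  by (simp add: rotation_eq norm_mult norm_rotation_factor)

lemma rotation_mem_ring: "rotation \<theta> p \<in> spherical_ring a b \<longleftrightarrow> p \<in> spherical_ring a b"
  using norm_fst_rotation[of \<theta> p] by (simp add: spherical_ring_def split_beta) (simp add: rotation_eq)

lemma rotation_mem_sphere: "rotation \<theta> p \<in> koranyi_sphere r \<longleftrightarrow> p \<in> koranyi_sphere r"
  using norm_fst_rotation[of \<theta> p] by (simp add: koranyi_sphere_def split_beta) (simp add: rotation_eq)

lemma rotation_mem_axis: "rotation \<theta> p \<in> vertical_axis \<longleftrightarrow> p \<in> vertical_axis"
  by (simp add: vertical_axis_iff rotation_eq)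

lemma contact_form_rotation: "contact_form (rotation \<theta> p) (rotation \<theta> v) = contact_form p v"
proof -
  define e where "e = exp (\<i> * complex_of_real \<theta>)"
  have "e * cnj e = 1" unfolding complex_norm_square[symmetric] by (simp add: e_def norm_rotation_factor)
  moreover have "cnj (fst p * e) * (fst v * e) = (e * cnj e) * (cnj (fst p) * fst v)" by (simp add: mult_ac)
  ultimately show ?thesis unfolding contact_form_def rotation_eq e_def[symmetric] fst_conv snd_conv by (simp only: mult_1_left)
qed

lemma dist_rotation: "dist (rotation \<theta> p) (rotation \<theta> q) = dist p q"
proof -
  have "rotation \<theta> p - rotation \<theta> q = rotation \<theta> (p - q)"
    using bounded_linear.linear[OF bounded_linear_rotation] by (simp add: linear_diff)
  moreover have "norm (rotation \<theta> x) = norm x" for x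
    unfolding norm_prod_def norm_fst_rotation by (simp add: rotation_eq)
  ultimately show ?thesis by (simp add: dist_norm)
qed

lemma infdist_rotation: "infdist (rotation \<theta> p) (koranyi_sphere r) = infdist p (koranyi_sphere r)"
proof -
  have "rotation \<theta> ` koranyi_sphere r = koranyi_sphere r"
  proof
    show "koranyi_sphere r \<subseteq> rotation \<theta> ` koranyi_sphere r"
      using rotation_inverse(1) rotation_mem_sphere by (metis image_eqI subsetI)
  qed (use rotation_mem_sphere in blast)
  hence "infdist (rotation \<theta> p) (koranyi_sphere r) = infdist (rotation \<theta> p) (rotation \<theta> ` koranyi_sphere r)" by simp
  also have "\<dots> = infdist p (koranyi_sphere r)"
    by (simp add: infdist_def image_image dist_rotation)
  finally show ?thesis .
qed

lemma Z_fields_mult_right: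
  assumes "(g has_derivative g') (at p)"
  shows "Z_field (\<lambda>q. g q * e) p = Z_field g p * e" "Zbar_field (\<lambda>q. g q * e) p = Zbar_field g p * e"
proof -
  have "frechet_derivative (\<lambda>q. g q * e) (at p) = (\<lambda>v. frechet_derivative g (at p) v * e)"
    using frechet_derivative_at[OF assms] frechet_derivative_at[OF has_derivative_mult_left[OF assms, of e]] by simp
  hence "X_field (\<lambda>q. g q * e) p = X_field g p * e" "Y_field (\<lambda>q. g q * e) p = Y_field g p * e"
    by (simp_all add: X_field_def Y_field_def partial_x_def partial_y_def partial_t_def algebra_simps)
  thus "Z_field (\<lambda>q. g q * e) p = Z_field g p * e" "Zbar_field (\<lambda>q. g q * e) p = Zbar_field g p * e"
    by (simp_all add: Z_field_def Zbar_field_def algebra_simps add_divide_distrib diff_divide_distrib)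
qed

text \<open>
Composition with a rotation multiplies \<open>Z f\<^sub>I\<close> and \<open>Zbar f\<^sub>I\<close> by the same unimodular number.
\<close>

lemma distortion_rotation:
  assumes "(f has_derivative f') (at p)"
  shows "distortion (rotation \<theta> \<circ> f) p = distortion f p"
  unfolding distortion_def beltrami_def o_def rotation_eq fst_conv
  by (simp add: Z_fields_mult_right[OF has_derivative_fst[OF assms]])

lemma rotation_ring_maps:
  assumes ab: "0 < a" "a < b" and f: "f \<in> ring_maps a b k"
  shows "rotation \<theta> \<circ> f \<in> ring_maps a b k"
proof -
  define \<Omega> \<Omega>' where "\<Omega> = spherical_ring a b" and "\<Omega>' = spherical_ring (a powr k) (b powr k)"
  define R where "R = rotation \<theta>"
  have op: "open \<Omega>'" using open_spherical_ring[of "a powr k" "b powr k"] ab by (simp add: \<Omega>'_def)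
  have fc: "op_contact_transformation \<Omega> \<Omega>' f" and fm: "max_distortion \<Omega> f < \<infinity>"
    and fa: "f ` (vertical_axis \<inter> \<Omega>) = vertical_axis \<inter> \<Omega>'"
    and bd: "maps_boundary \<Omega> f (koranyi_sphere a) (koranyi_sphere (a powr k))"
      "maps_boundary \<Omega> f (koranyi_sphere b) (koranyi_sphere (b powr k))"
    using f by (auto simp: ring_maps_def contact_quasiconformal_def \<Omega>_def \<Omega>'_def)
  have bij: "bij_betw f \<Omega> \<Omega>'" and C2: "C2_on \<Omega> f" "C2_on \<Omega>' (inv_into \<Omega> f)"
    using fc by (auto simp: op_contact_transformation_def C2_diffeomorphism_def)
  have bR: "bij_betw R \<Omega>' \<Omega>'"
    by (rule bij_betw_byWitness[where f' = "rotation (- \<theta>)"])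
       (auto simp: R_def \<Omega>'_def rotation_inverse rotation_mem_ring)
  have bRf: "bij_betw (R \<circ> f) \<Omega> \<Omega>'" by (rule bij_betw_trans[OF bij bR])
  have cR: "C2_on S (rotation \<phi>)" for S \<phi> by (rule C2_on_bounded_linear[OF bounded_linear_rotation])
  have C2R: "C2_on \<Omega> (R \<circ> f)"
    unfolding o_def R_def by (rule C2_on_compose[of UNIV, OF cR C2(1)]) simp
  have "C2_on \<Omega>' (inv_into \<Omega> (R \<circ> f))"
  proof (rule C2_on_cong[OF op])
    show "C2_on \<Omega>' (\<lambda>p. inv_into \<Omega> f (rotation (- \<theta>) p))"
      by (rule C2_on_compose[OF C2(2) cR]) (simp add: \<Omega>'_def rotation_mem_ring)
    show "inv_into \<Omega> f (rotation (- \<theta>) p) = inv_into \<Omega> (R \<circ> f) p" if "p \<in> \<Omega>'" for p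
    proof (rule inv_into_f_eq[symmetric])
      have "rotation (- \<theta>) p \<in> f ` \<Omega>" using that bij by (simp add: bij_betw_def) (simp add: \<Omega>'_def rotation_mem_ring)
      thus "inv_into \<Omega> f (rotation (- \<theta>) p) \<in> \<Omega>" "(R \<circ> f) (inv_into \<Omega> f (rotation (- \<theta>) p)) = p"
        by (simp_all add: inv_into_into f_inv_into_f R_def rotation_inverse)
      show "inj_on (R \<circ> f) \<Omega>" using bRf by (simp add: bij_betw_def)
    qed
  qed
  with bRf C2R have diff: "C2_diffeomorphism \<Omega> \<Omega>' (R \<circ> f)" by (simp add: C2_diffeomorphism_def)
  have dR: "(R has_derivative R) (at q)" for q
    unfolding R_def by (rule bounded_linear_imp_has_derivative[OF bounded_linear_rotation])
  have df: "\<exists>f'. (f has_derivative f') (at p)" if "p \<in> \<Omega>" for p using C2(1) that unfolding C2_on_def by blast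
  obtain l where l: "\<forall>p\<in>\<Omega>. 0 < l p"
    "\<forall>p\<in>\<Omega>. \<forall>v. contact_form (f p) (frechet_derivative f (at p) v) = l p * contact_form p v"
    using fc by (auto simp: op_contact_transformation_def)
  have "contact_form ((R \<circ> f) p) (frechet_derivative (R \<circ> f) (at p) v) = l p * contact_form p v" if p: "p \<in> \<Omega>" for p v
  proof -
    obtain f' where f': "(f has_derivative f') (at p)" using df[OF p] by blast
    have "frechet_derivative (R \<circ> f) (at p) = R \<circ> f'"
      using frechet_derivative_at[OF diff_chain_at[OF f' dR]] by simp
    moreover have "frechet_derivative f (at p) = f'" using frechet_derivative_at[OF f'] by simp
    ultimately show ?thesis using l(2)[rule_format, OF p, of v] by (simp add: R_def contact_form_rotation)
  qed
  with diff l(1) have op_c: "op_contact_transformation \<Omega> \<Omega>' (R \<circ> f)"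
    unfolding op_contact_transformation_def by blast
  have "distortion (R \<circ> f) p = distortion f p" if "p \<in> \<Omega>" for p
    using df[OF that] distortion_rotation unfolding R_def by blast
  hence "max_distortion \<Omega> (R \<circ> f) = max_distortion \<Omega> f"
    unfolding max_distortion_def by (intro esssup_restrict_lborel_cong) simp
  hence "contact_quasiconformal \<Omega> \<Omega>' (R \<circ> f)" using op_c fm by (simp add: contact_quasiconformal_def)
  moreover have "(R \<circ> f) ` (vertical_axis \<inter> \<Omega>) = vertical_axis \<inter> \<Omega>'"
  proof -
    have "R ` \<Omega>' = \<Omega>'" using bR by (simp add: bij_betw_def)
    moreover have "R ` (vertical_axis \<inter> \<Omega>') = vertical_axis \<inter> R ` \<Omega>'"
      by (auto simp: R_def rotation_mem_axis)
    ultimately have "R ` (vertical_axis \<inter> \<Omega>') = vertical_axis \<inter> \<Omega>'" by simp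
    thus ?thesis by (simp only: image_comp[symmetric] fa)
  qed
  moreover have "maps_boundary \<Omega> (R \<circ> f) B (koranyi_sphere r)" if "maps_boundary \<Omega> f B (koranyi_sphere r)" for B r
    using that by (simp add: maps_boundary_def R_def infdist_rotation)
  ultimately show ?thesis using bd unfolding ring_maps_def \<Omega>_def \<Omega>'_def R_def by blast
qed

lemma mean_distortion_rotation:
  assumes f: "f \<in> ring_maps a b k"
  shows "mean_distortion_2_3 (spherical_ring a b) (rotation \<theta> \<circ> f) \<rho> = mean_distortion_2_3 (spherical_ring a b) f \<rho>"
proof -
  have "distortion (rotation \<theta> \<circ> f) p = distortion f p" if "p \<in> spherical_ring a b" for p
  proof -
    have "C2_on (spherical_ring a b) f"
      using f by (simp add: ring_maps_def contact_quasiconformal_def op_contact_transformation_def C2_diffeomorphism_def)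
    then obtain D :: "heis \<Rightarrow> heis \<Rightarrow>\<^sub>L heis" where
      "\<forall>p\<in>spherical_ring a b. (f has_derivative blinfun_apply (D p)) (at p)"
      unfolding C2_on_def by blast
    thus ?thesis using distortion_rotation that by blast
  qed
  hence "(\<integral>\<^sup>+p\<in>spherical_ring a b. ennreal (distortion (rotation \<theta> \<circ> f) p powr (2/3) * \<rho> p powr (4/3)) \<partial>lborel)
     = (\<integral>\<^sup>+p\<in>spherical_ring a b. ennreal (distortion f p powr (2/3) * \<rho> p powr (4/3)) \<partial>lborel)"
    by (intro nn_integral_cong) (simp add: indicator_def)
  thus ?thesis by (simp add: mean_distortion_2_3_def)
qed

section \<open>Minimality of the stretch map\<close>

theorem theorem1p3:
  fixes a b k :: real
  assumes "0 < a" and "a < b" and "0 < k" and "k < 1"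
  shows "stretch k \<in> ring_maps a b k \<and>
    k powr (- 1 / 3) =
      real_of_ereal (max_distortion (spherical_ring a b) (stretch k)) powr (1 / 6) \<and>
    ennreal (real_of_ereal (max_distortion (spherical_ring a b) (stretch k)) powr (1 / 6)) =
      mean_distortion_2_3 (spherical_ring a b) (stretch k) (rho0 a b) \<and>
    (\<forall>f \<in> ring_maps a b k.
      mean_distortion_2_3 (spherical_ring a b) (stretch k) (rho0 a b)
        \<le> mean_distortion_2_3 (spherical_ring a b) f (rho0 a b)) \<and>
    (\<forall>\<theta>. rotation \<theta> \<circ> stretch k \<in> ring_maps a b k \<and>
      mean_distortion_2_3 (spherical_ring a b) (rotation \<theta> \<circ> stretch k) (rho0 a b) =
        mean_distortion_2_3 (spherical_ring a b) (stretch k) (rho0 a b)) \<and>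
    (\<forall>f \<in> ring_maps a b k.
      max_distortion (spherical_ring a b) f \<ge>
        ereal (real_of_ereal (max_distortion (spherical_ring a b) (stretch k)) powr (1 / 4)))"
proof -
  note ab = assms(1,2) and k = assms(3,4)
  have mem: "stretch k \<in> ring_maps a b k" by (rule stretch_ring_maps[OF ab k])
  obtain D D2 l where "ring_contact a b (stretch k) D D2 l k" using ring_maps_contact[OF ab k(1) mem] .
  then interpret S: ring_contact a b "stretch k" D D2 l k .
  have max: "real_of_ereal (max_distortion (spherical_ring a b) (stretch k)) = k powr (- 2)"
    using k by (simp add: max_distortion_stretch[OF ab k] powr_minus divide_inverse)
  have mean: "mean_distortion_2_3 (spherical_ring a b) (stretch k) (rho0 a b) = ennreal (k powr (- 1 / 3))"
    by (rule mean_distortion_stretch[OF ab k S.measurable_distortion])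
  have sixth: "(k powr (- 2)) powr (1 / 6) = k powr (- 1 / 3)" and quarter: "(k powr (- 2)) powr (1 / 4) = k powr (- 1 / 2)"
    unfolding powr_powr by simp_all
  have lower: "ennreal (k powr (- 1 / 3)) \<le> mean_distortion_2_3 (spherical_ring a b) f (rho0 a b)
      \<and> ereal (k powr (- 1 / 2)) \<le> max_distortion (spherical_ring a b) f" if f: "f \<in> ring_maps a b k" for f
  proof -
    obtain D D2 l where "ring_contact a b f D D2 l k" using ring_maps_contact[OF ab k(1) f] .
    then interpret F: ring_contact a b f D D2 l k .
    show ?thesis using F.mean_distortion_ge F.max_distortion_ge by blast
  qed
  show ?thesis
    unfolding max mean sixth quarter
    using mem lower rotation_ring_maps[OF ab mem] mean_distortion_rotation[OF mem] mean by simp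
qed

end
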